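(* Assume $p\ge n^\kappa$ for some universal constant $\kappa>0$. Assume that there exist a sequence of constants $B_n\ge1$ and a universal constant $\gamma_1\ge1$ such that $\|X_{t,j}\|_{\psi_{\gamma_1}}\le B_n$ for all $t\in[n]$, $j\in[p]$, and that there exists a universal constant $K_3>0$ such that $\min_{j\in[p]}\mathrm{Var}(n^{-1/2}\sum_{t=1}^nX_{t,j})\ge K_3$. Then $$\varrho_n\lesssim\frac{B_n(D_nD_n^* )^{1/3}(\log p)^{7/6}}{n^{1/6}},$$ where $D_n$ and $D_n^*$ are the maximum degrees of the first-degree and second-degree connections in the dependency graph generated by the sequence $\{X_t\}_{t=1}^n$, respectively.
   Context: Asymptotic setting: for each $n$, $\mathcal X_n=\{X_1,\dots,X_n\}$ is a sequence of (possibly dependent and non-stationary) random vectors $X_t=(X_{t,1},\dots,X_{t,p})^\top\in\mathbb R^p$ with $\mathbb E(X_t)=0$; $p$ and the distribution of the sequence may depend on $n$. A "universal constant" is a constant not depending on $n$ or on any quantity allowed to vary with $n$. For positive sequences, $a_n\lesssim b_n$ means that $\limsup_{n\to\infty}a_n/b_n\le c$ for some universal constant $c>0$. $[m]=\{1,\dots,m\}$. For vectors, $v\le u$ means $v_j\le u_j$ for all $j$. $S_{n,x}=n^{-1/2}\sum_{t=1}^nX_t$, $\Xi=\mathrm{Cov}(S_{n,x})$, and $G\sim N(0,\Xi)$ is independent of $\mathcal X_n$. Define $$\varrho_n=\sup_{u\in\mathbb R^p,\ \nu\in[0,1]}\big|\mathbb P(\sqrt{\nu}\,S_{n,x}+\sqrt{1-\nu}\,G\le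 u)-\mathbb P(G\le u)\big|.$$ For $\gamma>0$ and a real random variable $\xi$, $\|\xi\|_{\psi_\gamma}=\inf\{\lambda>0:\mathbb E[\exp\{(|\xi|/\lambda)^{\gamma}\}-1]\le 1\}$. Dependency graph: an undirected graph $G_n=(V_n,E_n)$ with node set $V_n=[n]$, node $t$ denoting $X_t$, and a set $E_n$ of undirected edges such that $X_t$ and $X_s$ are independent whenever $(t,s)\notin E_n$, with the convention $(t,t)\in E_n$ for all $t\in V_n$. Let $\mathcal N_t=\{s\in V_n:(t,s)\in E_n\}$, $D_n=\max_{t\in[n]}\sum_{s=1}^nI\{(t,s)\in E_n\}$, and $D_n^*=\max_{t\in[n]}\sum_{s=1}^nI\{s\in\cup_{\ell\in\mathcal N_t}\mathcal N_\ell\}$, where $I(\cdot)$ is the indicator function.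
   Formalization: The dependency graph is taken in the standard joint sense (subfamilies of the X_t with no edge between them are independent), since with only pairwise independence of X_t and X_s for non-edges the claim fails, e.g. for products of random signs. *)

theory Defs
  imports "HOL-Probability.Probability"
begin

text \<open>A random vector in \<open>\<real>\<^sup>p\<close> is a measurable map into the product space below. Its values are
  functions on coordinates \<open>1, \<dots>, p\<close>, so that \<open>p\<close> may vary with \<open>n\<close>.\<close>

abbreviation rvec :: "nat \<Rightarrow> (nat \<Rightarrow> real) measure" where
  "rvec p \<equiv> (\<Pi>\<^sub>M j\<in>{1..p}. borel)"

text \<open>The value is in \<^typ>\<open>ennreal\<close> and the expectation is a nonnegative integral: the norm is
  \<open>\<infinity>\<close> if no \<open>l\<close> qualifies, and an infinite exponential moment is never mistaken for \<open>0\<close>.\<close>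

definition psi_norm :: "'a measure \<Rightarrow> real \<Rightarrow> ('a \<Rightarrow> real) \<Rightarrow> ennreal" where
  "psi_norm M \<gamma> \<xi> =
     (INF l\<in>{l. 0 < l \<and> (\<integral>\<^sup>+\<omega>. ennreal (exp ((\<bar>\<xi> \<omega>\<bar> / l) powr \<gamma>) - 1) \<partial>M) \<le> 1}. ennreal l)"

definition covariance :: "'a measure \<Rightarrow> ('a \<Rightarrow> real) \<Rightarrow> ('a \<Rightarrow> real) \<Rightarrow> real" where
  "covariance M Y Z =
     (\<integral>\<omega>. (Y \<omega> - (\<integral>\<omega>'. Y \<omega>' \<partial>M)) * (Z \<omega> - (\<integral>\<omega>'. Z \<omega>' \<partial>M)) \<partial>M)"

text \<open>The normal law is specified through its characteristic function, which covers singular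
  \<open>\<Sigma>\<close> (unavoidable for \<open>p > n\<close>).\<close>

definition multivariate_normal ::
  "'a measure \<Rightarrow> nat \<Rightarrow> (nat \<Rightarrow> real) \<Rightarrow> (nat \<Rightarrow> nat \<Rightarrow> real) \<Rightarrow> ('a \<Rightarrow> nat \<Rightarrow> real) \<Rightarrow> bool" where
  "multivariate_normal M p \<mu> \<Sigma> G \<longleftrightarrow>
     G \<in> M \<rightarrow>\<^sub>M rvec p \<and>
     (\<forall>a :: nat \<Rightarrow> real.
        (CLINT \<omega>|M. iexp (\<Sum>j=1..p. a j * G \<omega> j)) =
        exp (\<i> * complex_of_real (\<Sum>j=1..p. a j * \<mu> j) -
             complex_of_real (\<Sum>j=1..p. \<Sum>k=1..p. a j * \<Sigma> j k * a k) / 2))"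

text \<open>In the following, \<open>X t\<close> is the \<open>t\<close>-th vector of the sample, \<open>t \<in> {1..n}\<close>.\<close>

definition normalized_sum :: "nat \<Rightarrow> (nat \<Rightarrow> 'a \<Rightarrow> nat \<Rightarrow> real) \<Rightarrow> 'a \<Rightarrow> nat \<Rightarrow> real" where
  "normalized_sum n X \<omega> j = (\<Sum>t=1..n. X t \<omega> j) / sqrt (real n)"

definition sample :: "nat set \<Rightarrow> (nat \<Rightarrow> 'a \<Rightarrow> nat \<Rightarrow> real) \<Rightarrow> 'a \<Rightarrow> nat \<Rightarrow> nat \<Rightarrow> real" where
  "sample A X \<omega> = (\<lambda>t\<in>A. X t \<omega>)"

text \<open>Independence of \<open>G\<close> from the whole sample. (\<^const>\<open>prob_space.indep_var\<close> would force both
  variables to have the same range type.)\<close>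

definition indep_of_sample ::
  "'a measure \<Rightarrow> nat \<Rightarrow> nat \<Rightarrow> (nat \<Rightarrow> 'a \<Rightarrow> nat \<Rightarrow> real) \<Rightarrow> ('a \<Rightarrow> nat \<Rightarrow> real) \<Rightarrow> bool" where
  "indep_of_sample M n p X G \<longleftrightarrow>
     prob_space.indep_set M
       (sets (vimage_algebra (space M) (sample {1..n} X) (\<Pi>\<^sub>M t\<in>{1..n}. rvec p)))
       (sets (vimage_algebra (space M) G (rvec p)))"

text \<open>Only the coordinates \<open>u 1, \<dots>, u p\<close> of \<open>u\<close> matter.\<close>

definition varrho ::
  "'a measure \<Rightarrow> nat \<Rightarrow> nat \<Rightarrow> (nat \<Rightarrow> 'a \<Rightarrow> nat \<Rightarrow> real) \<Rightarrow> ('a \<Rightarrow> nat \<Rightarrow> real) \<Rightarrow> real" where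
  "varrho M n p X G =
     (SUP (u, \<nu>) \<in> (UNIV :: (nat \<Rightarrow> real) set) \<times> {0..1 :: real}.
        \<bar>measure M {\<omega> \<in> space M. \<forall>j\<in>{1..p}.
            sqrt \<nu> * normalized_sum n X \<omega> j + sqrt (1 - \<nu>) * G \<omega> j \<le> u j}
         - measure M {\<omega> \<in> space M. \<forall>j\<in>{1..p}. G \<omega> j \<le> u j}\<bar>)"

text \<open>The usual notion of a dependency graph: subfamilies with no edge between them are
  independent (jointly, as families). Independence of \<open>X t\<close> and \<open>X s\<close> for each single non-edge is
  the special case of singletons, see below; on its own it would allow every pairwise independent
  sequence to have an edgeless graph, and for those central limit theorems fail.
  Since \<open>E\<close> contains the loops, \<open>A\<close> and \<open>B\<close> are disjoint.\<close>

definition dependency_graph ::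
  "'a measure \<Rightarrow> nat \<Rightarrow> nat \<Rightarrow> (nat \<Rightarrow> 'a \<Rightarrow> nat \<Rightarrow> real) \<Rightarrow> (nat \<times> nat) set \<Rightarrow> bool" where
  "dependency_graph M n p X E \<longleftrightarrow>
     E \<subseteq> {1..n} \<times> {1..n} \<and> sym E \<and> (\<forall>t\<in>{1..n}. (t, t) \<in> E) \<and>
     (\<forall>A B. A \<subseteq> {1..n} \<longrightarrow> B \<subseteq> {1..n} \<longrightarrow> (A \<times> B) \<inter> E = {} \<longrightarrow>
        prob_space.indep_var M (\<Pi>\<^sub>M t\<in>A. rvec p) (sample A X) (\<Pi>\<^sub>M t\<in>B. rvec p) (sample B X))"

lemma dependency_graph_pairwise_indep:
  assumes "prob_space M" and dg: "dependency_graph M n p X E"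
    and "t \<in> {1..n}" "s \<in> {1..n}" "(t, s) \<notin> E"
  shows "prob_space.indep_var M (rvec p) (X t) (rvec p) (X s)"
proof -
  interpret prob_space M by fact
  have "indep_var (\<Pi>\<^sub>M u\<in>{t}. rvec p) (sample {t} X) (\<Pi>\<^sub>M u\<in>{s}. rvec p) (sample {s} X)"
    using dg assms(3-5) unfolding dependency_graph_def by simp
  then have "indep_var (rvec p) ((\<lambda>f. f t) \<circ> sample {t} X) (rvec p) ((\<lambda>f. f s) \<circ> sample {s} X)"
    by (rule indep_var_compose) (rule measurable_component_singleton, simp)+
  moreover have "(\<lambda>f. f u) \<circ> sample {u} X = X u" for u
    by (auto simp: sample_def)
  ultimately show ?thesis by simp
qed

definition nbhd :: "nat \<Rightarrow> (nat \<times> nat) set \<Rightarrow> nat \<Rightarrow> nat set" where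
  "nbhd n E t = {s \<in> {1..n}. (t, s) \<in> E}"

definition max_degree :: "nat \<Rightarrow> (nat \<times> nat) set \<Rightarrow> nat" where
  "max_degree n E = (MAX t\<in>{1..n}. \<Sum>s=1..n. of_bool ((t, s) \<in> E))"

definition max_degree2 :: "nat \<Rightarrow> (nat \<times> nat) set \<Rightarrow> nat" where
  "max_degree2 n E = (MAX t\<in>{1..n}. \<Sum>s=1..n. of_bool (s \<in> (\<Union>l\<in>nbhd n E t. nbhd n E l)))"

end

theory Submission
  imports Defs
begin

text \<open>Stein's method along \<open>Z \<theta> = sin \<theta> S + cos \<theta> G\<close>, tested against a smooth cutoff \<open>f\<close> of the soft maximum
  \<open>ln (\<Sum>j. exp (\<beta> (w j - u j)))\<close>. Gaussian integration by parts cancels the second order terms of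
  \<open>d/d\<theta> E f (Z \<theta>)\<close>. The remainder is a sum over triples of neighbouring indices of third derivatives of \<open>f\<close>;
  these are softmax averages of cubes, they vanish unless \<open>Z \<theta>\<close> lies near the boundary of the orthant, and the softmax
  weights change by a bounded factor when the neighbourhood of an index is removed from \<open>Z \<theta>\<close>. Hence, up to
  truncation errors, the remainder is at most \<open>\<epsilon>\<^sup>3\<close> times the probability that \<open>Z \<theta>\<close> lies in a thin strip
  around the boundary, which is at most \<open>2 \<rho>\<close> plus a Gaussian strip probability. Nazarov's anti-concentration inequality bounds the
  latter, and a small \<open>\<epsilon>\<close> absorbs \<open>\<rho>\<close> into the left hand side.\<close>

section \<open>A smooth cutoff\<close>

text \<open>The scale \<open>b\<close> decides the rate. With \<open>\<beta> = b * sqrt n\<close>,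
  smoothing moves the corner by an amount of order \<open>ln p / \<beta>\<close>, which costs
  \<open>sqrt (ln p) * ln p / \<beta>\<close> in probability, while the prefactor of the remainder
  is \<open>n * D * Ds * (b * B)^3 / ln p\<close>. If the first is set to
  \<open>rate / \<epsilon>\<close>, the second equals \<open>\<epsilon>^3\<close>, a constant: the
  third order bound alone is not small, only its product with a strip probability is. That strip is
  met at intermediate angles, where the supremum over all \<open>\<nu>\<close> in
  \<open>varrho\<close> controls it. The localisation has to survive the removal of neighbourhoods,
  which shifts every coordinate. Truncation at a level of order \<open>B * ln (n * p)\<close> keeps
  these shifts below one in the scale of the soft maximum; for small \<open>\<epsilon>\<close> the
  condition for this follows from \<open>rate < 1\<close>, and otherwise the bound is trivial.
  Softmax weights sum to one, so a cube that is independent of them costs the largest third moment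
  of a coordinate rather than the moment of the maximum over coordinates. The path uses an angle
  because \<open>sqrt \<nu>\<close> and \<open>sqrt (1 - \<nu>)\<close> have unbounded derivatives
  at the ends.\<close>

definition pos_pow :: "nat \<Rightarrow> real \<Rightarrow> real" where
  "pos_pow k s = (max 0 s) ^ k"

lemma has_real_derivative_pos_pow:
  "((pos_pow (Suc (Suc k))) has_real_derivative real (Suc (Suc k)) * pos_pow (Suc k) s) (at s)"
proof -
  consider "s < 0" | "s > 0" | "s = 0" by linarith
  then show ?thesis
  proof cases
    case 1
    have "((\<lambda>_. 0) has_real_derivative 0) (at s)" by simp
    then have "((pos_pow (Suc (Suc k))) has_real_derivative 0) (at s)"
      by (rule has_field_derivative_transform_within_open[where S="{..<0}"])
         (use 1 in \<open>auto simp: pos_pow_def\<close>)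
    then show ?thesis using 1 by (simp add: pos_pow_def)
  next
    case 2
    have "((\<lambda>s. s ^ (Suc (Suc k))) has_real_derivative real (Suc (Suc k)) * s ^ (Suc k)) (at s)"
      using DERIV_pow[of "Suc (Suc k)" s] by (simp only: diff_Suc_Suc diff_zero)
    then have "((pos_pow (Suc (Suc k))) has_real_derivative real (Suc (Suc k)) * s ^ (Suc k)) (at s)"
      by (rule has_field_derivative_transform_within_open[where S="{0<..}"])
         (use 2 in \<open>auto simp: pos_pow_def simp del: power_Suc\<close>)
    moreover have "s ^ Suc k = pos_pow (Suc k) s" using 2 by (simp add: pos_pow_def max_def)
    ultimately show ?thesis by (simp only:)
  next
    case 3
    \<comment> \<open>At the kink the difference quotient is dominated by a positive power of the
      positive part, which tends to zero.\<close>
    have "((\<lambda>h. (max 0 h) ^ Suc k) \<longlongrightarrow> (max 0 0) ^ Suc k) (at (0::real))"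
      by (intro tendsto_intros)
    moreover have "\<bar>pos_pow (Suc (Suc k)) h / h\<bar> \<le> (max 0 h) ^ Suc k" for h
    proof (cases "0 < h")
      case True
      then have "pos_pow (Suc (Suc k)) h / h = h ^ Suc k" by (simp add: pos_pow_def)
      then show ?thesis using True by (simp add: max_def del: power_Suc)
    next
      case False
      then have "pos_pow (Suc (Suc k)) h = 0" by (simp add: pos_pow_def max_def)
      then show ?thesis by (simp only: div_0 abs_zero) (intro zero_le_power, simp)
    qed
    then have "\<forall>\<^sub>F h in at 0. norm (pos_pow (Suc (Suc k)) h / h) \<le> (max 0 h) ^ Suc k"
      by (intro always_eventually allI) (simp only: real_norm_def)
    ultimately have "((\<lambda>h. pos_pow (Suc (Suc k)) h / h) \<longlongrightarrow> 0) (at 0)"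
      by (elim Lim_null_comparison) simp
    then show ?thesis
      using 3 by (simp add: has_field_derivative_iff pos_pow_def)
  qed
qed

lemma pos_pow_le_one: "s \<le> 1 \<Longrightarrow> pos_pow k s \<le> 1"
  by (auto simp: pos_pow_def intro!: power_le_one)

lemma pos_pow_nonneg: "0 \<le> pos_pow k s"
  by (auto simp: pos_pow_def)

text \<open>A step from 1 on the negative half line to 0 beyond 1. The inner power flattens it at 0,
  the outer one at 1. Exponent 4 gives three derivatives everywhere, where exponent 3 would give
  two, and the derivatives remain explicit polynomials in positive parts.\<close>

definition cut0 :: "real \<Rightarrow> real" where
  "cut0 s = pos_pow 4 (1 - pos_pow 4 s)"
definition cut1 :: "real \<Rightarrow> real" where
  "cut1 s = - 16 * (pos_pow 3 (1 - pos_pow 4 s) * pos_pow 3 s)"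
definition cut2 :: "real \<Rightarrow> real" where
  "cut2 s = 192 * (pos_pow 2 (1 - pos_pow 4 s) * (pos_pow 3 s * pos_pow 3 s))
          - 48 * (pos_pow 3 (1 - pos_pow 4 s) * pos_pow 2 s)"
definition cut3 :: "real \<Rightarrow> real" where
  "cut3 s = - 1536 * (max 0 (1 - pos_pow 4 s) * pos_pow 3 s * (pos_pow 3 s * pos_pow 3 s))
          + 1728 * (pos_pow 2 (1 - pos_pow 4 s) * (pos_pow 3 s * pos_pow 2 s))
          - 96 * (pos_pow 3 (1 - pos_pow 4 s) * max 0 s)"

lemma pos_pow_derivs:
  "(pos_pow 4 has_real_derivative 4 * pos_pow 3 s) (at s)"
  "(pos_pow 3 has_real_derivative 3 * pos_pow 2 s) (at s)"
  "(pos_pow 2 has_real_derivative 2 * max 0 s) (at s)"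
  using has_real_derivative_pos_pow[of 2 s] has_real_derivative_pos_pow[of 1 s]
    has_real_derivative_pos_pow[of 0 s]
  by (simp_all add: numeral_eq_Suc pos_pow_def)

lemmas pos_pow_derivs_chain [derivative_intros] = pos_pow_derivs[THEN DERIV_chain2]

lemma cut_derivs:
  "(cut0 has_real_derivative cut1 s) (at s)"
  "(cut1 has_real_derivative cut2 s) (at s)"
  "(cut2 has_real_derivative cut3 s) (at s)"
proof -
  define q where "q = 1 - pos_pow 4 s"
  show "(cut0 has_real_derivative cut1 s) (at s)"
    unfolding cut0_def[abs_def] cut1_def q_def[symmetric]
    by (rule derivative_eq_intros refl)+ (simp add: q_def)
  show "(cut1 has_real_derivative cut2 s) (at s)"
    unfolding cut1_def[abs_def] cut2_def q_def[symmetric]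
    by (rule derivative_eq_intros refl)+ (unfold q_def, algebra)
  show "(cut2 has_real_derivative cut3 s) (at s)"
    unfolding cut2_def[abs_def] cut3_def q_def[symmetric]
    by (rule derivative_eq_intros refl)+ (unfold q_def, algebra)
qed

lemmas cut_derivs_chain [derivative_intros] = cut_derivs[THEN DERIV_chain2]

lemma pos_pow_eq_0: "s \<le> 0 \<Longrightarrow> 0 < k \<Longrightarrow> pos_pow k s = 0"
  by (simp add: pos_pow_def max_def)

lemma pos_pow_ge_one: "1 \<le> s \<Longrightarrow> 1 \<le> pos_pow k s"
  by (simp add: pos_pow_def one_le_power)

lemma cut0_eq_1: "s \<le> 0 \<Longrightarrow> cut0 s = 1"
  by (simp add: cut0_def pos_pow_eq_0) (simp add: pos_pow_def)

lemma cut0_eq_0: "1 \<le> s \<Longrightarrow> cut0 s = 0"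
  using pos_pow_ge_one[of s 4] by (simp add: cut0_def pos_pow_eq_0)

lemma cut0_bounds: "0 \<le> cut0 s" "cut0 s \<le> 1"
  by (auto simp: cut0_def pos_pow_nonneg intro!: pos_pow_le_one)

text \<open>Source of the localisation: every derivative of a test function is supported where the
  argument of the cutoff lies in the open unit interval.\<close>

lemma cut_derivs_eq_0:
  assumes "\<not> (0 < s \<and> s < 1)"
  shows "cut1 s = 0" "cut2 s = 0" "cut3 s = 0"
proof -
  consider "s \<le> 0" | "1 \<le> s" using assms by linarith
  then have "cut1 s = 0 \<and> cut2 s = 0 \<and> cut3 s = 0"
  proof cases
    case 1
    then show ?thesis by (simp add: cut1_def cut2_def cut3_def pos_pow_eq_0)
  next
    case 2
    then have "1 - pos_pow 4 s \<le> 0" using pos_pow_ge_one[of s 4] by simp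
    then show ?thesis by (simp add: cut1_def cut2_def cut3_def pos_pow_eq_0)
  qed
  then show "cut1 s = 0" "cut2 s = 0" "cut3 s = 0" by auto
qed

text \<open>On the unit interval every product of powers lies between 0 and 1, so a derivative is
  bounded by the sum of its coefficients; the largest sum is \<open>1536 + 1728 + 96\<close> for
  \<open>cut3\<close>.\<close>

lemma cut_derivs_bound:
  "\<bar>cut1 s\<bar> \<le> 4000" "\<bar>cut2 s\<bar> \<le> 4000" "\<bar>cut3 s\<bar> \<le> 4000"
proof -
  have "\<bar>cut1 s\<bar> \<le> 4000 \<and> \<bar>cut2 s\<bar> \<le> 4000 \<and> \<bar>cut3 s\<bar> \<le> 4000"
  proof (cases "0 < s \<and> s < 1")
    case True
    define q where "q = 1 - pos_pow 4 s"
    have q1: "q \<le> 1" using pos_pow_nonneg[of 4 s] by (simp add: q_def)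
    have m: "0 \<le> x * y \<and> x * y \<le> 1" if "0 \<le> x" "x \<le> 1" "0 \<le> y" "y \<le> 1" for x y :: real
      using that by (simp add: mult_le_one)
    have b: "0 \<le> pos_pow k s" "pos_pow k s \<le> 1" "0 \<le> pos_pow k q" "pos_pow k q \<le> 1" for k
      using True q1 by (auto simp: pos_pow_nonneg intro!: pos_pow_le_one)
    have c: "0 \<le> max 0 s" "max 0 s \<le> 1" "0 \<le> max 0 q" "max 0 q \<le> 1" using True q1 by auto
    have t1: "0 \<le> pos_pow 3 q * pos_pow 3 s" "pos_pow 3 q * pos_pow 3 s \<le> 1"
      and t2: "0 \<le> pos_pow 2 q * (pos_pow 3 s * pos_pow 3 s)" "pos_pow 2 q * (pos_pow 3 s * pos_pow 3 s) \<le> 1"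
      and t3: "0 \<le> pos_pow 3 q * pos_pow 2 s" "pos_pow 3 q * pos_pow 2 s \<le> 1"
      and t4: "0 \<le> max 0 q * pos_pow 3 s * (pos_pow 3 s * pos_pow 3 s)" "max 0 q * pos_pow 3 s * (pos_pow 3 s * pos_pow 3 s) \<le> 1"
      and t5: "0 \<le> pos_pow 2 q * (pos_pow 3 s * pos_pow 2 s)" "pos_pow 2 q * (pos_pow 3 s * pos_pow 2 s) \<le> 1"
      and t6: "0 \<le> pos_pow 3 q * max 0 s" "pos_pow 3 q * max 0 s \<le> 1"
      using m b c by simp_all
    show ?thesis unfolding cut1_def cut2_def cut3_def q_def[symmetric]
      using t1 t2 t3 t4 t5 t6 unfolding abs_le_iff by linarith
  qed (simp add: cut_derivs_eq_0)
  then show "\<bar>cut1 s\<bar> \<le> 4000" "\<bar>cut2 s\<bar> \<le> 4000" "\<bar>cut3 s\<bar> \<le> 4000" by auto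
qed

lemma continuous_on_cut:
  "continuous_on UNIV cut0" "continuous_on UNIV cut1" "continuous_on UNIV cut2"
  using cut_derivs by (meson DERIV_isCont continuous_at_imp_continuous_on)+

lemma measurable_cut [measurable]:
  "cut0 \<in> borel_measurable borel" "cut1 \<in> borel_measurable borel" "cut2 \<in> borel_measurable borel"
  using continuous_on_cut by (auto intro: borel_measurable_continuous_onI)

section \<open>Calculus of the soft maximum\<close>

definition lse :: "nat \<Rightarrow> (nat \<Rightarrow> real) \<Rightarrow> real" where
  "lse p w = ln (\<Sum>j=1..p. exp (w j))"

definition softmax :: "nat \<Rightarrow> (nat \<Rightarrow> real) \<Rightarrow> nat \<Rightarrow> real" where
  "softmax p w j = exp (w j) / (\<Sum>k=1..p. exp (w k))"

definition avg :: "nat \<Rightarrow> (nat \<Rightarrow> real) \<Rightarrow> (nat \<Rightarrow> real) \<Rightarrow> real" where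
  "avg p w x = (\<Sum>j=1..p. softmax p w j * x j)"

lemma sum_exp_pos: "1 \<le> (p::nat) \<Longrightarrow> 0 < (\<Sum>j=1..p. exp (w j :: real))"
  by (intro sum_pos) auto

lemma softmax_nonneg: "0 \<le> softmax p w j"
  by (simp add: softmax_def sum_nonneg)

lemma sum_softmax: "1 \<le> p \<Longrightarrow> (\<Sum>j=1..p. softmax p w j) = 1"
  using sum_exp_pos[of p w] by (simp add: softmax_def sum_divide_distrib[symmetric])

lemma softmax_le_one: "1 \<le> p \<Longrightarrow> j \<in> {1..p} \<Longrightarrow> softmax p w j \<le> 1"
  using sum_softmax[of p w] member_le_sum[of j "{1..p}" "softmax p w"] by (simp add: softmax_nonneg)

lemma avg_eq: "avg p w x = (\<Sum>j=1..p. exp (w j) * x j) / (\<Sum>k=1..p. exp (w k))"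
  by (simp add: avg_def softmax_def sum_divide_distrib)

lemma avg_mono: "(\<And>j. j \<in> {1..p} \<Longrightarrow> x j \<le> y j) \<Longrightarrow> avg p w x \<le> avg p w y"
  unfolding avg_def by (intro sum_mono mult_left_mono softmax_nonneg) auto

lemma avg_add: "avg p w (\<lambda>j. x j + y j) = avg p w x + avg p w y"
  by (simp add: avg_def algebra_simps sum.distrib)

lemma avg_mult_left: "avg p w (\<lambda>j. c * x j) = c * avg p w x"
  by (simp add: avg_def sum_distrib_left algebra_simps)

lemma avg_mult_right: "avg p w (\<lambda>j. x j * c) = avg p w x * c"
  by (simp add: avg_def sum_distrib_right mult.assoc)

lemma avg_const: "1 \<le> p \<Longrightarrow> avg p w (\<lambda>_. c) = c"
  using sum_softmax[of p w] by (simp add: avg_def sum_distrib_right[symmetric])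

lemma avg_abs: "\<bar>avg p w x\<bar> \<le> avg p w (\<lambda>j. \<bar>x j\<bar>)"
  unfolding avg_def by (rule order_trans[OF sum_abs]) (simp add: abs_mult softmax_nonneg)

lemma avg_nonneg: "(\<And>j. 0 \<le> x j) \<Longrightarrow> 0 \<le> avg p w x"
  unfolding avg_def by (intro sum_nonneg mult_nonneg_nonneg softmax_nonneg)

lemma avg_sum: "avg p w (\<lambda>j. \<Sum>u\<in>U. z u j) = (\<Sum>u\<in>U. avg p w (z u))"
  unfolding avg_def by (simp add: sum_distrib_left) (rule sum.swap)

text \<open>Decouples products of three different coordinates or indices into single cubes, so that
  third moments of single coordinates are all that has to be estimated.\<close>

lemma prod3_le_cubes:
  assumes "0 \<le> a" "0 \<le> b" "0 \<le> c" shows "a * b * c \<le> a^3 + b^3 + (c::real)^3"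
proof -
  define m where "m = max a (max b c)"
  have "a \<le> m" "b \<le> m" "c \<le> m" "0 \<le> m" using assms by (auto simp: m_def)
  then have "a * b * c \<le> m * m * m" using assms by (intro mult_mono) auto
  also have "\<dots> = m ^ 3" by (simp add: power3_eq_cube)
  also have "\<dots> \<le> a^3 + b^3 + c^3" using assms by (auto simp: m_def max_def)
  finally show ?thesis .
qed

context
  fixes p :: nat and w :: "nat \<Rightarrow> real" and x y z :: "nat \<Rightarrow> real"
  assumes p: "1 \<le> p"
begin

text \<open>A product of means is an iterated mean over separate indices. The inequality for cubes
  is applied under these means, and means of constants collapse because the weights sum to
  one.\<close>

lemma avg_prod_bounds:
  defines "Q \<equiv> avg p w (\<lambda>j. \<bar>x j\<bar>^3 + \<bar>y j\<bar>^3 + \<bar>z j\<bar>^3)"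
  shows "\<bar>avg p w x * avg p w y * avg p w z\<bar> \<le> Q"
    and "\<bar>avg p w (\<lambda>j. x j * y j) * avg p w z\<bar> \<le> Q"
    and "\<bar>avg p w (\<lambda>j. x j * y j * z j)\<bar> \<le> Q"
proof -
  let ?A = "avg p w"
  have Q: "Q = ?A (\<lambda>j. \<bar>x j\<bar>^3) + ?A (\<lambda>j. \<bar>y j\<bar>^3) + ?A (\<lambda>j. \<bar>z j\<bar>^3)"
    by (simp add: Q_def avg_add)
  note pc = prod3_le_cubes[OF abs_ge_zero abs_ge_zero abs_ge_zero]
  have "\<bar>?A x * ?A y * ?A z\<bar> \<le> ?A (\<lambda>j. \<bar>x j\<bar>) * ?A (\<lambda>j. \<bar>y j\<bar>) * ?A (\<lambda>j. \<bar>z j\<bar>)"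
    unfolding abs_mult by (intro mult_mono avg_abs mult_nonneg_nonneg avg_nonneg abs_ge_zero)
  also have "\<dots> = ?A (\<lambda>j. ?A (\<lambda>k. ?A (\<lambda>l. \<bar>x j\<bar> * \<bar>y k\<bar> * \<bar>z l\<bar>)))"
    by (simp add: avg_mult_left avg_mult_right)
  also have "\<dots> \<le> ?A (\<lambda>j. ?A (\<lambda>k. ?A (\<lambda>l. \<bar>x j\<bar>^3 + \<bar>y k\<bar>^3 + \<bar>z l\<bar>^3)))"
    by (intro avg_mono pc)
  also have "\<dots> = Q" unfolding Q by (simp only: avg_add avg_const[OF p])
  finally show "\<bar>?A x * ?A y * ?A z\<bar> \<le> Q" .
  have "\<bar>?A (\<lambda>j. x j * y j) * ?A z\<bar> \<le> ?A (\<lambda>j. \<bar>x j * y j\<bar>) * ?A (\<lambda>j. \<bar>z j\<bar>)"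
    unfolding abs_mult[of "avg p w (\<lambda>j. x j * y j)"] by (intro mult_mono avg_abs avg_nonneg abs_ge_zero)
  also have "\<dots> = ?A (\<lambda>j. ?A (\<lambda>l. \<bar>x j\<bar> * \<bar>y j\<bar> * \<bar>z l\<bar>))"
    by (simp add: avg_mult_left avg_mult_right abs_mult)
  also have "\<dots> \<le> ?A (\<lambda>j. ?A (\<lambda>l. \<bar>x j\<bar>^3 + \<bar>y j\<bar>^3 + \<bar>z l\<bar>^3))"
    by (intro avg_mono pc)
  also have "\<dots> = Q" unfolding Q by (simp only: avg_add avg_const[OF p])
  finally show "\<bar>avg p w (\<lambda>j. x j * y j) * avg p w z\<bar> \<le> Q" .
  have "\<bar>?A (\<lambda>j. x j * y j * z j)\<bar> \<le> ?A (\<lambda>j. \<bar>x j\<bar> * \<bar>y j\<bar> * \<bar>z j\<bar>)"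
    using avg_abs[of p w "\<lambda>j. x j * y j * z j"] by (simp add: abs_mult)
  also have "\<dots> \<le> Q" unfolding Q_def by (intro avg_mono pc)
  finally show "\<bar>avg p w (\<lambda>j. x j * y j * z j)\<bar> \<le> Q" .
qed

end

lemma has_real_derivative_lse:
  assumes p: "1 \<le> p" and w: "\<And>j. j \<in> {1..p} \<Longrightarrow> ((\<lambda>t. w t j) has_real_derivative d j) (at t)"
  shows "((\<lambda>t. lse p (w t)) has_real_derivative avg p (w t) d) (at t)"
proof -
  have "((\<lambda>t. \<Sum>j=1..p. exp (w t j)) has_real_derivative (\<Sum>j=1..p. exp (w t j) * d j)) (at t)"
    using w by (intro DERIV_sum) (auto intro!: derivative_eq_intros)
  then have "((\<lambda>t. lse p (w t)) has_real_derivative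
     inverse (\<Sum>j=1..p. exp (w t j)) * (\<Sum>j=1..p. exp (w t j) * d j)) (at t)"
    unfolding lse_def using sum_exp_pos[OF p] by (intro DERIV_chain2[OF DERIV_ln])
  then show ?thesis by (simp add: avg_eq divide_inverse mult.commute)
qed

text \<open>Differentiating a Gibbs mean yields the covariance of the observable and the direction
  under the same weights. Iterated, this generates the cumulants in the formulas below.\<close>

lemma has_real_derivative_avg:
  assumes p: "1 \<le> p" and w: "\<And>j. j \<in> {1..p} \<Longrightarrow> ((\<lambda>t. w t j) has_real_derivative d j) (at t)"
  shows "((\<lambda>t. avg p (w t) x) has_real_derivative
    avg p (w t) (\<lambda>j. x j * d j) - avg p (w t) x * avg p (w t) d) (at t)"
proof -
  let ?S = "\<Sum>j=1..p. exp (w t j)"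
  have 1: "((\<lambda>t. \<Sum>j=1..p. exp (w t j) * x j) has_real_derivative (\<Sum>j=1..p. exp (w t j) * (x j * d j))) (at t)"
    using w by (intro DERIV_sum) (auto intro!: derivative_eq_intros)
  have 2: "((\<lambda>t. \<Sum>j=1..p. exp (w t j)) has_real_derivative (\<Sum>j=1..p. exp (w t j) * d j)) (at t)"
    using w by (intro DERIV_sum) (auto intro!: derivative_eq_intros)
  have S: "?S \<noteq> 0" using sum_exp_pos[OF p, of "w t"] by simp
  have "((\<lambda>t. avg p (w t) x) has_real_derivative
    ((\<Sum>j=1..p. exp (w t j) * (x j * d j)) * ?S - (\<Sum>j=1..p. exp (w t j) * x j) * (\<Sum>j=1..p. exp (w t j) * d j)) / (?S * ?S)) (at t)"
    unfolding avg_eq by (rule DERIV_divide[OF 1 2 S])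
  also have "((\<Sum>j=1..p. exp (w t j) * (x j * d j)) * ?S - (\<Sum>j=1..p. exp (w t j) * x j) * (\<Sum>j=1..p. exp (w t j) * d j)) / (?S * ?S)
    = avg p (w t) (\<lambda>j. x j * d j) - avg p (w t) x * avg p (w t) d"
    using S unfolding avg_eq by (simp add: diff_divide_distrib)
  finally show ?thesis .
qed

section \<open>The smoothed indicator and its directional derivatives\<close>

definition sm0 :: "real \<Rightarrow> nat \<Rightarrow> (nat \<Rightarrow> real) \<Rightarrow> real" where
  "sm0 a p w = cut0 (a * lse p w)"

definition sm1 :: "real \<Rightarrow> nat \<Rightarrow> (nat \<Rightarrow> real) \<Rightarrow> (nat \<Rightarrow> real) \<Rightarrow> real" where
  "sm1 a p w x = a * cut1 (a * lse p w) * avg p w x"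

definition sm2 :: "real \<Rightarrow> nat \<Rightarrow> (nat \<Rightarrow> real) \<Rightarrow> (nat \<Rightarrow> real) \<Rightarrow> (nat \<Rightarrow> real) \<Rightarrow> real" where
  "sm2 a p w x y = a * a * cut2 (a * lse p w) * (avg p w x * avg p w y)
     + a * cut1 (a * lse p w) * (avg p w (\<lambda>j. x j * y j) - avg p w x * avg p w y)"

text \<open>The bracket after \<open>cut1\<close> is the third joint cumulant of the directions
  under the softmax weights. The one after \<open>cut2\<close> is the sum of the three products of a
  covariance with a mean, and \<open>cut3\<close> carries the product of the means.\<close>

definition sm3 :: "real \<Rightarrow> nat \<Rightarrow> (nat \<Rightarrow> real) \<Rightarrow> (nat \<Rightarrow> real) \<Rightarrow> (nat \<Rightarrow> real) \<Rightarrow> (nat \<Rightarrow> real) \<Rightarrow> real" where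
  "sm3 a p w x y z =
     a * a * a * cut3 (a * lse p w) * (avg p w x * avg p w y * avg p w z)
   + a * a * cut2 (a * lse p w) *
      (avg p w (\<lambda>j. x j * z j) * avg p w y + avg p w (\<lambda>j. y j * z j) * avg p w x
       + avg p w (\<lambda>j. x j * y j) * avg p w z - 3 * (avg p w x * avg p w y * avg p w z))
   + a * cut1 (a * lse p w) *
      (avg p w (\<lambda>j. x j * y j * z j) - avg p w (\<lambda>j. x j * z j) * avg p w y
       - avg p w (\<lambda>j. y j * z j) * avg p w x
       - avg p w (\<lambda>j. x j * y j) * avg p w z + 2 * (avg p w x * avg p w y * avg p w z))"

context
  fixes p :: nat and w :: "real \<Rightarrow> nat \<Rightarrow> real" and d :: "nat \<Rightarrow> real" and t :: real
  assumes p: "1 \<le> p" and w: "\<And>j. j \<in> {1..p} \<Longrightarrow> ((\<lambda>t. w t j) has_real_derivative d j) (at t)"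
begin

lemma has_real_derivative_sm0: "((\<lambda>t. sm0 a p (w t)) has_real_derivative sm1 a p (w t) d) (at t)"
  unfolding sm0_def sm1_def
  by (rule derivative_eq_intros has_real_derivative_lse[OF p w] refl | assumption)+ simp

lemma has_real_derivative_sm1: "((\<lambda>t. sm1 a p (w t) x) has_real_derivative sm2 a p (w t) x d) (at t)"
  unfolding sm1_def sm2_def
  by (rule derivative_eq_intros has_real_derivative_lse[OF p w] has_real_derivative_avg[OF p w] refl | assumption)+
     (simp add: algebra_simps)

lemma has_real_derivative_sm2: "((\<lambda>t. sm2 a p (w t) x y) has_real_derivative sm3 a p (w t) x y d) (at t)"
  unfolding sm2_def sm3_def
  by (rule derivative_eq_intros has_real_derivative_lse[OF p w] has_real_derivative_avg[OF p w] refl | assumption)+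
     (simp add: algebra_simps)

end

text \<open>Since \<open>a\<close> is at most one, \<open>a * a\<close> and \<open>a * a * a\<close>
  are bounded by \<open>a\<close>. The three groups contain 1, 6 and 6 products with multiplicity,
  each at most the mean of the cubes, whence \<open>52000 = 4000 * 13\<close>. The surviving factor
  \<open>a\<close> will be \<open>1 / ln p\<close>.\<close>

lemma sm3_bound:
  assumes p: "1 \<le> p" and a: "0 < a" "a \<le> 1"
  shows "\<bar>sm3 a p w x y z\<bar> \<le> (if 0 < a * lse p w \<and> a * lse p w < 1
     then 52000 * a * avg p w (\<lambda>j. \<bar>x j\<bar>^3 + \<bar>y j\<bar>^3 + \<bar>z j\<bar>^3) else 0)"
proof (cases "0 < a * lse p w \<and> a * lse p w < 1")
  case False
  then show ?thesis unfolding if_not_P[OF False] by (simp only: sm3_def cut_derivs_eq_0[OF False] mult_zero_right mult_zero_left add_0_right abs_zero order_refl)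
next
  case True
  define Q where "Q = avg p w (\<lambda>j. \<bar>x j\<bar>^3 + \<bar>y j\<bar>^3 + \<bar>z j\<bar>^3)"
  define P where "P = avg p w x * avg p w y * avg p w z"
  define xz where "xz = avg p w (\<lambda>j. x j * z j) * avg p w y"
  define yz where "yz = avg p w (\<lambda>j. y j * z j) * avg p w x"
  define xy where "xy = avg p w (\<lambda>j. x j * y j) * avg p w z"
  define R where "R = avg p w (\<lambda>j. x j * y j * z j)"
  have b: "\<bar>P\<bar> \<le> Q" "\<bar>xy\<bar> \<le> Q" "\<bar>R\<bar> \<le> Q" "\<bar>xz\<bar> \<le> Q" "\<bar>yz\<bar> \<le> Q"
    using avg_prod_bounds[OF p, of w x y z] avg_prod_bounds(2)[OF p, of w x z y] avg_prod_bounds(2)[OF p, of w y z x]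
    by (simp_all add: P_def xy_def R_def xz_def yz_def Q_def ac_simps)
  then have Q0: "0 \<le> Q" by linarith
  define c where "c = a * lse p w"
  have m: "\<bar>u * v * s\<bar> \<le> a * 4000 * K"
    if "0 \<le> u" "u \<le> a" "\<bar>v\<bar> \<le> 4000" "\<bar>s\<bar> \<le> K" for u v s K
  proof -
    have "\<bar>u * v\<bar> \<le> a * 4000" unfolding abs_mult using that a by (intro mult_mono) auto
    then show ?thesis unfolding abs_mult[of "u * v"] using that a by (intro mult_mono) auto
  qed
  have a2: "a * a \<le> a" "a * a * a \<le> a" "0 \<le> a * a" "0 \<le> a * a * a"
    using a by (auto simp: mult_left_le mult_le_one intro: order_trans[OF mult_right_mono])
  have "\<bar>a * a * a * cut3 c * P\<bar> \<le> a * 4000 * Q"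
    using a2 cut_derivs_bound b by (intro m) auto
  moreover have "\<bar>a * a * cut2 c * (xz + yz + xy - 3 * P)\<bar> \<le> a * 4000 * (6 * Q)"
    using a2 cut_derivs_bound b by (intro m) auto
  moreover have "\<bar>a * cut1 c * (R - xz - yz - xy + 2 * P)\<bar> \<le> a * 4000 * (6 * Q)"
    using a cut_derivs_bound b by (intro m) auto
  moreover have "sm3 a p w x y z = a * a * a * cut3 c * P + a * a * cut2 c * (xz + yz + xy - 3 * P)
      + a * cut1 c * (R - xz - yz - xy + 2 * P)"
    by (simp add: sm3_def c_def P_def xy_def R_def xz_def yz_def)
  ultimately have "\<bar>sm3 a p w x y z\<bar> \<le> 52000 * a * Q"
    by (simp add: abs_le_iff)
  then show ?thesis using True by (simp add: Q_def)
qed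

lemma sm3_sum:
  assumes "finite U"
  shows "sm3 a p w x y (\<lambda>j. \<Sum>u\<in>U. z u j) = (\<Sum>u\<in>U. sm3 a p w x y (z u))"
  using assms
proof (induction U rule: finite_induct)
  case empty
  then show ?case by (simp add: sm3_def avg_def)
next
  case (insert v U)
  have "sm3 a p w x y (\<lambda>j. z v j + s j) = sm3 a p w x y (z v) + sm3 a p w x y s" for s
    unfolding sm3_def distrib_left avg_add by (simp add: algebra_simps)
  then show ?case using insert by simp
qed

lemma sm2_sum:
  assumes "finite U"
  shows "sm2 a p w x (\<lambda>j. \<Sum>u\<in>U. z u j) = (\<Sum>u\<in>U. sm2 a p w x (z u))"
  using assms
proof (induction U rule: finite_induct)
  case empty
  then show ?case by (simp add: sm2_def avg_def)
next
  case (insert v U)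
  have "sm2 a p w x (\<lambda>j. z v j + s j) = sm2 a p w x (z v) + sm2 a p w x s" for s
    unfolding sm2_def distrib_left avg_add by (simp add: algebra_simps)
  then show ?case using insert by simp
qed

lemma sm1_sum: "sm1 a p w (\<lambda>j. \<Sum>u\<in>U. z u j) = (\<Sum>u\<in>U. sm1 a p w (z u))"
  by (simp add: sm1_def avg_sum sum_distrib_left)

lemma sm2_scale: "sm2 a p w x (\<lambda>j. c * y j) = c * sm2 a p w x y"
proof -
  have "(\<lambda>j. x j * (c * y j)) = (\<lambda>j. c * (x j * y j))" by (simp add: algebra_simps)
  then show ?thesis unfolding sm2_def by (simp only: avg_mult_left) (simp add: algebra_simps)
qed

lemma sm1_scale: "sm1 a p w (\<lambda>j. c * y j) = c * sm1 a p w y"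
  unfolding sm1_def avg_mult_left by (simp add: algebra_simps)

lemma sm2_commute: "sm2 a p w x y = sm2 a p w y x"
  by (simp add: sm2_def mult.commute)

lemma sm_cong:
  assumes "\<And>j. j \<in> {1..p} \<Longrightarrow> x j = x' j" "\<And>j. j \<in> {1..p} \<Longrightarrow> y j = y' j"
  shows "sm1 a p w x = sm1 a p w x'" "sm2 a p w x y = sm2 a p w x' y'"
proof -
  have "avg p w x = avg p w x'" "avg p w y = avg p w y'" "avg p w (\<lambda>j. x j * y j) = avg p w (\<lambda>j. x' j * y' j)"
    using assms by (simp_all add: avg_def)
  then show "sm1 a p w x = sm1 a p w x'" "sm2 a p w x y = sm2 a p w x' y'"
    by (simp_all add: sm1_def sm2_def)
qed

section \<open>Expansion along coordinates\<close>

definition unit_vec :: "nat \<Rightarrow> nat \<Rightarrow> real" where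
  "unit_vec j = (\<lambda>k. of_bool (k = j))"

lemma sum_unit_vec: "k \<in> {1..p} \<Longrightarrow> (\<Sum>j=1..p. x j * unit_vec j k) = x k"
  by (simp add: unit_vec_def of_bool_def if_distrib cong: if_cong)

text \<open>The directions will be random and correlated with the base point. Expansion pulls their
  coordinates out as scalar factors, so that independence can split an expectation and the remaining
  derivatives along unit vectors are bounded.\<close>

lemma sm1_expand: "sm1 a p w x = (\<Sum>j=1..p. x j * sm1 a p w (unit_vec j))"
proof -
  have "sm1 a p w x = sm1 a p w (\<lambda>k. \<Sum>j=1..p. x j * unit_vec j k)"
    by (rule sm_cong) (rule sum_unit_vec[symmetric] refl; assumption)+
  then show ?thesis by (simp add: sm1_sum sm1_scale)
qed

lemma sm2_expand_right: "sm2 a p w x y = (\<Sum>k=1..p. y k * sm2 a p w x (unit_vec k))"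
proof -
  have "sm2 a p w x y = sm2 a p w x (\<lambda>k. \<Sum>j=1..p. y j * unit_vec j k)"
    by (rule sm_cong) (rule sum_unit_vec[symmetric] refl; assumption)+
  then show ?thesis by (simp add: sm2_sum sm2_scale)
qed

lemma sm2_expand: "sm2 a p w x y = (\<Sum>j=1..p. \<Sum>k=1..p. x j * y k * sm2 a p w (unit_vec j) (unit_vec k))"
proof -
  have "sm2 a p w x y = (\<Sum>j=1..p. x j * sm2 a p w y (unit_vec j))"
    by (subst sm2_commute) (rule sm2_expand_right)
  also have "\<dots> = (\<Sum>j=1..p. x j * (\<Sum>k=1..p. y k * sm2 a p w (unit_vec j) (unit_vec k)))"
    by (subst (1) sm2_commute) (subst sm2_expand_right, rule refl)
  finally show ?thesis by (simp add: sum_distrib_left mult.assoc)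
qed

lemma sm1_add: "sm1 a p w (\<lambda>j. x j + y j) = sm1 a p w x + sm1 a p w y"
  by (simp add: sm1_def avg_add algebra_simps)

lemma sm_cong_point:
  assumes "\<And>j. j \<in> {1..p} \<Longrightarrow> w j = w' j"
  shows "lse p w = lse p w'" "sm0 a p w = sm0 a p w'" "sm1 a p w x = sm1 a p w' x" "sm2 a p w x y = sm2 a p w' x y"
proof -
  have s: "(\<Sum>j=1..p. exp (w j)) = (\<Sum>j=1..p. exp (w' j))" using assms by simp
  show l: "lse p w = lse p w'" by (simp only: lse_def s)
  have av: "avg p w x = avg p w' x" for x using assms unfolding avg_def softmax_def s by simp
  show "sm0 a p w = sm0 a p w'" "sm1 a p w x = sm1 a p w' x" "sm2 a p w x y = sm2 a p w' x y"
    by (simp_all only: sm0_def sm1_def sm2_def l av)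
qed

lemma avg_unit_vec_bounds:
  assumes "1 \<le> p"
  shows "\<bar>avg p w (unit_vec j)\<bar> \<le> 1" "\<bar>avg p w (\<lambda>i. unit_vec j i * unit_vec k i)\<bar> \<le> 1"
proof -
  have b: "\<bar>avg p w x\<bar> \<le> 1" if "\<And>j. \<bar>x j\<bar> \<le> 1" for x
    using avg_abs[of p w x] avg_mono[of p "\<lambda>j. \<bar>x j\<bar>" "\<lambda>_. 1" w] that avg_const[OF assms, of w 1] by simp
  show "\<bar>avg p w (unit_vec j)\<bar> \<le> 1" "\<bar>avg p w (\<lambda>i. unit_vec j i * unit_vec k i)\<bar> \<le> 1"
    by (auto intro!: b simp: unit_vec_def)
qed

text \<open>Crude bounds for integrability and domination; no rate depends on them. The second
  constant is 4000 for the \<open>cut2\<close> term plus twice 4000 for the covariance term.\<close>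

lemma sm_unit_vec_bounds:
  assumes p: "1 \<le> p" and a: "0 < a" "a \<le> 1"
  shows "\<bar>sm1 a p w (unit_vec j)\<bar> \<le> 4000" "\<bar>sm2 a p w (unit_vec j) (unit_vec k)\<bar> \<le> 12000"
proof -
  have m: "\<bar>u * v * s\<bar> \<le> 4000 * K"
    if "0 \<le> u" "u \<le> 1" "\<bar>v\<bar> \<le> 4000" "\<bar>s\<bar> \<le> K" for u v s K :: real
  proof -
    have "\<bar>u * v\<bar> \<le> 1 * 4000" unfolding abs_mult using that by (intro mult_mono) auto
    then show ?thesis unfolding abs_mult[of "u * v"] using that by (intro mult_mono) auto
  qed
  note b = avg_unit_vec_bounds[OF p, of w]
  have aa: "a * a \<le> 1" using a by (simp add: mult_le_one)
  have b2: "\<bar>avg p w (unit_vec j) * avg p w (unit_vec k)\<bar> \<le> 1" for j k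
    unfolding abs_mult using b(1) by (simp add: mult_le_one)
  show "\<bar>sm1 a p w (unit_vec j)\<bar> \<le> 4000"
    unfolding sm1_def using m[of a _ _ 1] a b(1) cut_derivs_bound by simp
  have "\<bar>a * a * cut2 (a * lse p w) * (avg p w (unit_vec j) * avg p w (unit_vec k))\<bar> \<le> 4000 * 1"
    using a aa b2 cut_derivs_bound by (intro m) auto
  moreover have "\<bar>a * cut1 (a * lse p w) * (avg p w (\<lambda>i. unit_vec j i * unit_vec k i) - avg p w (unit_vec j) * avg p w (unit_vec k))\<bar> \<le> 4000 * 2"
    using a b(2)[of j k] b2[of j k] cut_derivs_bound by (intro m) auto
  ultimately show "\<bar>sm2 a p w (unit_vec j) (unit_vec k)\<bar> \<le> 12000"
    unfolding sm2_def by linarith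
qed

section \<open>Stability of the soft maximum and of the derivatives under shifts\<close>

lemma lse_perturb:
  assumes p: "1 \<le> p" and d: "\<And>j. j \<in> {1..p} \<Longrightarrow> \<bar>w j - w' j\<bar> \<le> \<delta>"
  shows "\<bar>lse p w - lse p w'\<bar> \<le> \<delta>"
proof -
  \<comment> \<open>The soft maximum is monotone and commutes with adding a constant to all
    coordinates, hence it is 1-Lipschitz for the maximum norm.\<close>
  have *: "lse p w \<le> lse p w' + \<delta>" if "\<And>j. j \<in> {1..p} \<Longrightarrow> w j \<le> w' j + \<delta>" for w w'
  proof -
    have "(\<Sum>j=1..p. exp (w j)) \<le> (\<Sum>j=1..p. exp (w' j) * exp \<delta>)"
      using that by (intro sum_mono) (simp add: exp_add[symmetric])
    also have "\<dots> = (\<Sum>j=1..p. exp (w' j)) * exp \<delta>" by (simp add: sum_distrib_right)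
    finally have "lse p w \<le> ln ((\<Sum>j=1..p. exp (w' j)) * exp \<delta>)"
      unfolding lse_def using sum_exp_pos[OF p] by (intro ln_mono) auto
    then show ?thesis unfolding lse_def using sum_exp_pos[OF p, of w'] by (simp add: ln_mult)
  qed
  have "w j \<le> w' j + \<delta>" "w' j \<le> w j + \<delta>" if "j \<in> {1..p}" for j using d[OF that] by linarith+
  then show ?thesis using *[of w w'] *[of w' w] by (simp add: abs_le_iff)
qed

text \<open>A softmax weight is \<open>exp (w j - lse p w)\<close>, and both terms in the exponent
  move by at most \<open>\<delta>\<close>. This multiplicative stability lets the weights be
  evaluated at a point with a neighbourhood removed.\<close>

lemma softmax_perturb:
  assumes p: "1 \<le> p" and d: "\<And>j. j \<in> {1..p} \<Longrightarrow> \<bar>w j - w' j\<bar> \<le> \<delta>" and j: "j \<in> {1..p}"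
  shows "softmax p w j \<le> exp (2 * \<delta>) * softmax p w' j"
proof -
  have s: "softmax p w j = exp (w j - lse p w)" for w
    using sum_exp_pos[OF p, of w] by (simp add: softmax_def lse_def exp_diff)
  have "w j - lse p w \<le> 2 * \<delta> + (w' j - lse p w')"
    using lse_perturb[OF p, of w w' \<delta>] d d[OF j] by (simp add: abs_le_iff)
  then show ?thesis by (simp add: s exp_add[symmetric])
qed

lemma le_lse: "j \<in> {1..p} \<Longrightarrow> w j \<le> lse p w"
  unfolding lse_def by (subst ln_exp[symmetric], rule ln_mono) (auto intro!: member_le_sum sum_exp_pos)

text \<open>Together with \<open>le_lse\<close> this places the soft maximum within
  \<open>ln p\<close> above the maximum, which is why the cutoff is later stretched over length
  \<open>ln p\<close>.\<close>

lemma lse_le: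
  assumes "1 \<le> p" "\<And>j. j \<in> {1..p} \<Longrightarrow> w j \<le> c"
  shows "lse p w \<le> c + ln p"
proof -
  have "(\<Sum>j=1..p. exp (w j)) \<le> (\<Sum>j=1..p. exp c)" using assms by (intro sum_mono) simp
  then have "lse p w \<le> ln (p * exp c)"
    unfolding lse_def using assms(1) sum_exp_pos[OF assms(1), of w] by (intro ln_mono) auto
  then show ?thesis using assms(1) by (simp add: ln_mult)
qed

text \<open>By the mean value theorem the increment is a third derivative at some point of the
  segment, and linearity splits it over the displaced summands. Domination by \<open>W\<close> is
  required only where the argument of the cutoff is inside the unit interval, since the third
  derivative vanishes elsewhere.\<close>

lemma sm2_diff_bound:
  assumes p: "1 \<le> p" and a: "0 < a" "a \<le> 1" and U: "finite U"
    and W: "\<And>t j. 0 < t \<Longrightarrow> t < 1 \<Longrightarrow> j \<in> {1..p} \<Longrightarrow> 0 < a * lse p (\<lambda>j. A j + t * (\<Sum>u\<in>U. z u j)) \<Longrightarrow>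
        a * lse p (\<lambda>j. A j + t * (\<Sum>u\<in>U. z u j)) < 1 \<Longrightarrow>
        softmax p (\<lambda>j. A j + t * (\<Sum>u\<in>U. z u j)) j \<le> W j"
    and W0: "\<And>j. 0 \<le> W j"
  shows "\<bar>sm2 a p (\<lambda>j. A j + (\<Sum>u\<in>U. z u j)) x y - sm2 a p A x y\<bar>
    \<le> 52000 * a * (\<Sum>u\<in>U. \<Sum>j=1..p. W j * (\<bar>x j\<bar>^3 + \<bar>y j\<bar>^3 + \<bar>z u j\<bar>^3))"
proof -
  define \<xi> where "\<xi> t = (\<lambda>j. A j + t * (\<Sum>u\<in>U. z u j))" for t :: real
  have "((\<lambda>t. sm2 a p (\<xi> t) x y) has_real_derivative sm3 a p (\<xi> t) x y (\<lambda>j. \<Sum>u\<in>U. z u j)) (at t)" for t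
    by (rule has_real_derivative_sm2[OF p]) (auto simp: \<xi>_def intro!: derivative_eq_intros)
  then obtain t where t: "0 < t" "t < 1"
    "sm2 a p (\<xi> 1) x y - sm2 a p (\<xi> 0) x y = (1 - 0) * sm3 a p (\<xi> t) x y (\<lambda>j. \<Sum>u\<in>U. z u j)"
    using MVT2[of 0 1 "\<lambda>t. sm2 a p (\<xi> t) x y" "\<lambda>t. sm3 a p (\<xi> t) x y (\<lambda>j. \<Sum>u\<in>U. z u j)"] by auto
  have "\<bar>sm3 a p (\<xi> t) x y (z u)\<bar> \<le> 52000 * a * (\<Sum>j=1..p. W j * (\<bar>x j\<bar>^3 + \<bar>y j\<bar>^3 + \<bar>z u j\<bar>^3))" for u
  proof (cases "0 < a * lse p (\<xi> t) \<and> a * lse p (\<xi> t) < 1")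
    case True
    then have "avg p (\<xi> t) (\<lambda>j. \<bar>x j\<bar>^3 + \<bar>y j\<bar>^3 + \<bar>z u j\<bar>^3) \<le> (\<Sum>j=1..p. W j * (\<bar>x j\<bar>^3 + \<bar>y j\<bar>^3 + \<bar>z u j\<bar>^3))"
      unfolding avg_def using W[OF t(1,2), folded \<xi>_def] by (intro sum_mono mult_right_mono) auto
    then have "52000 * a * avg p (\<xi> t) (\<lambda>j. \<bar>x j\<bar>^3 + \<bar>y j\<bar>^3 + \<bar>z u j\<bar>^3)
       \<le> 52000 * a * (\<Sum>j=1..p. W j * (\<bar>x j\<bar>^3 + \<bar>y j\<bar>^3 + \<bar>z u j\<bar>^3))"
      using a by (intro mult_left_mono) auto
    then show ?thesis using sm3_bound[OF p a, of "\<xi> t" x y "z u"] True by simp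
  next
    case False
    then have "\<bar>sm3 a p (\<xi> t) x y (z u)\<bar> \<le> 0" using sm3_bound[OF p a, of "\<xi> t" x y "z u"] by (simp split: if_splits)
    also have "0 \<le> 52000 * a * (\<Sum>j=1..p. W j * (\<bar>x j\<bar>^3 + \<bar>y j\<bar>^3 + \<bar>z u j\<bar>^3))"
      using a W0 by (intro mult_nonneg_nonneg sum_nonneg add_nonneg_nonneg) auto
    finally show ?thesis .
  qed
  then have "\<bar>\<Sum>u\<in>U. sm3 a p (\<xi> t) x y (z u)\<bar> \<le> (\<Sum>u\<in>U. 52000 * a * (\<Sum>j=1..p. W j * (\<bar>x j\<bar>^3 + \<bar>y j\<bar>^3 + \<bar>z u j\<bar>^3)))"
    by (intro order_trans[OF sum_abs] sum_mono)
  then show ?thesis using t(3) by (simp add: sm3_sum[OF U] \<xi>_def sum_distrib_left)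
qed

text \<open>The intermediate point is kept explicit: second derivatives at it still have to be
  compared with second derivatives at points having larger neighbourhoods removed.\<close>

lemma sm1_diff:
  assumes p: "1 \<le> p" and U: "finite U"
  shows "\<exists>t. 0 < t \<and> t < 1 \<and> sm1 a p (\<lambda>j. A j + (\<Sum>u\<in>U. z u j)) x - sm1 a p A x
    = (\<Sum>u\<in>U. sm2 a p (\<lambda>j. A j + t * (\<Sum>u\<in>U. z u j)) x (z u))"
proof -
  define \<xi> where "\<xi> t = (\<lambda>j. A j + t * (\<Sum>u\<in>U. z u j))" for t :: real
  have "((\<lambda>t. sm1 a p (\<xi> t) x) has_real_derivative sm2 a p (\<xi> t) x (\<lambda>j. \<Sum>u\<in>U. z u j)) (at t)" for t
    by (rule has_real_derivative_sm1[OF p]) (auto simp: \<xi>_def intro!: derivative_eq_intros)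
  then obtain t where t: "0 < t" "t < 1"
    "sm1 a p (\<xi> 1) x - sm1 a p (\<xi> 0) x = (1 - 0) * sm2 a p (\<xi> t) x (\<lambda>j. \<Sum>u\<in>U. z u j)"
    using MVT2[of 0 1 "\<lambda>t. sm1 a p (\<xi> t) x" "\<lambda>t. sm2 a p (\<xi> t) x (\<lambda>j. \<Sum>u\<in>U. z u j)"] by auto
  then show ?thesis by (auto simp: \<xi>_def sm2_sum[OF U])
qed

lemma measurable_sm:
  assumes "\<And>j. j \<in> {1..p} \<Longrightarrow> (\<lambda>\<omega>. w \<omega> j) \<in> borel_measurable M"
  shows "(\<lambda>\<omega>. lse p (w \<omega>)) \<in> borel_measurable M"
    "\<And>j. j \<in> {1..p} \<Longrightarrow> (\<lambda>\<omega>. softmax p (w \<omega>) j) \<in> borel_measurable M"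
    "(\<lambda>\<omega>. avg p (w \<omega>) x) \<in> borel_measurable M"
    "(\<lambda>\<omega>. sm0 a p (w \<omega>)) \<in> borel_measurable M"
    "(\<lambda>\<omega>. sm1 a p (w \<omega>) x) \<in> borel_measurable M"
    "(\<lambda>\<omega>. sm2 a p (w \<omega>) x y) \<in> borel_measurable M"
proof -
  have s: "(\<lambda>\<omega>. \<Sum>j=1..p. exp (w \<omega> j)) \<in> borel_measurable M"
    using assms by (intro borel_measurable_sum) (auto intro: measurable_compose[OF _ borel_measurable_exp])
  show l [measurable]: "(\<lambda>\<omega>. lse p (w \<omega>)) \<in> borel_measurable M"
    unfolding lse_def using s by measurable
  show sf: "(\<lambda>\<omega>. softmax p (w \<omega>) j) \<in> borel_measurable M" if "j \<in> {1..p}" for j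
    unfolding softmax_def using s assms[OF that] by measurable
  have av [measurable]: "(\<lambda>\<omega>. avg p (w \<omega>) x) \<in> borel_measurable M" for x
    unfolding avg_def by (intro borel_measurable_sum borel_measurable_times sf borel_measurable_const)
  then show "(\<lambda>\<omega>. avg p (w \<omega>) x) \<in> borel_measurable M" .
  show "(\<lambda>\<omega>. sm0 a p (w \<omega>)) \<in> borel_measurable M"
    "(\<lambda>\<omega>. sm1 a p (w \<omega>) x) \<in> borel_measurable M"
    "(\<lambda>\<omega>. sm2 a p (w \<omega>) x y) \<in> borel_measurable M"
    unfolding sm0_def sm1_def sm2_def by measurable
qed

section \<open>Uniqueness of characteristic functions\<close>

lemma char_distr_density:
  fixes f h :: "'a \<Rightarrow> real"
  assumes [measurable]: "h \<in> borel_measurable M" "f \<in> borel_measurable M" and "\<And>x. 0 \<le> h x"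
  shows "char (distr (density M h) borel f) t = (CLINT x|M. complex_of_real (h x) * iexp (t * f x))"
proof -
  have "char (distr (density M h) borel f) t = (CLINT x|density M h. iexp (t * f x))"
    unfolding char_def by (subst integral_distr) auto
  also have "\<dots> = (CLINT x|M. h x *\<^sub>R iexp (t * f x))"
    by (subst integral_density) (use assms in auto)
  finally show ?thesis by (simp add: scaleR_conv_of_real)
qed

text \<open>The measure with density \<open>h\<close> is normalised to a probability, to which
  Levy's uniqueness theorem applies. The common total mass is read off at frequency zero; mass zero
  cannot be normalised and is trivial.\<close>

lemma weighted_char_uniqueness:
  fixes h f :: "'a \<Rightarrow> real"
  assumes fin: "finite_measure M" "finite_measure N" and sets: "sets M = sets N"
    and h [measurable]: "h \<in> borel_measurable M" and f [measurable]: "f \<in> borel_measurable M"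
    and pos: "\<And>x. 0 \<le> h x" and bnd: "\<And>x. h x \<le> C"
    and eq: "\<And>t. (CLINT x|M. complex_of_real (h x) * iexp (t * f x))
                = (CLINT x|N. complex_of_real (h x) * iexp (t * f x))"
    and A: "A \<in> sets borel"
  shows "(\<integral>x. h x * indicator A (f x) \<partial>M) = (\<integral>x. h x * indicator A (f x) \<partial>N)"
proof -
  interpret M: finite_measure M by fact
  interpret N: finite_measure N by fact
  have hN [measurable]: "h \<in> borel_measurable N" and fN [measurable]: "f \<in> borel_measurable N"
    using h f by (simp_all cong: measurable_cong_sets add: sets)
  note A [measurable]
  have intM: "integrable M h" and intN: "integrable N h"
    using pos bnd by (auto intro!: M.integrable_const_bound[where B=C] N.integrable_const_bound[where B=C])
  define m where "m = (\<integral>x. h x \<partial>M)"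
  have "complex_of_real m = complex_of_real (\<integral>x. h x \<partial>N)"
    using eq[of 0] intM intN by (simp add: m_def)
  then have mN: "m = (\<integral>x. h x \<partial>N)" by (simp only: of_real_eq_iff)
  show ?thesis
  proof (cases "m = 0")
    case True
    have "AE x in M. h x = 0" "AE x in N. h x = 0"
      using True mN intM intN pos by (simp_all add: m_def integral_nonneg_eq_0_iff_AE[symmetric])
    then have "(\<integral>x. h x * indicator A (f x) \<partial>M) = 0" "(\<integral>x. h x * indicator A (f x) \<partial>N) = 0"
      by (auto intro!: integral_eq_zero_AE elim!: eventually_mono)
    then show ?thesis by simp
  next
    case False
    then have m0: "0 < m" using pos by (simp add: m_def less_le integral_nonneg_AE)
    define k where "k = (\<lambda>x. h x / m)"
    have [measurable]: "k \<in> borel_measurable M" "k \<in> borel_measurable N" by (simp_all add: k_def)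
    have kpos: "0 \<le> k x" for x using m0 pos by (simp add: k_def)
    have prob: "real_distribution (distr (density L k) borel f)"
      if "integrable L h" "f \<in> borel_measurable L" "(\<integral>x. h x \<partial>L) = m" for L
    proof -
      have km: "k \<in> borel_measurable L" using that by (simp add: k_def)
      have "emeasure (density L k) (space L) = (\<integral>\<^sup>+x. ennreal (k x) \<partial>L)"
        using km by (simp add: emeasure_density cong: nn_integral_cong)
      also have "\<dots> = ennreal (\<integral>x. k x \<partial>L)"
        using that kpos by (intro nn_integral_eq_integral) (auto simp: k_def)
      also have "\<dots> = 1" using that m0 by (simp add: k_def)
      finally have "prob_space (density L k)" by (intro prob_spaceI) simp
      then have "prob_space (distr (density L k) borel f)"
        using that by (intro prob_space.prob_space_distr) auto
      then show ?thesis by (simp add: real_distribution_def real_distribution_axioms_def)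
    qed
    have "distr (density M k) borel f = distr (density N k) borel f"
    proof (rule Levy_uniqueness)
      show "char (distr (density M k) borel f) = char (distr (density N k) borel f)"
      proof
        fix t
        have "(CLINT x|M. complex_of_real (k x) * iexp (t * f x)) = (CLINT x|M. complex_of_real (h x) * iexp (t * f x)) / m"
          "(CLINT x|N. complex_of_real (k x) * iexp (t * f x)) = (CLINT x|N. complex_of_real (h x) * iexp (t * f x)) / m"
          by (simp_all add: k_def)
        then show "char (distr (density M k) borel f) t = char (distr (density N k) borel f) t"
          using kpos eq[of t] by (subst (1 2) char_distr_density) auto
      qed
    qed (use prob intM intN mN m_def in auto)
    then have "(\<integral>y. indicator A y \<partial>distr (density M k) borel f) = (\<integral>y. indicator A y \<partial>distr (density N k) borel f :: real)"
      by simp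
    then have "(\<integral>x. k x * indicator A (f x) \<partial>M) = (\<integral>x. k x * indicator A (f x) \<partial>N)"
      using kpos by (subst (asm) (1 2) integral_distr) (auto simp: integral_density)
    then show ?thesis using m0 by (simp add: k_def)
  qed
qed

lemma integrable_bounded_times_iexp:
  assumes "finite_measure M" and [measurable]: "h \<in> borel_measurable M" "f \<in> borel_measurable M"
    and "\<And>x. \<bar>h x\<bar> \<le> (C::real)"
  shows "integrable M (\<lambda>x. complex_of_real (h x) * iexp (f x))"
proof -
  interpret finite_measure M by fact
  show ?thesis
    by (rule integrable_const_bound[where B=C]) (use assms in \<open>auto simp: norm_mult\<close>)
qed

text \<open>Weighting by the nonnegative functions \<open>h\<close>, \<open>h (1 + cos g)\<close> and \<open>h (1 + sin g)\<close> reduces a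
  joint characteristic function to one-dimensional ones of finite measures.\<close>

lemma char_uniqueness_step:
  fixes h f g :: "'a \<Rightarrow> real"
  assumes fin: "finite_measure M" "finite_measure N" and sets: "sets M = sets N"
    and h [measurable]: "h \<in> borel_measurable M" and f [measurable]: "f \<in> borel_measurable M"
    and g [measurable]: "g \<in> borel_measurable M"
    and pos: "\<And>x. 0 \<le> h x" and bnd: "\<And>x. h x \<le> C"
    and eq: "\<And>s t. (CLINT x|M. complex_of_real (h x) * iexp (s * g x + t * f x))
                = (CLINT x|N. complex_of_real (h x) * iexp (s * g x + t * f x))"
    and A: "A \<in> sets borel"
  shows "(CLINT x|M. complex_of_real (h x * indicator A (f x)) * iexp (g x))
       = (CLINT x|N. complex_of_real (h x * indicator A (f x)) * iexp (g x))"
proof -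
  interpret M: finite_measure M by fact
  interpret N: finite_measure N by fact
  have [measurable]: "h \<in> borel_measurable N" "f \<in> borel_measurable N" "g \<in> borel_measurable N"
    using h f g by (simp_all cong: measurable_cong_sets add: sets)
  note A [measurable]
  note int = integrable_bounded_times_iexp[where C=C]
  have habs: "\<bar>h x\<bar> \<le> C" for x using pos[of x] bnd[of x] by simp
  have C0: "0 \<le> C" using pos bnd order_trans by blast
  have cosin: "cos x \<le> 1" "sin x \<le> 1" "-1 \<le> cos x" "-1 \<le> sin x" for x :: real by auto
  \<comment> \<open>Euler's formulas turn the factors \<open>1 + cos g\<close> and
    \<open>1 + sin g\<close> into combinations of the frequencies 0, 1 and -1 in \<open>g\<close>,
    at which the two measures agree by assumption.\<close>
  have triv: "complex_of_real (h x * (1 + cos (g x))) * iexp (t * f x) =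
      complex_of_real (h x) * iexp (0 * g x + t * f x)
      + (complex_of_real (h x) * iexp (1 * g x + t * f x) + complex_of_real (h x) * iexp ((-1) * g x + t * f x)) / 2"
    "complex_of_real (h x * (1 + sin (g x))) * iexp (t * f x) =
      complex_of_real (h x) * iexp (0 * g x + t * f x)
      + (complex_of_real (h x) * iexp (1 * g x + t * f x) - complex_of_real (h x) * iexp ((-1) * g x + t * f x)) / (2 * \<i>)"
    for t x
  proof -
    define E F where "E = iexp (g x)" and "F = iexp (t * f x)"
    have e: "iexp (0 * g x + t * f x) = F" "iexp (1 * g x + t * f x) = E * F" "iexp ((-1) * g x + t * f x) = inverse E * F"
      by (simp_all add: E_def F_def exp_minus[symmetric] exp_add[symmetric] algebra_simps)
    have c: "complex_of_real (cos (g x)) = (E + inverse E) / 2" "complex_of_real (sin (g x)) = (E - inverse E) / (2 * \<i>)"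
      by (simp_all add: E_def cos_of_real[symmetric] sin_of_real[symmetric] cos_exp_eq sin_exp_eq exp_minus)
    show "complex_of_real (h x * (1 + cos (g x))) * iexp (t * f x) =
      complex_of_real (h x) * iexp (0 * g x + t * f x)
      + (complex_of_real (h x) * iexp (1 * g x + t * f x) + complex_of_real (h x) * iexp ((-1) * g x + t * f x)) / 2"
      "complex_of_real (h x * (1 + sin (g x))) * iexp (t * f x) =
      complex_of_real (h x) * iexp (0 * g x + t * f x)
      + (complex_of_real (h x) * iexp (1 * g x + t * f x) - complex_of_real (h x) * iexp ((-1) * g x + t * f x)) / (2 * \<i>)"
      unfolding e F_def[symmetric]
      unfolding of_real_mult of_real_add c by (simp_all add: field_simps)
  qed
  have iM: "integrable M (\<lambda>x. complex_of_real (h x) * iexp (s * g x + t * f x))"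
    and iN: "integrable N (\<lambda>x. complex_of_real (h x) * iexp (s * g x + t * f x))" for s t
    using habs fin by (intro int; simp)+
  have lin: "(\<integral>x. F x + (F' x + F'' x) / c \<partial>L) = (\<integral>x. F x \<partial>L) + ((\<integral>x. F' x \<partial>L) + (\<integral>x. F'' x \<partial>L)) / c"
     "(\<integral>x. F x + (F' x - F'' x) / c \<partial>L) = (\<integral>x. F x \<partial>L) + ((\<integral>x. F' x \<partial>L) - (\<integral>x. F'' x \<partial>L)) / c"
    if "integrable L F" "integrable L F'" "integrable L F''"
    for L :: "'a measure" and F F' F'' :: "'a \<Rightarrow> complex" and c
    using that by simp_all
  have w0: "(\<integral>x. h x * indicator A (f x) \<partial>M) = (\<integral>x. h x * indicator A (f x) \<partial>N)"
    using eq[of 0] by (intro weighted_char_uniqueness[OF fin sets h f pos bnd _ A]) simp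
  have wc: "(\<integral>x. (h x * (1 + cos (g x))) * indicator A (f x) \<partial>M) = (\<integral>x. (h x * (1 + cos (g x))) * indicator A (f x) \<partial>N)"
  proof (rule weighted_char_uniqueness[OF fin sets _ f _ _ _ A, where C="C * 2"])
    show "0 \<le> h x * (1 + cos (g x))" for x using pos[of x] cosin(3)[of "g x"] by (intro mult_nonneg_nonneg; linarith)
    show "h x * (1 + cos (g x)) \<le> C * 2" for x
      using pos[of x] bnd[of x] cosin[of "g x"] C0 by (intro mult_mono; linarith)
    show "(CLINT x|M. complex_of_real (h x * (1 + cos (g x))) * iexp (t * f x)) =
      (CLINT x|N. complex_of_real (h x * (1 + cos (g x))) * iexp (t * f x))" for t
      unfolding triv lin(1)[OF iM iM iM] lin(1)[OF iN iN iN] eq ..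
  qed measurable
  have ws: "(\<integral>x. (h x * (1 + sin (g x))) * indicator A (f x) \<partial>M) = (\<integral>x. (h x * (1 + sin (g x))) * indicator A (f x) \<partial>N)"
  proof (rule weighted_char_uniqueness[OF fin sets _ f _ _ _ A, where C="C * 2"])
    show "0 \<le> h x * (1 + sin (g x))" for x using pos[of x] cosin(4)[of "g x"] by (intro mult_nonneg_nonneg; linarith)
    show "h x * (1 + sin (g x)) \<le> C * 2" for x
      using pos[of x] bnd[of x] cosin[of "g x"] C0 by (intro mult_mono; linarith)
    show "(CLINT x|M. complex_of_real (h x * (1 + sin (g x))) * iexp (t * f x)) =
      (CLINT x|N. complex_of_real (h x * (1 + sin (g x))) * iexp (t * f x))" for t
      unfolding triv lin(2)[OF iM iM iM] lin(2)[OF iN iN iN] eq ..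
  qed measurable
  have b: "\<bar>h x * indicator A (f x)\<bar> \<le> C" "\<bar>h x * indicator A (f x) * cos (g x)\<bar> \<le> C"
     "\<bar>h x * indicator A (f x) * sin (g x)\<bar> \<le> C" for x
  proof -
    show "\<bar>h x * indicator A (f x)\<bar> \<le> C" using habs[of x] C0 by (auto simp: indicator_def)
    have "\<bar>h x * u\<bar> \<le> C" if "\<bar>u\<bar> \<le> 1" for u
      using mult_mono[OF habs[of x] that] C0 by (simp add: abs_mult)
    then show "\<bar>h x * indicator A (f x) * cos (g x)\<bar> \<le> C" "\<bar>h x * indicator A (f x) * sin (g x)\<bar> \<le> C"
      using abs_cos_le_one abs_sin_le_one C0 by (auto simp: indicator_def)
  qed
  have i: "integrable M (\<lambda>x. h x * indicator A (f x))" "integrable N (\<lambda>x. h x * indicator A (f x))"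
     "integrable M (\<lambda>x. h x * indicator A (f x) * cos (g x))" "integrable N (\<lambda>x. h x * indicator A (f x) * cos (g x))"
     "integrable M (\<lambda>x. h x * indicator A (f x) * sin (g x))" "integrable N (\<lambda>x. h x * indicator A (f x) * sin (g x))"
    using b by (auto intro!: M.integrable_const_bound[where B=C] N.integrable_const_bound[where B=C])
  have c: "(\<integral>x. h x * indicator A (f x) * cos (g x) \<partial>M) = (\<integral>x. h x * indicator A (f x) * cos (g x) \<partial>N)"
  proof -
    have "(h x * (1 + cos (g x))) * indicator A (f x) = h x * indicator A (f x) + h x * indicator A (f x) * cos (g x)" for x
      by (simp add: algebra_simps)
    then show ?thesis using wc w0 i by simp
  qed
  have s: "(\<integral>x. h x * indicator A (f x) * sin (g x) \<partial>M) = (\<integral>x. h x * indicator A (f x) * sin (g x) \<partial>N)"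
  proof -
    have "(h x * (1 + sin (g x))) * indicator A (f x) = h x * indicator A (f x) + h x * indicator A (f x) * sin (g x)" for x
      by (simp add: algebra_simps)
    then show ?thesis using ws w0 i by simp
  qed
  have split: "complex_of_real (h x * indicator A (f x)) * iexp (g x)
     = complex_of_real (h x * indicator A (f x) * cos (g x)) + \<i> * complex_of_real (h x * indicator A (f x) * sin (g x))" for x
    by (simp add: cis_conv_exp[symmetric] complex_eq_iff)
  show ?thesis
    unfolding split using i c s by (simp del: of_real_mult)
qed

text \<open>Characters are traded for indicators one coordinate at a time. When none is left, the
  two measures agree on all measurable rectangles, which generate the product space and are stable
  under intersection.\<close>

lemma rvec_eqI_char:
  assumes prob: "prob_space M" "prob_space N" and sets: "sets M = sets (rvec p)" "sets N = sets (rvec p)"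
    and eq: "\<And>a :: nat \<Rightarrow> real. (CLINT x|M. iexp (\<Sum>j=1..p. a j * x j)) = (CLINT x|N. iexp (\<Sum>j=1..p. a j * x j))"
  shows "M = N"
proof -
  interpret M: prob_space M by fact
  interpret N: prob_space N by fact
  have fin: "finite_measure M" "finite_measure N" by unfold_locales
  have [measurable_cong]: "sets M = sets (rvec p)" "sets N = sets (rvec p)" by fact+
  have step: "k \<le> p \<Longrightarrow> \<forall>j. A j \<in> sets borel \<Longrightarrow>
      (CLINT x|M. complex_of_real (\<Prod>j=1..k. indicator (A j) (x j)) * iexp (\<Sum>j=Suc k..p. a j * x j))
    = (CLINT x|N. complex_of_real (\<Prod>j=1..k. indicator (A j) (x j)) * iexp (\<Sum>j=Suc k..p. a j * x j))"
    for k and A :: "nat \<Rightarrow> real set" and a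
  proof (induction k arbitrary: a)
    case 0
    then show ?case using eq[of a] by simp
  next
    case (Suc k)
    then have [measurable]: "A j \<in> sets borel" for j by auto
    have k: "Suc k \<in> {1..p}" using Suc by auto
    have meas: "(\<lambda>x. \<Prod>j=1..k. indicator (A j) (x j) :: real) \<in> borel_measurable M"
      "(\<lambda>x. x (Suc k)) \<in> borel_measurable M" "(\<lambda>x. \<Sum>j=Suc (Suc k)..p. a j * x j) \<in> borel_measurable M"
      using Suc.prems k
      by (auto intro!: borel_measurable_prod borel_measurable_sum measurable_compose[OF measurable_component_singleton])
    have "(CLINT x|M. complex_of_real ((\<Prod>j=1..k. indicator (A j) (x j)) * indicator (A (Suc k)) (x (Suc k))) * iexp (\<Sum>j=Suc (Suc k)..p. a j * x j))
     = (CLINT x|N. complex_of_real ((\<Prod>j=1..k. indicator (A j) (x j)) * indicator (A (Suc k)) (x (Suc k))) * iexp (\<Sum>j=Suc (Suc k)..p. a j * x j))"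
    proof (rule char_uniqueness_step[OF fin _ meas, where C=1])
      show "sets M = sets N" by (simp add: sets)
      fix s t
      \<comment> \<open>The induction hypothesis holds for all frequencies: coordinate
        \<open>Suc k\<close> receives its own frequency \<open>t\<close>, the later ones are scaled
        by \<open>s\<close>.\<close>
      have e: "(\<Sum>j=Suc k..p. (if j = Suc k then t else s * a j) * x j) = s * (\<Sum>j=Suc (Suc k)..p. a j * x j) + t * x (Suc k)" for x :: "nat \<Rightarrow> real"
      proof -
        have "{Suc k..p} = insert (Suc k) {Suc (Suc k)..p}" using Suc.prems by auto
        then show ?thesis by (auto simp: sum_distrib_left mult.assoc intro!: sum.cong)
      qed
      show "(CLINT x|M. complex_of_real (\<Prod>j=1..k. indicator (A j) (x j)) * iexp (s * (\<Sum>j=Suc (Suc k)..p. a j * x j) + t * x (Suc k))) =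
        (CLINT x|N. complex_of_real (\<Prod>j=1..k. indicator (A j) (x j)) * iexp (s * (\<Sum>j=Suc (Suc k)..p. a j * x j) + t * x (Suc k)))"
        using Suc.IH[of "\<lambda>j. if j = Suc k then t else s * a j"] Suc.prems unfolding e by simp
    qed (auto intro!: prod_nonneg prod_le_1)
    then show ?case by simp
  qed
  show ?thesis
  proof (rule measure_eqI_PiM_finite[where I="{1..p}" and M="\<lambda>_. borel" and A="\<lambda>_. space (rvec p)"])
    fix A :: "nat \<Rightarrow> real set" assume A: "\<And>i. i \<in> {1..p} \<Longrightarrow> A i \<in> sets borel"
    \<comment> \<open>The statement \<open>step\<close> asks for measurable sets at every index, so
      a default is put outside the range.\<close>
    define A' where "A' = (\<lambda>i. if i \<in> {1..p} then A i else {})"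
    have A': "\<forall>j. A' j \<in> sets borel" using A by (auto simp: A'_def)
    have ind: "(\<Prod>j=1..p. indicator (A' j) (x j) :: real) = indicator (Pi\<^sub>E {1..p} A) x"
      if "x \<in> space (rvec p)" for x
    proof -
      have "x \<in> Pi\<^sub>E {1..p} A \<longleftrightarrow> (\<forall>j\<in>{1..p}. x j \<in> A j)"
        using that by (auto simp: space_PiM PiE_iff)
      then show ?thesis
        by (cases "x \<in> Pi\<^sub>E {1..p} A") (auto simp: A'_def indicator_def intro!: prod.neutral)
    qed
    have S: "Pi\<^sub>E {1..p} A \<in> sets (rvec p)" using A by (intro sets_PiM_I_finite) auto
    have "(\<Sum>j=Suc p..p. 0 * x j) = 0" for x :: "nat \<Rightarrow> real" by simp
    then have "(CLINT x|M. complex_of_real (\<Prod>j=1..p. indicator (A' j) (x j))) = (CLINT x|N. complex_of_real (\<Prod>j=1..p. indicator (A' j) (x j)))"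
      using step[of p A' "\<lambda>_. 0"] A' by simp
    also have "(CLINT x|M. complex_of_real (\<Prod>j=1..p. indicator (A' j) (x j))) = (CLINT x|M. complex_of_real (indicator (Pi\<^sub>E {1..p} A) x))"
      using ind by (intro Bochner_Integration.integral_cong) (auto simp: sets_eq_imp_space_eq[OF sets(1)] simp del: of_real_prod)
    also have "(CLINT x|N. complex_of_real (\<Prod>j=1..p. indicator (A' j) (x j))) = (CLINT x|N. complex_of_real (indicator (Pi\<^sub>E {1..p} A) x))"
      using ind by (intro Bochner_Integration.integral_cong) (auto simp: sets_eq_imp_space_eq[OF sets(2)] simp del: of_real_prod)
    finally have "measure M (Pi\<^sub>E {1..p} A) = measure N (Pi\<^sub>E {1..p} A)"
      using S sets by simp
    then show "emeasure M (Pi\<^sub>E {1..p} A) = emeasure N (Pi\<^sub>E {1..p} A)"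
      by (simp add: M.emeasure_eq_measure N.emeasure_eq_measure)
  next
    show "range (\<lambda>_. space (rvec p)) \<subseteq> prod_algebra {1..p} (\<lambda>_. borel)"
      by (auto simp: space_PiM intro!: prod_algebraI_finite)
  qed (use sets in auto)
qed

section \<open>Centered normal vectors\<close>

lemma prob_space_std_normal: "prob_space std_normal_distribution"
  using real_dist_normal_dist by (simp add: real_distribution_def)

lemma std_normal_density_tendsto_0:
  "(std_normal_density \<longlongrightarrow> 0) at_top" "(std_normal_density \<longlongrightarrow> 0) at_bot"
proof -
  have "((\<lambda>x::real. exp (- x\<^sup>2 / 2)) \<longlongrightarrow> 0) at_top" "((\<lambda>x::real. exp (- x\<^sup>2 / 2)) \<longlongrightarrow> 0) at_bot"
    by real_asymp+
  then show "(std_normal_density \<longlongrightarrow> 0) at_top" "(std_normal_density \<longlongrightarrow> 0) at_bot"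
    unfolding std_normal_density_def[abs_def] by (auto simp only: intro: tendsto_mult_right_zero)
qed

text \<open>Stein's identity, from the fundamental theorem on the whole line applied to the density
  times \<open>f\<close>. The boundary terms vanish because \<open>f\<close> is bounded and the
  density decays.\<close>

lemma std_normal_integral_by_parts:
  fixes f f' :: "real \<Rightarrow> real"
  assumes f: "\<And>x. (f has_real_derivative f' x) (at x)" and cont: "\<And>x. isCont f' x"
    and b: "\<And>x. \<bar>f x\<bar> \<le> C" "\<And>x. \<bar>f' x\<bar> \<le> C"
  shows "(\<integral>x. x * f x \<partial>std_normal_distribution) = (\<integral>x. f' x \<partial>std_normal_distribution)"
proof -
  let ?\<phi> = std_normal_density
  have mf [measurable]: "f \<in> borel_measurable borel"
    using f by (intro borel_measurable_continuous_onI continuous_at_imp_continuous_on) (auto intro: DERIV_isCont)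
  have mf' [measurable]: "f' \<in> borel_measurable borel"
    using cont by (intro borel_measurable_continuous_onI continuous_at_imp_continuous_on) auto
  have d\<phi>: "(?\<phi> has_real_derivative - x * ?\<phi> x) (at x)" for x
    unfolding std_normal_density_def[abs_def] by (rule derivative_eq_intros refl)+ (simp_all add: field_simps, simp only: mult_minus_left)
  have c\<phi>: "isCont ?\<phi> x" for x using d\<phi> DERIV_isCont by blast
  have i1: "integrable lborel (\<lambda>x. ?\<phi> x * (x * f x))"
  proof (rule Bochner_Integration.integrable_bound)
    show "integrable lborel (\<lambda>x. C * (?\<phi> x * \<bar>x\<bar> ^ 1))"
      by (intro integrable_mult_right integrable_std_normal_moment_abs)
    show "AE x in lborel. norm (?\<phi> x * (x * f x)) \<le> norm (C * (?\<phi> x * \<bar>x\<bar> ^ 1))"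
    proof (intro AE_I2)
      fix x
      have "?\<phi> x * \<bar>x\<bar> * \<bar>f x\<bar> \<le> ?\<phi> x * \<bar>x\<bar> * C"
        using b(1)[of x] by (intro mult_left_mono) auto
      then show "norm (?\<phi> x * (x * f x)) \<le> norm (C * (?\<phi> x * \<bar>x\<bar> ^ 1))"
        using b(1)[of x] by (simp add: abs_mult algebra_simps)
    qed
  qed measurable
  have i2: "integrable lborel (\<lambda>x. ?\<phi> x * f' x)"
  proof (rule Bochner_Integration.integrable_bound)
    show "integrable lborel (\<lambda>x. C * (?\<phi> x * \<bar>x\<bar> ^ 0))"
      by (intro integrable_mult_right integrable_std_normal_moment_abs)
    show "AE x in lborel. norm (?\<phi> x * f' x) \<le> norm (C * (?\<phi> x * \<bar>x\<bar> ^ 0))"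
    proof (intro AE_I2)
      fix x
      have "?\<phi> x * \<bar>f' x\<bar> \<le> ?\<phi> x * C"
        using b(2)[of x] by (intro mult_left_mono) auto
      then show "norm (?\<phi> x * f' x) \<le> norm (C * (?\<phi> x * \<bar>x\<bar> ^ 0))"
        using b(2)[of x] by (simp add: abs_mult algebra_simps)
    qed
  qed measurable
  have lim: "((\<lambda>x. ?\<phi> x * f x) \<longlongrightarrow> 0) F" if "(?\<phi> \<longlongrightarrow> 0) F" for F
  proof (rule Lim_null_comparison)
    show "((\<lambda>x. ?\<phi> x * C) \<longlongrightarrow> 0) F" using that by (rule tendsto_mult_left_zero)
    show "\<forall>\<^sub>F x in F. norm (?\<phi> x * f x) \<le> ?\<phi> x * C"
      using b(1) by (intro always_eventually allI) (simp add: abs_mult mult_left_mono)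
  qed
  have "(LBINT x=-\<infinity>..\<infinity>. ?\<phi> x * f' x - ?\<phi> x * (x * f x)) = 0 - 0"
  proof (rule interval_integral_FTC_integrable[where F="\<lambda>x. ?\<phi> x * f x"])
    show "((\<lambda>x. ?\<phi> x * f x) has_vector_derivative ?\<phi> x * f' x - ?\<phi> x * (x * f x)) (at x)" for x
      unfolding has_real_derivative_iff_has_vector_derivative[symmetric]
      using f[of x] d\<phi>[of x] by (auto intro!: derivative_eq_intros simp: algebra_simps)
    show "isCont (\<lambda>x. ?\<phi> x * f' x - ?\<phi> x * (x * f x)) x" for x
      using c\<phi> cont DERIV_isCont[OF f] by (intro continuous_intros) auto
    show "set_integrable lborel (einterval (-\<infinity>) \<infinity>) (\<lambda>x. ?\<phi> x * f' x - ?\<phi> x * (x * f x))"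
      using i1 i2 by (simp add: set_integrable_def)
    show "(((\<lambda>x. ?\<phi> x * f x) \<circ> real_of_ereal) \<longlongrightarrow> 0) (at_right (-\<infinity>))"
      using lim[OF std_normal_density_tendsto_0(2)] unfolding at_right_MInf by (simp add: filterlim_filtermap o_def)
    show "(((\<lambda>x. ?\<phi> x * f x) \<circ> real_of_ereal) \<longlongrightarrow> 0) (at_left \<infinity>)"
      using lim[OF std_normal_density_tendsto_0(1)] unfolding at_left_PInf by (simp add: filterlim_filtermap o_def)
  qed auto
  then have "(\<integral>x. ?\<phi> x * f' x - ?\<phi> x * (x * f x) \<partial>lborel) = 0"
    by (simp add: interval_lebesgue_integral_def set_lebesgue_integral_def)
  then show ?thesis using i1 i2 by (simp add: integral_density)
qed

text \<open>Regression on one coordinate: with \<open>b k = \<Sigma> j k / sqrt (\<Sigma> j j)\<close>, the law of \<open>G\<close> is that of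
  \<open>b z + R\<close>, where \<open>z\<close> is standard normal and independent of the residual \<open>R\<close>.\<close>

definition regression :: "nat \<Rightarrow> (nat \<Rightarrow> nat \<Rightarrow> real) \<Rightarrow> nat \<Rightarrow> ('a \<Rightarrow> nat \<Rightarrow> real) \<Rightarrow> real \<Rightarrow> 'a \<Rightarrow> nat \<Rightarrow> real" where
  "regression p \<Sigma> j G z \<omega> = (\<lambda>k\<in>{1..p}. \<Sigma> j k / sqrt (\<Sigma> j j) * z + (G \<omega> k - \<Sigma> j k / \<Sigma> j j * G \<omega> j))"

text \<open>Positive variances allow division in the regression on a coordinate; the matrix
  \<open>\<Sigma>\<close> itself may be singular.\<close>

locale centered_normal = prob_space M for M :: "'a measure" +
  fixes p :: nat and \<Sigma> :: "nat \<Rightarrow> nat \<Rightarrow> real" and G :: "'a \<Rightarrow> nat \<Rightarrow> real"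
  assumes normal: "multivariate_normal M p (\<lambda>_. 0) \<Sigma> G"
    and sym_cov: "\<And>j k. \<Sigma> j k = \<Sigma> k j"
    and pos_var: "\<And>j. j \<in> {1..p} \<Longrightarrow> 0 < \<Sigma> j j"
begin

lemma measurable_G [measurable]: "G \<in> M \<rightarrow>\<^sub>M rvec p"
  using normal by (simp add: multivariate_normal_def)

lemma measurable_G_coord: "k \<in> {1..p} \<Longrightarrow> (\<lambda>\<omega>. G \<omega> k) \<in> borel_measurable M"
  using measurable_compose[OF measurable_G measurable_component_singleton] by simp

definition quad :: "(nat \<Rightarrow> real) \<Rightarrow> real" where
  "quad a = (\<Sum>j=1..p. \<Sum>k=1..p. a j * \<Sigma> j k * a k)"

lemma char_G: "(CLINT \<omega>|M. iexp (\<Sum>j=1..p. a j * G \<omega> j)) = complex_of_real (exp (- quad a / 2))"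
  using normal by (simp add: multivariate_normal_def quad_def exp_of_real[symmetric])

text \<open>Positive semidefiniteness is forced by the characteristic function, whose modulus cannot
  exceed one.\<close>

lemma quad_nonneg: "0 \<le> quad a"
proof -
  have "norm (CLINT \<omega>|M. iexp (\<Sum>j=1..p. a j * G \<omega> j)) \<le> (\<integral>\<omega>. norm (iexp (\<Sum>j=1..p. a j * G \<omega> j)) \<partial>M)"
    by (rule integral_norm_bound)
  also have "\<dots> = 1" by (simp add: prob_space)
  finally have "exp (- quad a / 2) \<le> 1" unfolding char_G by simp
  then show ?thesis by simp
qed

lemma quad_shift:
  assumes j: "j \<in> {1..p}"
  shows "quad (\<lambda>k. a k + (if k = j then c else 0)) = quad a + 2 * c * (\<Sum>k=1..p. \<Sigma> j k * a k) + c * c * \<Sigma> j j"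
proof -
  have d: "(\<Sum>k=1..p. (if k = j then f k else 0)) = f j" for f :: "nat \<Rightarrow> real"
    using j by (subst sum.delta) auto
  have e: "(a i + (if i = j then c else 0)) * \<Sigma> i k * (a k + (if k = j then c else 0))
     = a i * \<Sigma> i k * a k + (if i = j then c * \<Sigma> j k * a k else 0)
      + ((if k = j then c * a i * \<Sigma> j i else 0) + (if i = j then (if k = j then c * c * \<Sigma> j j else 0) else 0))" for i k
    using sym_cov[of i j] by (simp add: algebra_simps)
  have s: "(\<Sum>k=1..p. if i = j then f k else 0) = (if i = j then \<Sum>k=1..p. f k else 0)" for i and f :: "nat \<Rightarrow> real"
    by simp
  show ?thesis unfolding quad_def e
    by (simp only: sum.distrib s d) (simp add: sum_distrib_left algebra_simps)
qed

lemma measurable_regression [measurable]: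
  "(\<lambda>(z, \<omega>). regression p \<Sigma> j G z \<omega>) \<in> (std_normal_distribution \<Otimes>\<^sub>M M) \<rightarrow>\<^sub>M rvec p" if "j \<in> {1..p}"
proof -
  have [measurable]: "(\<lambda>\<omega>. G \<omega> k) \<in> borel_measurable M" if "k \<in> {1..p}" for k
    using measurable_G_coord[OF that] .
  have [measurable]: "(\<lambda>\<omega>. G \<omega> j) \<in> borel_measurable M" using measurable_G_coord[OF that] .
  have [measurable]: "(\<lambda>z. z) \<in> std_normal_distribution \<rightarrow>\<^sub>M borel" by simp
  show ?thesis unfolding regression_def case_prod_beta
    by (intro measurable_restrict) measurable
qed

text \<open>For a functional \<open>a\<close>, the normal summand contributes variance
  \<open>s^2 / v\<close> and the residual contributes \<open>quad a - s^2 / v\<close>. The two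
  characteristic functions therefore agree for every \<open>a\<close>.\<close>

lemma distr_regression:
  assumes j: "j \<in> {1..p}"
  shows "distr M (rvec p) G = distr (std_normal_distribution \<Otimes>\<^sub>M M) (rvec p) (\<lambda>(z, \<omega>). regression p \<Sigma> j G z \<omega>)"
proof (rule rvec_eqI_char)
  interpret N: prob_space std_normal_distribution by (rule prob_space_std_normal)
  interpret P: pair_prob_space std_normal_distribution M ..
  note [measurable] = measurable_regression[OF j] measurable_G_coord
  show "prob_space (distr M (rvec p) G)" by (intro prob_space_distr) measurable
  show "prob_space (distr (std_normal_distribution \<Otimes>\<^sub>M M) (rvec p) (\<lambda>(z, \<omega>). regression p \<Sigma> j G z \<omega>))"
    by (intro P.prob_space_distr) measurable
  fix a :: "nat \<Rightarrow> real"
  define v where "v = \<Sigma> j j"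
  have v: "0 < v" using pos_var[OF j] by (simp add: v_def)
  define s where "s = (\<Sum>k=1..p. a k * \<Sigma> j k)"
  \<comment> \<open>Evaluating \<open>a\<close> on the residual is evaluating \<open>a'\<close> on
    \<open>G\<close>: subtracting the regression on coordinate \<open>j\<close> changes one
    coefficient.\<close>
  define a' where "a' = (\<lambda>k. a k + (if k = j then - s / v else 0))"
  have q: "quad a' = quad a - s\<^sup>2 / v"
  proof -
    have "(\<Sum>k=1..p. \<Sigma> j k * a k) = s" by (simp add: s_def mult.commute)
    then show ?thesis using v unfolding a'_def quad_shift[OF j] v_def[symmetric]
      by (simp add: field_simps power2_eq_square)
  qed
  have sp: "(\<Sum>k=1..p. a k * regression p \<Sigma> j G z \<omega> k) = (s / sqrt v) * z + (\<Sum>k=1..p. a' k * G \<omega> k)" for z \<omega>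
  proof -
    have "(\<Sum>k=1..p. a' k * G \<omega> k) = (\<Sum>k=1..p. a k * G \<omega> k) + (\<Sum>k=1..p. if k = j then - s / v * G \<omega> k else 0)"
      unfolding a'_def by (simp only: distrib_right sum.distrib if_distrib[where f="\<lambda>x. x * _"] mult_zero_left)
    also have "(\<Sum>k=1..p. if k = j then - s / v * G \<omega> k else 0) = - s / v * G \<omega> j"
      using j by (subst sum.delta) auto
    finally have *: "(\<Sum>k=1..p. a' k * G \<omega> k) = (\<Sum>k=1..p. a k * G \<omega> k) - s / v * G \<omega> j" by simp
    have "(\<Sum>k=1..p. a k * regression p \<Sigma> j G z \<omega> k)
      = (\<Sum>k=1..p. (a k * \<Sigma> j k) * (z / sqrt v) + (a k * G \<omega> k - (a k * \<Sigma> j k) * (G \<omega> j / v)))"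
      unfolding regression_def v_def by (intro sum.cong) (auto simp: algebra_simps)
    also have "\<dots> = s * (z / sqrt v) + ((\<Sum>k=1..p. a k * G \<omega> k) - s * (G \<omega> j / v))"
      by (simp only: sum.distrib sum_subtractf sum_distrib_right s_def)
    finally show ?thesis using * by simp
  qed
  have ms: "(\<lambda>\<omega>. \<Sum>k=1..p. a' k * G \<omega> k) \<in> borel_measurable M" for a'
    by (intro borel_measurable_sum borel_measurable_times borel_measurable_const measurable_G_coord)
  have "(CLINT x|distr (std_normal_distribution \<Otimes>\<^sub>M M) (rvec p) (\<lambda>(z, \<omega>). regression p \<Sigma> j G z \<omega>). iexp (\<Sum>k=1..p. a k * x k))
    = (CLINT w|std_normal_distribution \<Otimes>\<^sub>M M. iexp (\<Sum>k=1..p. a k * (case w of (z, \<omega>) \<Rightarrow> regression p \<Sigma> j G z \<omega>) k))"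
    by (intro integral_distr) measurable
  also have "\<dots> = (CLINT w|std_normal_distribution \<Otimes>\<^sub>M M. case w of (z, \<omega>) \<Rightarrow> iexp ((s / sqrt v) * z) * iexp (\<Sum>k=1..p. a' k * G \<omega> k))"
    by (intro Bochner_Integration.integral_cong refl) (simp only: case_prod_beta sp exp_add[symmetric] of_real_add distrib_left)
  also have "\<dots> = (CLINT \<omega>|M. (CLINT z|std_normal_distribution. iexp ((s / sqrt v) * z) * iexp (\<Sum>k=1..p. a' k * G \<omega> k)))"
  proof (rule P.integral_snd[symmetric])
    note [measurable] = ms
    show "integrable (std_normal_distribution \<Otimes>\<^sub>M M) (\<lambda>(z, \<omega>). iexp ((s / sqrt v) * z) * iexp (\<Sum>k=1..p. a' k * G \<omega> k))"
      by (rule P.P.integrable_const_bound[where B=1]) (auto simp: norm_mult case_prod_beta)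
  qed
  also have "\<dots> = (CLINT \<omega>|M. char std_normal_distribution (s / sqrt v) * iexp (\<Sum>k=1..p. a' k * G \<omega> k))"
    by (simp add: char_def)
  also have "\<dots> = char std_normal_distribution (s / sqrt v) * complex_of_real (exp (- quad a' / 2))"
    using char_G[of a'] by simp
  also have "\<dots> = complex_of_real (exp (- ((s / sqrt v)\<^sup>2) / 2) * exp (- quad a' / 2))"
    by (simp only: char_std_normal_distribution of_real_mult)
  also have "exp (- ((s / sqrt v)\<^sup>2) / 2) * exp (- quad a' / 2) = exp (- quad a / 2)"
    using v by (simp add: exp_add[symmetric] q power_divide) (simp add: field_simps)
  also have "complex_of_real (exp (- quad a / 2)) = (CLINT x|distr M (rvec p) G. iexp (\<Sum>k=1..p. a k * x k))"
    unfolding char_G[symmetric] by (intro integral_distr[symmetric]) measurable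
  finally show "(CLINT x|distr M (rvec p) G. iexp (\<Sum>k=1..p. a k * x k)) =
    (CLINT x|distr (std_normal_distribution \<Otimes>\<^sub>M M) (rvec p) (\<lambda>(z, \<omega>). regression p \<Sigma> j G z \<omega>). iexp (\<Sum>k=1..p. a k * x k))"
    by simp
qed simp_all

text \<open>The normal variable is integrated first, with the residual frozen, so that
  one-dimensional facts about the standard normal law carry over to \<open>G\<close>.\<close>

lemma expectation_regression:
  fixes F :: "(nat \<Rightarrow> real) \<Rightarrow> real"
  assumes j: "j \<in> {1..p}" and F [measurable]: "F \<in> borel_measurable (rvec p)"
    and i: "integrable (std_normal_distribution \<Otimes>\<^sub>M M) (\<lambda>(z, \<omega>). F (regression p \<Sigma> j G z \<omega>))"
  shows "integrable M (\<lambda>\<omega>. F (G \<omega>))"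
    "(\<integral>\<omega>. F (G \<omega>) \<partial>M) = (\<integral>\<omega>. (\<integral>z. F (regression p \<Sigma> j G z \<omega>) \<partial>std_normal_distribution) \<partial>M)"
    "integrable M (\<lambda>\<omega>. \<integral>z. F (regression p \<Sigma> j G z \<omega>) \<partial>std_normal_distribution)"
proof -
  interpret N: prob_space std_normal_distribution by (rule prob_space_std_normal)
  interpret P: pair_prob_space std_normal_distribution M ..
  note [measurable] = measurable_regression[OF j]
  have *: "(\<lambda>(z, \<omega>). F (regression p \<Sigma> j G z \<omega>)) = (\<lambda>w. F (case w of (z, \<omega>) \<Rightarrow> regression p \<Sigma> j G z \<omega>))"
    by auto
  have "integrable (distr (std_normal_distribution \<Otimes>\<^sub>M M) (rvec p) (\<lambda>(z, \<omega>). regression p \<Sigma> j G z \<omega>)) F"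
    using i unfolding * by (subst integrable_distr_eq) measurable
  then have "integrable (distr M (rvec p) G) F" unfolding distr_regression[OF j] .
  then show "integrable M (\<lambda>\<omega>. F (G \<omega>))" by (subst (asm) integrable_distr_eq) measurable
  have "(\<integral>\<omega>. F (G \<omega>) \<partial>M) = (\<integral>x. F x \<partial>distr M (rvec p) G)" by (intro integral_distr[symmetric]) measurable
  also have "\<dots> = (\<integral>w. F (case w of (z, \<omega>) \<Rightarrow> regression p \<Sigma> j G z \<omega>) \<partial>(std_normal_distribution \<Otimes>\<^sub>M M))"
    unfolding distr_regression[OF j] by (intro integral_distr) measurable
  also have "\<dots> = (\<integral>\<omega>. (\<integral>z. F (regression p \<Sigma> j G z \<omega>) \<partial>std_normal_distribution) \<partial>M)"
    unfolding *[symmetric] by (rule P.integral_snd[symmetric, OF i])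
  finally show "(\<integral>\<omega>. F (G \<omega>) \<partial>M) = (\<integral>\<omega>. (\<integral>z. F (regression p \<Sigma> j G z \<omega>) \<partial>std_normal_distribution) \<partial>M)" .
  show "integrable M (\<lambda>\<omega>. \<integral>z. F (regression p \<Sigma> j G z \<omega>) \<partial>std_normal_distribution)"
    by (rule P.integrable_snd[OF i])
qed

lemma regression_self:
  assumes j: "j \<in> {1..p}" shows "regression p \<Sigma> j G z \<omega> j = sqrt (\<Sigma> j j) * z"
  using j pos_var[OF j] by (simp add: regression_def real_div_sqrt del: times_divide_eq_left)

lemma integrable_std_normal_coord:
  assumes "f \<in> borel_measurable (std_normal_distribution \<Otimes>\<^sub>M M)" and b: "\<And>z \<omega>. \<bar>f (z, \<omega>)\<bar> \<le> C"
  shows "integrable (std_normal_distribution \<Otimes>\<^sub>M M) (\<lambda>(z, \<omega>). z * (f (z, \<omega>) :: real))"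
proof -
  interpret N: prob_space std_normal_distribution by (rule prob_space_std_normal)
  interpret P: pair_prob_space std_normal_distribution M ..
  note [measurable] = assms(1)
  have [measurable]: "(\<lambda>z. z) \<in> std_normal_distribution \<rightarrow>\<^sub>M borel" by simp
  have C: "0 \<le> C" using order_trans[OF abs_ge_zero b] .
  have i: "integrable std_normal_distribution (\<lambda>z. \<bar>z\<bar>)"
    using integrable_std_normal_moment_abs[of 1] by (subst integrable_density) auto
  have "integrable (std_normal_distribution \<Otimes>\<^sub>M M) (\<lambda>(z, \<omega>). C * \<bar>z\<bar>)"
    using i by (intro P.Fubini_integrable) (auto simp: case_prod_beta prob_space)
  then show ?thesis
  proof (rule Bochner_Integration.integrable_bound)
    show "AE x in std_normal_distribution \<Otimes>\<^sub>M M. norm (case x of (z, \<omega>) \<Rightarrow> z * f (z, \<omega>)) \<le> norm (case x of (z, \<omega>) \<Rightarrow> C * \<bar>z\<bar>)"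
      using b C by (intro AE_I2) (auto simp: abs_mult mult.commute[of C] intro!: mult_left_mono)
  qed (simp add: case_prod_beta)
qed

text \<open>One-dimensional integration by parts along the regression line, then Fubini.
  Differentiability is asked for along affine lines in the coordinates, the only place where it
  enters; \<open>D g k\<close> has the role of the partial derivative. Division by the standard
  deviation in the direction cancels the factor in front of \<open>z\<close>.\<close>

lemma integration_by_parts:
  fixes F :: "(nat \<Rightarrow> real) \<Rightarrow> real" and D :: "(nat \<Rightarrow> real) \<Rightarrow> nat \<Rightarrow> real"
  assumes j: "j \<in> {1..p}" and F [measurable]: "F \<in> borel_measurable (rvec p)"
    and D: "\<And>k. k \<in> {1..p} \<Longrightarrow> (\<lambda>g. D g k) \<in> borel_measurable (rvec p)"
    and der: "\<And>b r z. ((\<lambda>z. F (\<lambda>k\<in>{1..p}. b k * z + r k)) has_real_derivative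
        (\<Sum>k=1..p. b k * D (\<lambda>k\<in>{1..p}. b k * z + r k) k)) (at z)"
    and cont: "\<And>b r z k. k \<in> {1..p} \<Longrightarrow> isCont (\<lambda>z. D (\<lambda>k\<in>{1..p}. b k * z + r k) k) z"
    and bF: "\<And>g. \<bar>F g\<bar> \<le> C" and bD: "\<And>g k. \<bar>D g k\<bar> \<le> C"
  shows "integrable M (\<lambda>\<omega>. G \<omega> j * F (G \<omega>))"
    "(\<integral>\<omega>. G \<omega> j * F (G \<omega>) \<partial>M) = (\<Sum>k=1..p. \<Sigma> j k * (\<integral>\<omega>. D (G \<omega>) k \<partial>M))"
proof -
  interpret N: prob_space std_normal_distribution by (rule prob_space_std_normal)
  interpret P: pair_prob_space std_normal_distribution M ..
  note [measurable] = measurable_regression[OF j]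
  let ?T = "regression p \<Sigma> j G"
  define v where "v = sqrt (\<Sigma> j j)"
  have v: "0 < v" using pos_var[OF j] by (simp add: v_def)
  have mF: "(\<lambda>w. F (case w of (z, \<omega>) \<Rightarrow> ?T z \<omega>)) \<in> borel_measurable (std_normal_distribution \<Otimes>\<^sub>M M)"
    by measurable
  have mD: "(\<lambda>w. D (case w of (z, \<omega>) \<Rightarrow> ?T z \<omega>) k) \<in> borel_measurable (std_normal_distribution \<Otimes>\<^sub>M M)" if "k \<in> {1..p}" for k
    using D[OF that] by (rule measurable_compose[rotated]) measurable
  have "integrable (std_normal_distribution \<Otimes>\<^sub>M M) (\<lambda>(z, \<omega>). z * F (case (z, \<omega>) of (z, \<omega>) \<Rightarrow> ?T z \<omega>))"
    using mF bF by (rule integrable_std_normal_coord)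
  then have "integrable (std_normal_distribution \<Otimes>\<^sub>M M) (\<lambda>w. v * (case w of (z, \<omega>) \<Rightarrow> z * F (?T z \<omega>)))"
    by (intro integrable_mult_right) simp
  then have i: "integrable (std_normal_distribution \<Otimes>\<^sub>M M) (\<lambda>(z, \<omega>). ?T z \<omega> j * F (?T z \<omega>))"
    unfolding case_prod_beta regression_self[OF j] v_def mult.assoc by (simp only: mult.assoc fst_conv snd_conv)
  have mjF: "(\<lambda>g. g j * F g) \<in> borel_measurable (rvec p)"
    using j by measurable
  show "integrable M (\<lambda>\<omega>. G \<omega> j * F (G \<omega>))"
    by (rule expectation_regression(1)[OF j mjF i])
  have iD: "integrable (std_normal_distribution \<Otimes>\<^sub>M M) (\<lambda>(z, \<omega>). D (?T z \<omega>) k)" if "k \<in> {1..p}" for k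
    by (rule P.P.integrable_const_bound[where B=C]) (use bD mD[OF that] in \<open>auto simp: case_prod_beta\<close>)
  have T: "?T z \<omega> = (\<lambda>k\<in>{1..p}. \<Sigma> j k / v * z + (G \<omega> k - \<Sigma> j k / \<Sigma> j j * G \<omega> j))" for z \<omega>
    by (simp add: regression_def v_def)
  have isc: "isCont (\<lambda>z. D (?T z \<omega>) k) z" if "k \<in> {1..p}" for \<omega> z k
    unfolding T by (rule cont[OF that])
  have in_D: "integrable std_normal_distribution (\<lambda>z. D (?T z \<omega>) k)" if "k \<in> {1..p}" for \<omega> k
  proof (rule N.integrable_const_bound[where B=C])
    show "(\<lambda>z. D (?T z \<omega>) k) \<in> borel_measurable std_normal_distribution"
      using isc[OF that] by (auto intro!: borel_measurable_continuous_onI continuous_at_imp_continuous_on)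
  qed (use bD in auto)
  have inner: "(\<integral>z. ?T z \<omega> j * F (?T z \<omega>) \<partial>std_normal_distribution)
     = (\<Sum>k=1..p. \<Sigma> j k * (\<integral>z. D (?T z \<omega>) k \<partial>std_normal_distribution))" for \<omega>
  proof -
    have "(\<integral>z. ?T z \<omega> j * F (?T z \<omega>) \<partial>std_normal_distribution) = v * (\<integral>z. z * F (?T z \<omega>) \<partial>std_normal_distribution)"
      by (simp add: regression_self[OF j] v_def mult.assoc)
    also have "(\<integral>z. z * F (?T z \<omega>) \<partial>std_normal_distribution)
      = (\<integral>z. (\<Sum>k=1..p. \<Sigma> j k / v * D (?T z \<omega>) k) \<partial>std_normal_distribution)"
    proof (rule std_normal_integral_by_parts)
      show "((\<lambda>z. F (?T z \<omega>)) has_real_derivative (\<Sum>k=1..p. \<Sigma> j k / v * D (?T z \<omega>) k)) (at z)" for z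
        unfolding T by (rule der)
      show "isCont (\<lambda>z. \<Sum>k=1..p. \<Sigma> j k / v * D (?T z \<omega>) k) z" for z
        by (intro continuous_intros isc)
      show "\<bar>F (?T z \<omega>)\<bar> \<le> C + (\<Sum>k=1..p. \<bar>\<Sigma> j k / v\<bar> * C)" for z
        using bF[of "?T z \<omega>"] order_trans[OF abs_ge_zero bF]
        by (intro order_trans[OF bF]) (auto intro!: sum_nonneg)
      have "\<bar>\<Sum>k=1..p. \<Sigma> j k / v * D (?T z \<omega>) k\<bar> \<le> (\<Sum>k=1..p. \<bar>\<Sigma> j k / v\<bar> * C)" for z
        by (rule order_trans[OF sum_abs], rule sum_mono, subst abs_mult) (intro mult_left_mono bD abs_ge_zero)
      then show "\<bar>\<Sum>k=1..p. \<Sigma> j k / v * D (?T z \<omega>) k\<bar> \<le> C + (\<Sum>k=1..p. \<bar>\<Sigma> j k / v\<bar> * C)" for z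
        using order_trans[OF abs_ge_zero bF] by (meson add_increasing)
    qed
    also have "\<dots> = (\<Sum>k=1..p. \<Sigma> j k / v * (\<integral>z. D (?T z \<omega>) k \<partial>std_normal_distribution))"
      using in_D by (subst Bochner_Integration.integral_sum) auto
    finally show ?thesis using v by (simp add: sum_distrib_left)
  qed
  have "(\<integral>\<omega>. G \<omega> j * F (G \<omega>) \<partial>M) = (\<integral>\<omega>. (\<Sum>k=1..p. \<Sigma> j k * (\<integral>z. D (?T z \<omega>) k \<partial>std_normal_distribution)) \<partial>M)"
    unfolding expectation_regression(2)[OF j mjF i] inner ..
  also have "\<dots> = (\<Sum>k=1..p. \<Sigma> j k * (\<integral>\<omega>. (\<integral>z. D (?T z \<omega>) k \<partial>std_normal_distribution) \<partial>M))"
    using expectation_regression(3)[OF j D iD] by (subst Bochner_Integration.integral_sum) auto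
  also have "\<dots> = (\<Sum>k=1..p. \<Sigma> j k * (\<integral>\<omega>. D (G \<omega>) k \<partial>M))"
    using expectation_regression(2)[OF j D iD] by simp
  finally show "(\<integral>\<omega>. G \<omega> j * F (G \<omega>) \<partial>M) = (\<Sum>k=1..p. \<Sigma> j k * (\<integral>\<omega>. D (G \<omega>) k \<partial>M))" .
qed

lemma integrable_G:
  assumes j: "j \<in> {1..p}" shows "integrable M (\<lambda>\<omega>. G \<omega> j)"
  using integration_by_parts(1)[OF j, of "\<lambda>_. 1" "\<lambda>_ _. 0" 1] by simp

end

section \<open>Gaussian anti-concentration\<close>

lemma std_normal_measure_le:
  assumes "a \<le> b" "\<And>x. a < x \<Longrightarrow> x \<le> b \<Longrightarrow> std_normal_density x \<le> c"
  shows "measure std_normal_distribution {a<..b} \<le> (b - a) * c"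
proof -
  interpret N: prob_space std_normal_distribution by (rule prob_space_std_normal)
  show ?thesis
  proof (cases "a = b")
    case True
    then show ?thesis by simp
  next
    case False
    then have c0: "0 \<le> c"
      using assms order_trans[OF normal_density_nonneg assms(2)[of b]] by (simp add: less_le)
    have "emeasure std_normal_distribution {a<..b} = (\<integral>\<^sup>+x. ennreal (std_normal_density x) * indicator {a<..b} x \<partial>lborel)"
      by (subst emeasure_density) auto
    also have "\<dots> \<le> (\<integral>\<^sup>+x. ennreal c * indicator {a<..b} x \<partial>lborel)"
      using assms(2) by (intro nn_integral_mono) (auto simp: indicator_def intro!: ennreal_leI)
    also have "\<dots> = ennreal c * ennreal (b - a)" using assms(1) by (simp add: nn_integral_cmult_indicator)
    also have "\<dots> = ennreal ((b - a) * c)" using assms(1) by (simp add: ennreal_mult'[OF c0] mult.commute)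
    finally show ?thesis using c0 assms(1) by (simp add: N.emeasure_eq_measure)
  qed
qed

lemma std_normal_measure_ge:
  assumes "a \<le> b" "0 \<le> c" "\<And>x. a < x \<Longrightarrow> x \<le> b \<Longrightarrow> c \<le> std_normal_density x"
  shows "(b - a) * c \<le> measure std_normal_distribution {a<..b}"
proof -
  interpret N: prob_space std_normal_distribution by (rule prob_space_std_normal)
  have "ennreal ((b - a) * c) = ennreal c * ennreal (b - a)" using assms by (simp add: ennreal_mult' mult.commute)
  also have "\<dots> = (\<integral>\<^sup>+x. ennreal c * indicator {a<..b} x \<partial>lborel)" using assms(1) by (simp add: nn_integral_cmult_indicator)
  also have "\<dots> \<le> (\<integral>\<^sup>+x. ennreal (std_normal_density x) * indicator {a<..b} x \<partial>lborel)"
    using assms(3) by (intro nn_integral_mono) (auto simp: indicator_def intro!: ennreal_leI)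
  also have "\<dots> = emeasure std_normal_distribution {a<..b}"
    by (subst emeasure_density) auto
  finally show ?thesis by (simp add: N.emeasure_eq_measure)
qed

lemma std_normal_density_mono:
  assumes "\<bar>x\<bar> \<le> \<bar>y\<bar>" shows "std_normal_density y \<le> std_normal_density x"
proof -
  have "x\<^sup>2 \<le> y\<^sup>2" using assms by (simp add: abs_le_square_iff)
  then show ?thesis unfolding std_normal_density_def by (intro mult_left_mono) auto
qed

lemma std_normal_density_0: "std_normal_density 0 \<le> 1"
proof -
  have "1 \<le> sqrt (2 * pi)" using pi_ge_two by (intro real_le_rsqrt) auto
  then show ?thesis by (simp add: std_normal_density_def)
qed

text \<open>A bound of Mills type: to the left of \<open>L\<close>, the mass of a short interval is
  at most of order \<open>(L + 1) * d\<close> times the tail behind it, because the density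
  decreases by a bounded factor over the distance \<open>2 / (L + 1)\<close>.\<close>

lemma std_normal_interval_le_tail:
  assumes L: "1 \<le> L" and d: "0 \<le> d" "d \<le> 1 / (L + 1)" and x: "x < L"
  shows "measure std_normal_distribution {x<..x + d}
    \<le> exp 4 * (L + 1) * d * measure std_normal_distribution {x + d<..}"
proof -
  interpret N: prob_space std_normal_distribution by (rule prob_space_std_normal)
  \<comment> \<open>Moving from \<open>x\<close> to \<open>x + 2 * h\<close> increases half the
    square by \<open>2 * x * h + 2 * h^2\<close>, at most 4. This is the origin of
    \<open>exp 4\<close>.\<close>
  define h where "h = 1 / (L + 1)"
  have h: "0 < h" "h \<le> 1 / 2" "h * (L + 1) = 1" using L by (auto simp: h_def field_simps)
  show ?thesis
  \<comment> \<open>For negative \<open>x\<close> the tail contains the fixed interval from 1/2 to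
    1, since \<open>d\<close> is at most 1/2, and the density is bounded by its value at 0.\<close>
  proof (cases "x < 0")
    case True
    have "measure std_normal_distribution {x<..x + d} \<le> (x + d - x) * std_normal_density 0"
      using d by (intro std_normal_measure_le std_normal_density_mono) auto
    then have 1: "measure std_normal_distribution {x<..x + d} \<le> d * std_normal_density 0" by simp
    have "(1 - 1/2) * std_normal_density 1 \<le> measure std_normal_distribution {1/2<..1}"
      by (intro std_normal_measure_ge std_normal_density_mono) auto
    also have "\<dots> \<le> measure std_normal_distribution {x + d<..}"
      using True d(2) h(2) unfolding h_def[symmetric] by (intro N.finite_measure_mono) auto
    finally have 2: "std_normal_density 1 \<le> 2 * measure std_normal_distribution {x + d<..}" by simp
    have 3: "std_normal_density 0 = exp (1/2) * std_normal_density 1"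
      by (simp add: std_normal_density_def exp_minus)
    have "measure std_normal_distribution {x<..x + d} \<le> d * (exp (1/2) * (2 * measure std_normal_distribution {x + d<..}))"
      using order_trans[OF 1[unfolded 3] mult_left_mono[OF mult_left_mono[OF 2]]] d by simp
    also have "\<dots> = (exp (1/2) * 2) * d * measure std_normal_distribution {x + d<..}" by simp
    also have "\<dots> \<le> (exp 4 * (L + 1)) * d * measure std_normal_distribution {x + d<..}"
      using d L by (intro mult_right_mono mult_mono) auto
    finally show ?thesis .
  next
    case False
    have "measure std_normal_distribution {x<..x + d} \<le> (x + d - x) * std_normal_density x"
      using d False by (intro std_normal_measure_le std_normal_density_mono) auto
    then have 1: "measure std_normal_distribution {x<..x + d} \<le> d * std_normal_density x" by simp
    have "((x + d + h) - (x + d)) * std_normal_density (x + 2 * h) \<le> measure std_normal_distribution {x + d<..x + d + h}"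
      using h False d by (intro std_normal_measure_ge std_normal_density_mono) (auto simp: h_def)
    also have "\<dots> \<le> measure std_normal_distribution {x + d<..}"
      by (intro N.finite_measure_mono) auto
    finally have "h * std_normal_density (x + 2 * h) \<le> measure std_normal_distribution {x + d<..}" by simp
    then have "(L + 1) * (h * std_normal_density (x + 2 * h)) \<le> (L + 1) * measure std_normal_distribution {x + d<..}"
      using L by (intro mult_left_mono) auto
    moreover have "(L + 1) * (h * std_normal_density (x + 2 * h)) = std_normal_density (x + 2 * h)"
      using h(3) by (metis mult.assoc mult.commute mult_1)
    ultimately have 2: "std_normal_density (x + 2 * h) \<le> (L + 1) * measure std_normal_distribution {x + d<..}" by simp
    have "x * h \<le> (L + 1) * h" using x h by (intro mult_right_mono) auto
    then have "x * h \<le> 1" using h(3) by (simp add: mult.commute)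
    moreover have "h * h \<le> 1" using h by (intro mult_le_one) auto
    ultimately have "- (x\<^sup>2 / 2) \<le> 4 - (x + 2 * h)\<^sup>2 / 2" by (simp add: power2_eq_square field_simps)
    then have "exp (- x\<^sup>2 / 2) \<le> exp 4 * exp (- (x + 2 * h)\<^sup>2 / 2)" by (simp add: exp_add[symmetric])
    then have "1 / sqrt (2 * pi) * exp (- x\<^sup>2 / 2) \<le> 1 / sqrt (2 * pi) * (exp 4 * exp (- (x + 2 * h)\<^sup>2 / 2))"
      by (rule mult_left_mono) simp
    then have 3: "std_normal_density x \<le> exp 4 * std_normal_density (x + 2 * h)"
      unfolding std_normal_density_def by (simp only: mult.left_commute)
    have "measure std_normal_distribution {x<..x + d} \<le> d * (exp 4 * ((L + 1) * measure std_normal_distribution {x + d<..}))"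
      using 1 3 2 d by (meson mult_left_mono exp_ge_zero order_trans)
    then show ?thesis by (simp add: ac_simps)
  qed
qed

text \<open>If the up-set \<open>Q\<close> meets the interval, it contains the whole tail behind it,
  so the tail bound applies to the left of \<open>L\<close>. From \<open>L\<close> on, the interval
  has mass at most \<open>d\<close> times the density at \<open>L\<close>.\<close>

lemma std_normal_upclosed:
  assumes L: "1 \<le> L" and d: "0 \<le> d" "d \<le> 1 / (L + 1)" and Q: "Q \<in> sets borel"
    and up: "\<And>z z'. z \<in> Q \<Longrightarrow> z \<le> z' \<Longrightarrow> z' \<in> Q"
  shows "measure std_normal_distribution ({x<..x + d} \<inter> Q)
    \<le> exp 4 * (L + 1) * d * measure std_normal_distribution Q + d * std_normal_density L"
proof -
  interpret N: prob_space std_normal_distribution by (rule prob_space_std_normal)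
  have Q' [measurable]: "Q \<in> sets borel" by fact
  show ?thesis
  proof (cases "x < L")
    case True
    show ?thesis
    proof (cases "{x<..x + d} \<inter> Q = {}")
      case True
      then show ?thesis using L d by simp
    next
      case False
      then obtain z where "z \<in> Q" "z \<le> x + d" by auto
      then have sub: "{x + d<..} \<subseteq> Q" using up by (meson greaterThan_iff less_imp_le order_trans subsetI)
      have "measure std_normal_distribution ({x<..x + d} \<inter> Q) \<le> measure std_normal_distribution {x<..x + d}"
        by (intro N.finite_measure_mono) auto
      also have "\<dots> \<le> exp 4 * (L + 1) * d * measure std_normal_distribution {x + d<..}"
        by (rule std_normal_interval_le_tail[OF L d True])
      also have "\<dots> \<le> exp 4 * (L + 1) * d * measure std_normal_distribution Q"
        using L d sub by (intro mult_left_mono N.finite_measure_mono) auto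
      finally show ?thesis using d by (smt (verit) mult_nonneg_nonneg normal_density_nonneg)
    qed
  next
    case False
    have "measure std_normal_distribution ({x<..x + d} \<inter> Q) \<le> measure std_normal_distribution {x<..x + d}"
      by (intro N.finite_measure_mono) auto
    also have "\<dots> \<le> (x + d - x) * std_normal_density L"
      using d L False by (intro std_normal_measure_le std_normal_density_mono) auto
    finally show ?thesis using L d by (simp add: add_increasing)
  qed
qed

section \<open>Disjoint maximality events and Nazarov's inequality\<close>

context centered_normal
begin

text \<open>Cauchy-Schwarz: the quadratic form at \<open>t\<close> times the \<open>j\<close>-th
  minus \<open>s\<close> times the \<open>k\<close>-th unit vector is
  \<open>2 * (s * t) * (s * t - \<Sigma> j k)\<close>, and it is nonnegative.\<close>

lemma cov_le:
  assumes j: "j \<in> {1..p}" and k: "k \<in> {1..p}"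
  shows "\<Sigma> j k \<le> sqrt (\<Sigma> j j) * sqrt (\<Sigma> k k)"
proof (cases "j = k")
  case True
  then show ?thesis using pos_var[OF j] by simp
next
  case False
  define s t where "s = sqrt (\<Sigma> j j)" and "t = sqrt (\<Sigma> k k)"
  have st: "0 < s" "0 < t" "\<Sigma> j j = s * s" "\<Sigma> k k = t * t" using pos_var[OF j] pos_var[OF k] by (auto simp: s_def t_def)
  have z: "quad (\<lambda>i. 0 + (if i = j then c else 0)) = c * c * \<Sigma> j j" for c
    unfolding quad_shift[OF j] by (simp add: quad_def)
  have "quad (\<lambda>i. (0 + (if i = j then t else 0)) + (if i = k then - s else 0))
     = t * t * \<Sigma> j j + 2 * (- s) * (\<Sum>i=1..p. \<Sigma> k i * (0 + (if i = j then t else 0))) + (- s) * (- s) * \<Sigma> k k"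
    unfolding quad_shift[OF k] z ..
  also have "(\<Sum>i=1..p. \<Sigma> k i * (0 + (if i = j then t else 0))) = \<Sigma> k j * t"
    using j by (subst sum.remove[OF _ j]) (auto simp: sum.neutral)
  also have "t * t * \<Sigma> j j + 2 * (- s) * (\<Sigma> k j * t) + (- s) * (- s) * \<Sigma> k k = 2 * (s * t) * (s * t - \<Sigma> j k)"
    unfolding st sym_cov[of k j] by (simp add: algebra_simps)
  finally have "0 \<le> 2 * (s * t) * (s * t - \<Sigma> j k)" using quad_nonneg by metis
  moreover have "0 < 2 * (s * t)" using st by simp
  ultimately have "0 \<le> s * t - \<Sigma> j k" by (simp only: zero_le_mult_iff) linarith
  then show ?thesis by (simp add: s_def t_def)
qed

text \<open>Ties are broken by the smallest index, so that these events are disjoint. Along the regression on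
  coordinate \<open>j\<close> they are up-sets in \<open>z\<close>, because correlations are at most one.\<close>

definition first_max :: "(nat \<Rightarrow> real) \<Rightarrow> nat \<Rightarrow> (nat \<Rightarrow> real) \<Rightarrow> bool" where
  "first_max x j g \<longleftrightarrow> (\<forall>k\<in>{1..p}. if k < j then g k / sqrt (\<Sigma> k k) - x k < g j / sqrt (\<Sigma> j j) - x j
      else g k / sqrt (\<Sigma> k k) - x k \<le> g j / sqrt (\<Sigma> j j) - x j)"

lemma first_max_regression_mono:
  assumes j: "j \<in> {1..p}" and z: "z \<le> z'"
    and fm: "first_max x j (regression p \<Sigma> j G z \<omega>)"
  shows "first_max x j (regression p \<Sigma> j G z' \<omega>)"
  unfolding first_max_def
proof
  fix k assume k: "k \<in> {1..p}"
  let ?T = "regression p \<Sigma> j G"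
  let ?s = "\<lambda>k. sqrt (\<Sigma> k k)"
  have s: "0 < ?s k" "0 < ?s j" using pos_var j k by auto
  have "?T z' \<omega> k / ?s k - ?T z \<omega> k / ?s k = (\<Sigma> j k / (?s j * ?s k)) * (z' - z)"
    using k s by (simp add: regression_def field_simps)
  also have "\<dots> \<le> 1 * (z' - z)"
    using cov_le[OF j k] s z by (intro mult_right_mono) auto
  also have "\<dots> = ?T z' \<omega> j / ?s j - ?T z \<omega> j / ?s j"
    using s unfolding regression_self[OF j] by simp
  finally show "if k < j then ?T z' \<omega> k / ?s k - x k < ?T z' \<omega> j / ?s j - x j
      else ?T z' \<omega> k / ?s k - x k \<le> ?T z' \<omega> j / ?s j - x j"
    using fm[unfolded first_max_def, rule_format, OF k] by (auto split: if_splits)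
qed

lemma measurable_first_max:
  assumes "j \<in> {1..p}" shows "Measurable.pred (rvec p) (first_max x j)"
proof -
  have m: "(\<lambda>g. g k / sqrt (\<Sigma> k k) - x k) \<in> borel_measurable (rvec p)" if "k \<in> {1..p}" for k
    using that by (intro borel_measurable_diff borel_measurable_divide borel_measurable_const measurable_component_singleton)
  note [measurable] = m[OF assms]
  have "Measurable.pred (rvec p) (\<lambda>g. if k < j then g k / sqrt (\<Sigma> k k) - x k < g j / sqrt (\<Sigma> j j) - x j
      else g k / sqrt (\<Sigma> k k) - x k \<le> g j / sqrt (\<Sigma> j j) - x j)" if "k \<in> {1..p}" for k
  proof -
    note [measurable] = m[OF that]
    have "Measurable.pred (rvec p) (\<lambda>g. g k / sqrt (\<Sigma> k k) - x k < g j / sqrt (\<Sigma> j j) - x j)"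
      "Measurable.pred (rvec p) (\<lambda>g. g k / sqrt (\<Sigma> k k) - x k \<le> g j / sqrt (\<Sigma> j j) - x j)"
      unfolding pred_def using m[OF that] m[OF assms] by (auto intro: borel_measurable_less borel_measurable_le)
    then show ?thesis by (cases "k < j") (simp_all only: if_True if_False)
  qed
  then show ?thesis unfolding first_max_def by (intro pred_intros_finite) auto
qed

text \<open>With the residual frozen, the event that \<open>j\<close> is the first maximiser is an
  up-set in \<open>z\<close>, and the strip condition is an interval of length \<open>d\<close>. The
  bound for up-sets is then averaged over the residual.\<close>

lemma first_max_strip:
  assumes j: "j \<in> {1..p}" and L: "1 \<le> L" and d: "0 \<le> d" "d \<le> 1 / (L + 1)"
  shows "prob {\<omega> \<in> space M. first_max x j (G \<omega>) \<and> x j < G \<omega> j / sqrt (\<Sigma> j j) \<and> G \<omega> j / sqrt (\<Sigma> j j) \<le> x j + d}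
    \<le> exp 4 * (L + 1) * d * prob {\<omega> \<in> space M. first_max x j (G \<omega>)} + d * std_normal_density L"
proof -
  interpret N: prob_space std_normal_distribution by (rule prob_space_std_normal)
  interpret P: pair_prob_space std_normal_distribution M ..
  note [measurable] = measurable_first_max[OF j] measurable_regression[OF j]
  let ?T = "regression p \<Sigma> j G"
  define F where "F = (\<lambda>g. of_bool (first_max x j g) :: real)"
  define F' where "F' = (\<lambda>g. of_bool (first_max x j g \<and> x j < g j / sqrt (\<Sigma> j j) \<and> g j / sqrt (\<Sigma> j j) \<le> x j + d) :: real)"
  have mF [measurable]: "F \<in> borel_measurable (rvec p)" and mF' [measurable]: "F' \<in> borel_measurable (rvec p)"
    unfolding F_def F'_def using j by measurable
  have iT: "integrable (std_normal_distribution \<Otimes>\<^sub>M M) (\<lambda>(z, \<omega>). H (?T z \<omega>))"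
    if "H \<in> borel_measurable (rvec p)" "\<And>g. \<bar>H g\<bar> \<le> (1::real)" for H
  proof (rule P.P.integrable_const_bound[where B=1])
    show "(\<lambda>(z, \<omega>). H (?T z \<omega>)) \<in> borel_measurable (std_normal_distribution \<Otimes>\<^sub>M M)"
      using measurable_compose[OF measurable_regression[OF j] that(1)] by (simp add: case_prod_beta)
  qed (use that in auto)
  have b: "\<bar>F g\<bar> \<le> 1" "\<bar>F' g\<bar> \<le> 1" for g by (auto simp: F_def F'_def)
  note eF = expectation_regression[OF j, of F, OF _ iT] and eF' = expectation_regression[OF j, of F', OF _ iT]
  have mQ: "{z. first_max x j (?T z \<omega>)} \<in> sets borel" if "\<omega> \<in> space M" for \<omega>
  proof -
    have "(\<lambda>z. ?T z \<omega>) \<in> std_normal_distribution \<rightarrow>\<^sub>M rvec p"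
      using measurable_compose[OF measurable_Pair2'[OF that] measurable_regression[OF j]] by simp
    then have "{z \<in> space std_normal_distribution. first_max x j (?T z \<omega>)} \<in> sets std_normal_distribution"
      by measurable
    then show ?thesis by simp
  qed
  have inner: "(\<integral>z. F' (?T z \<omega>) \<partial>std_normal_distribution)
     \<le> exp 4 * (L + 1) * d * (\<integral>z. F (?T z \<omega>) \<partial>std_normal_distribution) + d * std_normal_density L"
    if \<omega>: "\<omega> \<in> space M" for \<omega>
  proof -
    let ?Q = "{z. first_max x j (?T z \<omega>)}"
    have "sqrt (\<Sigma> j j) > 0" using pos_var[OF j] by simp
    then have "F' (?T z \<omega>) = indicator ({x j<..x j + d} \<inter> ?Q) z" for z
      unfolding F'_def regression_self[OF j] by (auto simp: indicator_def)
    moreover have "F (?T z \<omega>) = indicator ?Q z" for z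
      by (simp add: F_def indicator_def)
    ultimately show ?thesis
      using std_normal_upclosed[OF L d mQ[OF \<omega>], of "x j"] first_max_regression_mono[OF j] by simp
  qed
  have "prob {\<omega> \<in> space M. first_max x j (G \<omega>) \<and> x j < G \<omega> j / sqrt (\<Sigma> j j) \<and> G \<omega> j / sqrt (\<Sigma> j j) \<le> x j + d}
     = (\<integral>\<omega>. F' (G \<omega>) \<partial>M)"
  proof -
    have [measurable]: "(\<lambda>\<omega>. G \<omega> j) \<in> borel_measurable M" by (rule measurable_G_coord[OF j])
    have "(\<integral>\<omega>. F' (G \<omega>) \<partial>M) = (\<integral>\<omega>. indicator {\<omega> \<in> space M. first_max x j (G \<omega>) \<and> x j < G \<omega> j / sqrt (\<Sigma> j j) \<and> G \<omega> j / sqrt (\<Sigma> j j) \<le> x j + d} \<omega> \<partial>M)"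
      by (intro Bochner_Integration.integral_cong) (auto simp: F'_def indicator_def)
    also have "\<dots> = prob {\<omega> \<in> space M. first_max x j (G \<omega>) \<and> x j < G \<omega> j / sqrt (\<Sigma> j j) \<and> G \<omega> j / sqrt (\<Sigma> j j) \<le> x j + d}"
      by (simp add: emeasure_finite less_top[symmetric] Int_def conj_commute conj_left_commute)
    finally show ?thesis ..
  qed
  also have "\<dots> = (\<integral>\<omega>. (\<integral>z. F' (?T z \<omega>) \<partial>std_normal_distribution) \<partial>M)"
    by (rule eF'(2)[OF mF' mF' b(2)])
  also have "\<dots> \<le> (\<integral>\<omega>. exp 4 * (L + 1) * d * (\<integral>z. F (?T z \<omega>) \<partial>std_normal_distribution) + d * std_normal_density L \<partial>M)"
    using inner eF(3)[OF mF mF b(1)] eF'(3)[OF mF' mF' b(2)] by (intro integral_mono) auto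
  also have "\<dots> = exp 4 * (L + 1) * d * (\<integral>\<omega>. (\<integral>z. F (?T z \<omega>) \<partial>std_normal_distribution) \<partial>M) + d * std_normal_density L"
    using eF(3)[OF mF mF b(1)] by (subst Bochner_Integration.integral_add) (auto simp: prob_space)
  also have "(\<integral>\<omega>. (\<integral>z. F (?T z \<omega>) \<partial>std_normal_distribution) \<partial>M) = (\<integral>\<omega>. F (G \<omega>) \<partial>M)"
    by (rule eF(2)[OF mF mF b(1), symmetric])
  also have "\<dots> = prob {\<omega> \<in> space M. first_max x j (G \<omega>)}"
  proof -
    have "(\<integral>\<omega>. F (G \<omega>) \<partial>M) = (\<integral>\<omega>. indicator {\<omega> \<in> space M. first_max x j (G \<omega>)} \<omega> \<partial>M)"
      by (intro Bochner_Integration.integral_cong) (auto simp: F_def indicator_def)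
    then show ?thesis by (simp add: emeasure_finite less_top[symmetric])
  qed
  finally show ?thesis .
qed

text \<open>If the corner is exceeded by at most \<open>\<delta>\<close>, the coordinate with the
  largest standardised excess lies in a strip of width \<open>d\<close>. The strips are summed over
  the disjoint events of being this coordinate, so the main term carries total probability at most
  one instead of a factor \<open>p\<close>.\<close>

theorem anti_concentration:
  assumes p: "3 \<le> p" and K: "0 < K" "\<And>j. j \<in> {1..p} \<Longrightarrow> K \<le> \<Sigma> j j" and \<delta>: "0 \<le> \<delta>"
  shows "prob {\<omega> \<in> space M. \<forall>j\<in>{1..p}. G \<omega> j \<le> u j + \<delta>} - prob {\<omega> \<in> space M. \<forall>j\<in>{1..p}. G \<omega> j \<le> u j}
    \<le> 4 * exp 4 * sqrt (ln p) * (\<delta> / sqrt K)"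
proof -
  have lnp: "1 \<le> ln (real p)"
  proof -
    have "exp 1 \<le> real p" using exp_le p by linarith
    then show ?thesis using p by (subst ln_ge_iff) auto
  qed
  \<comment> \<open>At this level the density is \<open>1 / p\<close> times its value at 0, so the
    \<open>p\<close> error terms from \<open>first_max_strip\<close> add up to at most
    \<open>d\<close>.\<close>
  define L where "L = sqrt (2 * ln p)"
  have L: "1 \<le> L" unfolding L_def using lnp by (intro real_le_rsqrt) auto
  have sq: "1 \<le> sqrt (ln p)" using lnp by simp
  have "sqrt 2 \<le> 3 / 2" by (rule real_le_lsqrt) (auto simp: power2_eq_square)
  then have L2: "L + 1 \<le> 5 / 2 * sqrt (ln p)"
    using sq mult_right_mono[of "sqrt 2" "3/2" "sqrt (ln p)"] unfolding L_def real_sqrt_mult by linarith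
  define d where "d = \<delta> / sqrt K"
  have d0: "0 \<le> d" using K \<delta> by (simp add: d_def)
  have e4: "1 \<le> exp (4::real)" by simp
  have Gm [measurable]: "(\<lambda>\<omega>. G \<omega> j) \<in> borel_measurable M" if "j \<in> {1..p}" for j
    using that by (rule measurable_G_coord)
  have S [measurable]: "{\<omega> \<in> space M. \<forall>j\<in>{1..p}. G \<omega> j \<le> v j} \<in> events" for v
    by measurable
  define D where "D = prob {\<omega> \<in> space M. \<forall>j\<in>{1..p}. G \<omega> j \<le> u j + \<delta>} - prob {\<omega> \<in> space M. \<forall>j\<in>{1..p}. G \<omega> j \<le> u j}"
  show ?thesis
  \<comment> \<open>For wider strips the claimed bound exceeds one.\<close>
  proof (cases "d \<le> 1 / (L + 1)")
    case False
    have "D \<le> 1" unfolding D_def using prob_le_1 measure_nonneg by (smt (verit))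
    also have "1 \<le> (L + 1) * d" using False L by (simp add: field_simps)
    also have "\<dots> \<le> (5 / 2 * sqrt (ln p)) * d" using L2 d0 by (rule mult_right_mono)
    also have "\<dots> \<le> (4 * exp 4 * sqrt (ln p)) * d" by (intro mult_right_mono; use d0 sq e4 in linarith)
    finally show ?thesis by (simp add: D_def d_def)
  next
    case True
    define x where "x = (\<lambda>j. u j / sqrt (\<Sigma> j j))"
    define A where "A = (\<lambda>j. {\<omega> \<in> space M. first_max x j (G \<omega>)})"
    define A' where "A' = (\<lambda>j. {\<omega> \<in> space M. first_max x j (G \<omega>) \<and> x j < G \<omega> j / sqrt (\<Sigma> j j) \<and> G \<omega> j / sqrt (\<Sigma> j j) \<le> x j + d})"
    have Am: "A j \<in> events" "A' j \<in> events" if "j \<in> {1..p}" for j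
      unfolding A_def A'_def using that measurable_first_max[OF that] by measurable
    have "D = prob ({\<omega> \<in> space M. \<forall>j\<in>{1..p}. G \<omega> j \<le> u j + \<delta>} - {\<omega> \<in> space M. \<forall>j\<in>{1..p}. G \<omega> j \<le> u j})"
      unfolding D_def using \<delta> by (intro finite_measure_Diff[symmetric] S) (auto intro: add_increasing2)
    also have "\<dots> \<le> prob (\<Union>j\<in>{1..p}. A' j)"
    proof (intro finite_measure_mono sets.finite_UN Am subsetI)
      fix \<omega> assume "\<omega> \<in> {\<omega> \<in> space M. \<forall>j\<in>{1..p}. G \<omega> j \<le> u j + \<delta>} - {\<omega> \<in> space M. \<forall>j\<in>{1..p}. G \<omega> j \<le> u j}"
      then have \<omega>: "\<omega> \<in> space M" and le: "\<And>j. j \<in> {1..p} \<Longrightarrow> G \<omega> j \<le> u j + \<delta>"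
        and "\<exists>j\<in>{1..p}. u j < G \<omega> j" by (auto simp: not_le)
      then obtain j0 where j0: "j0 \<in> {1..p}" "u j0 < G \<omega> j0" by auto
      \<comment> \<open>The standardised excess over the corner. Its maximum is positive because
        some coordinate exceeds \<open>u\<close>, and at most \<open>d\<close> because none exceeds
        \<open>u + \<delta>\<close> and all variances are at least \<open>K\<close>.\<close>
      define f where "f = (\<lambda>j. G \<omega> j / sqrt (\<Sigma> j j) - x j)"
      define m where "m = Max (f ` {1..p})"
      have fin: "finite (f ` {1..p})" "f ` {1..p} \<noteq> {}" using p by auto
      have fm: "f k \<le> m" if "k \<in> {1..p}" for k unfolding m_def using fin that by (intro Max_ge) auto
      obtain j1 where j1: "j1 \<in> {1..p}" "f j1 = m" using Max_in[OF fin] by (auto simp: m_def)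
      define j where "j = (LEAST j. j \<in> {1..p} \<and> f j = m)"
      have j: "j \<in> {1..p} \<and> f j = m" unfolding j_def using j1 by (intro LeastI) auto
      have lt: "f k < m" if "k \<in> {1..p}" "k < j" for k
        using not_less_Least[of k "\<lambda>j. j \<in> {1..p} \<and> f j = m"] that fm[OF that(1)] by (auto simp: j_def less_le)
      have "first_max x j (G \<omega>)" unfolding first_max_def
        using lt fm j by (auto simp: f_def)
      moreover have "0 < f j"
      proof -
        have "0 < f j0" using j0 pos_var[OF j0(1)] by (simp add: f_def x_def diff_divide_distrib[symmetric])
        then show ?thesis using fm[OF j0(1)] j by simp
      qed
      moreover have "f j \<le> d"
      proof -
        have j': "j \<in> {1..p}" using j by simp
        have "f j \<le> \<delta> / sqrt (\<Sigma> j j)"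
          using le[OF j'] pos_var[OF j'] by (simp add: f_def x_def diff_divide_distrib[symmetric] divide_right_mono)
        also have "\<dots> \<le> d" unfolding d_def using K(1) K(2)[OF j'] \<delta> by (intro divide_left_mono) auto
        finally show ?thesis .
      qed
      ultimately show "\<omega> \<in> (\<Union>j\<in>{1..p}. A' j)" using j \<omega> by (auto simp: A'_def f_def)
    qed auto
    also have "\<dots> \<le> (\<Sum>j=1..p. prob (A' j))"
      using Am by (intro finite_measure_subadditive_finite) auto
    also have "\<dots> \<le> (\<Sum>j=1..p. exp 4 * (L + 1) * d * prob (A j) + d * std_normal_density L)"
      unfolding A_def A'_def by (intro sum_mono first_max_strip L d0 True)
    also have "\<dots> = exp 4 * (L + 1) * d * (\<Sum>j=1..p. prob (A j)) + p * (d * std_normal_density L)"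
      by (simp add: sum.distrib sum_distrib_left)
    also have "(\<Sum>j=1..p. prob (A j)) = prob (\<Union>j\<in>{1..p}. A j)"
    proof (rule finite_measure_finite_Union[symmetric])
      show "disjoint_family_on A {1..p}" unfolding disjoint_family_on_def
      proof (intro ballI impI)
        fix i k assume i: "i \<in> {1..p}" and k: "k \<in> {1..p}" and "i \<noteq> k"
        have False if a: "first_max x i g" and b: "first_max x k g" for g
        proof -
          consider "i < k" | "k < i" using \<open>i \<noteq> k\<close> by linarith
          then show False using a[unfolded first_max_def, rule_format, OF k] b[unfolded first_max_def, rule_format, OF i]
            by cases auto
        qed
        then show "A i \<inter> A k = {}" by (auto simp: A_def)
      qed
    qed (use Am in auto)
    also have "\<dots> \<le> 1" by (rule prob_le_1)
    also have "p * (d * std_normal_density L) \<le> d"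
    proof -
      have "std_normal_density L = std_normal_density 0 * exp (- L\<^sup>2 / 2)" by (simp add: std_normal_density_def)
      also have "exp (- L\<^sup>2 / 2) = 1 / p" using lnp p by (simp add: L_def exp_minus inverse_eq_divide)
      finally have "p * (d * std_normal_density L) = d * std_normal_density 0" using p by simp
      also have "\<dots> \<le> d * 1" using std_normal_density_0 d0 by (rule mult_left_mono)
      finally show ?thesis by simp
    qed
    finally have "D \<le> exp 4 * (L + 1) * d + d" using d0 L by (simp add: mult_left_mono)
    also have "\<dots> \<le> exp 4 * (5 / 2 * sqrt (ln p)) * d + exp 4 * (sqrt (ln p)) * d"
    proof -
      have "1 * 1 \<le> exp 4 * sqrt (ln p)" using sq e4 by (intro mult_mono) auto
      then have "d \<le> exp 4 * sqrt (ln p) * d" using mult_right_mono[OF _ d0] by fastforce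
      moreover have "exp 4 * (L + 1) * d \<le> exp 4 * (5 / 2 * sqrt (ln p)) * d"
        using L2 d0 by (intro mult_right_mono mult_left_mono) auto
      ultimately show ?thesis by linarith
    qed
    also have "\<dots> = 7 / 2 * (exp 4 * sqrt (ln p) * d)" by simp
    also have "\<dots> \<le> 4 * (exp 4 * sqrt (ln p) * d)" using d0 sq by (intro mult_right_mono) auto
    finally show ?thesis by (simp add: D_def d_def)
  qed
qed

end

section \<open>Consequences of a finite Orlicz norm\<close>

context prob_space
begin

text \<open>The infimum in the norm need not be attained, so \<open>2 * B\<close> provides room for
  an admissible \<open>l\<close>. Since \<open>\<gamma>\<close> is at least one, \<open>y\<close> is
  at most \<open>1 + y powr \<gamma>\<close>, which gives the bound \<open>exp 1 * 2\<close>, below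
  6.\<close>

lemma psi_norm_exp_moment:
  fixes \<xi> :: "'a \<Rightarrow> real"
  assumes m [measurable]: "\<xi> \<in> borel_measurable M" and g: "1 \<le> \<gamma>" and B: "0 < B"
    and psi: "psi_norm M \<gamma> \<xi> \<le> ennreal B"
  shows "integrable M (\<lambda>\<omega>. exp (\<bar>\<xi> \<omega>\<bar> / (2 * B)))"
    "(\<integral>\<omega>. exp (\<bar>\<xi> \<omega>\<bar> / (2 * B)) \<partial>M) \<le> 6"
proof -
  have "psi_norm M \<gamma> \<xi> < ennreal (2 * B)"
    by (rule le_less_trans[OF psi]) (use B in \<open>auto intro!: ennreal_lessI\<close>)
  then obtain l where l: "0 < l" "(\<integral>\<^sup>+\<omega>. ennreal (exp ((\<bar>\<xi> \<omega>\<bar> / l) powr \<gamma>) - 1) \<partial>M) \<le> 1"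
    and lB: "ennreal l < ennreal (2 * B)"
    unfolding psi_norm_def INF_less_iff by auto
  have lB: "l < 2 * B" using lB l by (simp add: ennreal_less_iff)
  have pw: "exp (\<bar>\<xi> \<omega>\<bar> / (2 * B)) \<le> exp 1 * (1 + (exp ((\<bar>\<xi> \<omega>\<bar> / l) powr \<gamma>) - 1))" for \<omega>
  proof -
    define y where "y = \<bar>\<xi> \<omega>\<bar> / l"
    have y: "0 \<le> y" using l by (simp add: y_def)
    have "\<bar>\<xi> \<omega>\<bar> / (2 * B) \<le> y" unfolding y_def using lB l by (intro divide_left_mono) auto
    also have "y \<le> 1 + y powr \<gamma>"
    proof (cases "y \<le> 1")
      case False
      then have "y powr 1 \<le> y powr \<gamma>" using g by (intro powr_mono) auto
      then show ?thesis using False by simp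
    qed (simp add: add_increasing2)
    finally show ?thesis unfolding y_def[symmetric] by (simp add: exp_add[symmetric])
  qed
  have "(\<integral>\<^sup>+\<omega>. ennreal (exp (\<bar>\<xi> \<omega>\<bar> / (2 * B))) \<partial>M)
      \<le> (\<integral>\<^sup>+\<omega>. ennreal (exp 1) * (1 + ennreal (exp ((\<bar>\<xi> \<omega>\<bar> / l) powr \<gamma>) - 1)) \<partial>M)"
  proof (rule nn_integral_mono)
    fix \<omega>
    have "ennreal (exp (\<bar>\<xi> \<omega>\<bar> / (2 * B))) \<le> ennreal (exp 1 * (1 + (exp ((\<bar>\<xi> \<omega>\<bar> / l) powr \<gamma>) - 1)))"
      by (rule ennreal_leI[OF pw])
    also have "\<dots> = ennreal (exp 1) * (ennreal 1 + ennreal (exp ((\<bar>\<xi> \<omega>\<bar> / l) powr \<gamma>) - 1))"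
      by (subst ennreal_plus[symmetric]) (simp_all add: ennreal_mult)
    finally show "ennreal (exp (\<bar>\<xi> \<omega>\<bar> / (2 * B))) \<le> ennreal (exp 1) * (1 + ennreal (exp ((\<bar>\<xi> \<omega>\<bar> / l) powr \<gamma>) - 1))"
      by simp
  qed
  also have "\<dots> = ennreal (exp 1) * (1 + (\<integral>\<^sup>+\<omega>. ennreal (exp ((\<bar>\<xi> \<omega>\<bar> / l) powr \<gamma>) - 1) \<partial>M))"
    by (simp add: nn_integral_cmult nn_integral_add emeasure_space_1)
  also have "\<dots> \<le> ennreal (exp 1) * (1 + 1)"
    using l(2) by (intro mult_left_mono add_left_mono) auto
  also have "\<dots> = ennreal (exp 1 * 2)" by (simp add: ennreal_mult)
  also have "\<dots> \<le> ennreal 6" using exp_le by (intro ennreal_leI) simp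
  finally have *: "(\<integral>\<^sup>+\<omega>. ennreal (exp (\<bar>\<xi> \<omega>\<bar> / (2 * B))) \<partial>M) \<le> ennreal 6" .
  show i: "integrable M (\<lambda>\<omega>. exp (\<bar>\<xi> \<omega>\<bar> / (2 * B)))"
    by (rule integrableI_bounded) (use * in \<open>auto simp: le_less_trans\<close>)
  show "(\<integral>\<omega>. exp (\<bar>\<xi> \<omega>\<bar> / (2 * B)) \<partial>M) \<le> 6"
    using * nn_integral_eq_integral[OF i] by (simp del: ennreal_numeral)
qed

lemma power_le_exp:
  fixes x :: real assumes "0 \<le> x" "0 < k" shows "x ^ k \<le> real k ^ k * exp x"
proof -
  have "(x / k) ^ k \<le> (1 + x / k) ^ k" using assms by (intro power_mono) auto
  also have "\<dots> \<le> exp x" using assms by (intro exp_ge_one_plus_x_over_n_power_n) auto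
  finally show ?thesis using assms by (simp add: power_divide field_simps)
qed

lemma psi_norm_moment:
  fixes \<xi> :: "'a \<Rightarrow> real"
  assumes m [measurable]: "\<xi> \<in> borel_measurable M" and g: "1 \<le> \<gamma>" and B: "0 < B"
    and psi: "psi_norm M \<gamma> \<xi> \<le> ennreal B" and k: "0 < k"
  shows "integrable M (\<lambda>\<omega>. \<bar>\<xi> \<omega>\<bar> ^ k)" "(\<integral>\<omega>. \<bar>\<xi> \<omega>\<bar> ^ k \<partial>M) \<le> 6 * (2 * real k) ^ k * B ^ k"
proof -
  note e = psi_norm_exp_moment[OF m g B psi]
  have pw: "\<bar>\<xi> \<omega>\<bar> ^ k \<le> ((2 * B) ^ k * real k ^ k) * exp (\<bar>\<xi> \<omega>\<bar> / (2 * B))" for \<omega>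
  proof -
    have "\<bar>\<xi> \<omega>\<bar> ^ k = (2 * B) ^ k * (\<bar>\<xi> \<omega>\<bar> / (2 * B)) ^ k" using B by (simp add: power_divide)
    also have "\<dots> \<le> (2 * B) ^ k * (real k ^ k * exp (\<bar>\<xi> \<omega>\<bar> / (2 * B)))"
      using B k by (intro mult_left_mono power_le_exp) auto
    finally show ?thesis by (simp add: mult.assoc)
  qed
  have i2: "integrable M (\<lambda>\<omega>. ((2 * B) ^ k * real k ^ k) * exp (\<bar>\<xi> \<omega>\<bar> / (2 * B)))"
    using e(1) by simp
  show i: "integrable M (\<lambda>\<omega>. \<bar>\<xi> \<omega>\<bar> ^ k)"
  proof (rule Bochner_Integration.integrable_bound[OF i2])
    have "norm (\<bar>\<xi> \<omega>\<bar> ^ k) \<le> norm (((2 * B) ^ k * real k ^ k) * exp (\<bar>\<xi> \<omega>\<bar> / (2 * B)))" for \<omega>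
      using order_trans[OF pw[of \<omega>] abs_ge_self] by (simp only: real_norm_def abs_of_nonneg zero_le_power abs_ge_zero)
    then show "AE \<omega> in M. norm (\<bar>\<xi> \<omega>\<bar> ^ k) \<le> norm (((2 * B) ^ k * real k ^ k) * exp (\<bar>\<xi> \<omega>\<bar> / (2 * B)))"
      by (rule AE_I2)
  qed measurable
  have "(\<integral>\<omega>. \<bar>\<xi> \<omega>\<bar> ^ k \<partial>M) \<le> (\<integral>\<omega>. ((2 * B) ^ k * real k ^ k) * exp (\<bar>\<xi> \<omega>\<bar> / (2 * B)) \<partial>M)"
    by (rule integral_mono[OF i i2 pw])
  also have "\<dots> \<le> ((2 * B) ^ k * real k ^ k) * 6" unfolding integral_mult_right_zero using e(2) B by (intro mult_left_mono) auto
  finally show "(\<integral>\<omega>. \<bar>\<xi> \<omega>\<bar> ^ k \<partial>M) \<le> 6 * (2 * real k) ^ k * B ^ k"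
    by (simp add: power_mult_distrib ac_simps)
qed

lemma psi_norm_tail:
  fixes \<xi> :: "'a \<Rightarrow> real"
  assumes m [measurable]: "\<xi> \<in> borel_measurable M" and g: "1 \<le> \<gamma>" and B: "0 < B"
    and psi: "psi_norm M \<gamma> \<xi> \<le> ennreal B"
  shows "prob {\<omega> \<in> space M. \<tau> < \<bar>\<xi> \<omega>\<bar>} \<le> 6 * exp (- \<tau> / (2 * B))"
proof -
  note e = psi_norm_exp_moment[OF m g B psi]
  have "prob {\<omega> \<in> space M. \<tau> < \<bar>\<xi> \<omega>\<bar>} \<le> prob {\<omega> \<in> space M. exp (\<tau> / (2 * B)) \<le> exp (\<bar>\<xi> \<omega>\<bar> / (2 * B))}"
    using B by (intro finite_measure_mono) (auto intro!: divide_right_mono)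
  also have "\<dots> \<le> (\<integral>\<omega>. exp (\<bar>\<xi> \<omega>\<bar> / (2 * B)) \<partial>M) / exp (\<tau> / (2 * B))"
    by (rule integral_Markov_inequality_measure[where A="{}", OF e(1)]) auto
  also have "\<dots> \<le> 6 / exp (\<tau> / (2 * B))" using e(2) by (intro divide_right_mono) auto
  finally show ?thesis by (simp add: exp_minus divide_inverse[symmetric])
qed

end

section \<open>Independence in a dependency graph\<close>

lemma measurable_imp_vimage_sets_subset:
  "f \<in> M \<rightarrow>\<^sub>M N \<Longrightarrow> sets (vimage_algebra (space M) f N) \<subseteq> sets M"
  by (simp add: measurable_iff_sets)

lemma sets_vimage_algebra_compose:
  assumes f: "f \<in> \<Omega> \<rightarrow> space N" and h: "h \<in> N \<rightarrow>\<^sub>M K"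
  shows "sets (vimage_algebra \<Omega> (\<lambda>\<omega>. h (f \<omega>)) K) \<subseteq> sets (vimage_algebra \<Omega> f N)"
proof -
  have "(\<lambda>\<omega>. h (f \<omega>)) \<in> vimage_algebra \<Omega> f N \<rightarrow>\<^sub>M K"
    using measurable_compose[OF measurable_vimage_algebra1[OF f] h] .
  then show ?thesis using measurable_imp_vimage_sets_subset[of _ "vimage_algebra \<Omega> f N" K] by simp
qed

context prob_space
begin

lemma indep_set_mono:
  "indep_set A B \<Longrightarrow> A' \<subseteq> A \<Longrightarrow> B' \<subseteq> B \<Longrightarrow> indep_set A' B'"
  unfolding indep_set_def by (erule indep_sets_mono_sets) (auto split: bool.split)

lemma indep_var_vimage_eq:
  "indep_var S X T Y \<longleftrightarrow> random_variable S X \<and> random_variable T Y \<and>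
    indep_set (sets (vimage_algebra (space M) X S)) (sets (vimage_algebra (space M) Y T))"
  unfolding indep_var_eq sets_vimage_algebra by auto

text \<open>The intersections of an event of \<open>B\<close> with an event of \<open>C\<close> form
  an intersection-stable generator of the joint sigma-algebra. The triple product rule makes this
  generator independent of \<open>A\<close>; with the whole space for \<open>a\<close> it also
  yields the product rule for \<open>b\<close> and \<open>c\<close>.\<close>

lemma indep_set_triple:
  assumes ABC: "\<And>a b c. a \<in> A \<Longrightarrow> b \<in> sets B \<Longrightarrow> c \<in> sets C \<Longrightarrow> prob (a \<inter> b \<inter> c) = prob a * prob b * prob c"
    and A: "Int_stable A" "A \<subseteq> events" "space M \<in> A"
    and sub: "sets B \<subseteq> events" "sets C \<subseteq> events" and sp: "space B = space M" "space C = space M"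
  shows "indep_set (sigma_sets (space M) A) (sigma_sets (space M) {b \<inter> c | b c. b \<in> sets B \<and> c \<in> sets C})"
proof (rule indep_set_sigma_sets)
  have top: "space M \<in> sets B" "space M \<in> sets C" using sets.top[of B] sets.top[of C] sp by auto
  have bc: "prob (b \<inter> c) = prob b * prob c" if "b \<in> sets B" "c \<in> sets C" for b c
    using ABC[OF A(3) that] sets.sets_into_space[OF that(1)] sp prob_space by (simp add: Int_absorb1)
  show "indep_set A {b \<inter> c | b c. b \<in> sets B \<and> c \<in> sets C}"
  proof (rule indep_setI)
    show "{b \<inter> c | b c. b \<in> sets B \<and> c \<in> sets C} \<subseteq> events" using sub by auto
    fix a d assume "a \<in> A" "d \<in> {b \<inter> c | b c. b \<in> sets B \<and> c \<in> sets C}"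
    then show "prob (a \<inter> d) = prob a * prob d"
      using ABC bc by (auto simp: Int_assoc[symmetric])
  qed (rule A(2))
  show "Int_stable {b \<inter> c | b c. b \<in> sets B \<and> c \<in> sets C}"
  proof (rule Int_stableI, clarify)
    fix b c b' c' assume "b \<in> sets B" "c \<in> sets C" "b' \<in> sets B" "c' \<in> sets C"
    then have "b \<inter> b' \<in> sets B" "c \<inter> c' \<in> sets C" "b \<inter> c \<inter> (b' \<inter> c') = (b \<inter> b') \<inter> (c \<inter> c')" by auto
    then show "\<exists>b'' c''. b \<inter> c \<inter> (b' \<inter> c') = b'' \<inter> c'' \<and> b'' \<in> sets B \<and> c'' \<in> sets C" by blast
  qed
qed (rule A(1))

end

locale dependent_sample = prob_space M for M :: "'a measure" +
  fixes n p :: nat and X :: "nat \<Rightarrow> 'a \<Rightarrow> nat \<Rightarrow> real" and G :: "'a \<Rightarrow> nat \<Rightarrow> real"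
    and E :: "(nat \<times> nat) set"
  assumes measurable_X: "\<And>t. t \<in> {1..n} \<Longrightarrow> X t \<in> M \<rightarrow>\<^sub>M rvec p"
    and measurable_G [measurable]: "G \<in> M \<rightarrow>\<^sub>M rvec p"
    and graph: "dependency_graph M n p X E"
    and indep_G: "indep_of_sample M n p X G"
begin

lemma measurable_sample: "A \<subseteq> {1..n} \<Longrightarrow> sample A X \<in> M \<rightarrow>\<^sub>M (\<Pi>\<^sub>M t\<in>A. rvec p)"
  unfolding sample_def using measurable_X by (intro measurable_restrict) auto

lemma measurable_X_coord: "t \<in> {1..n} \<Longrightarrow> j \<in> {1..p} \<Longrightarrow> (\<lambda>\<omega>. X t \<omega> j) \<in> borel_measurable M"
  using measurable_compose[OF measurable_X measurable_component_singleton] by simp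

lemma measurable_G_coord: "j \<in> {1..p} \<Longrightarrow> (\<lambda>\<omega>. G \<omega> j) \<in> borel_measurable M"
  using measurable_compose[OF measurable_G measurable_component_singleton] by simp

lemma sample_sets_subset:
  assumes "A \<subseteq> {1..n}"
  shows "sets (vimage_algebra (space M) (sample A X) (\<Pi>\<^sub>M t\<in>A. rvec p))
    \<subseteq> sets (vimage_algebra (space M) (sample {1..n} X) (\<Pi>\<^sub>M t\<in>{1..n}. rvec p))"
proof -
  have "sample A X = (\<lambda>\<omega>. restrict (sample {1..n} X \<omega>) A)"
    using assms by (auto simp: sample_def fun_eq_iff restrict_def)
  moreover have "sample {1..n} X \<in> space M \<rightarrow> space (\<Pi>\<^sub>M t\<in>{1..n}. rvec p)"
    using measurable_sample[of "{1..n}"] by (auto dest: measurable_space)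
  ultimately show ?thesis
    using sets_vimage_algebra_compose[OF _ measurable_restrict_subset[OF assms], of "sample {1..n} X" "space M" "\<lambda>_. rvec p"] by simp
qed

text \<open>Joint independence from a separated block and from \<open>G\<close> at once. An event of
  the two blocks belongs to the sigma-algebra of the sample, so \<open>G\<close> splits off, and the
  graph then splits the two blocks.\<close>

lemma indep_separated:
  assumes AB: "A \<subseteq> {1..n}" "B \<subseteq> {1..n}" "(A \<times> B) \<inter> E = {}"
    and f: "f \<in> borel_measurable (\<Pi>\<^sub>M t\<in>A. rvec p)"
    and g: "g \<in> borel_measurable ((\<Pi>\<^sub>M t\<in>B. rvec p) \<Otimes>\<^sub>M rvec p)"
  shows "indep_var borel (\<lambda>\<omega>. f (sample A X \<omega>) :: real) borel (\<lambda>\<omega>. g (sample B X \<omega>, G \<omega>) :: real)"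
proof -
  let ?V = "\<lambda>A. vimage_algebra (space M) (sample A X) (\<Pi>\<^sub>M t\<in>A. rvec p)"
  let ?W = "vimage_algebra (space M) G (rvec p)"
  let ?P = "\<lambda>\<omega>. (sample B X \<omega>, G \<omega>)"
  let ?B = "(\<Pi>\<^sub>M t\<in>B. rvec p) \<Otimes>\<^sub>M rvec p"
  have mA: "sample A X \<in> M \<rightarrow>\<^sub>M (\<Pi>\<^sub>M t\<in>A. rvec p)" and mB: "sample B X \<in> M \<rightarrow>\<^sub>M (\<Pi>\<^sub>M t\<in>B. rvec p)"
    by (rule measurable_sample[OF AB(1)] measurable_sample[OF AB(2)])+
  have evV: "sets (?V A) \<subseteq> events" "sets (?V B) \<subseteq> events" "sets ?W \<subseteq> events"
    by (rule measurable_imp_vimage_sets_subset[OF mA] measurable_imp_vimage_sets_subset[OF mB] measurable_imp_vimage_sets_subset[OF measurable_G])+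
  have ab: "prob (a \<inter> b) = prob a * prob b" if "a \<in> sets (?V A)" "b \<in> sets (?V B)" for a b
  proof -
    have "indep_var (\<Pi>\<^sub>M t\<in>A. rvec p) (sample A X) (\<Pi>\<^sub>M t\<in>B. rvec p) (sample B X)"
      using graph AB unfolding dependency_graph_def by blast
    then have "indep_set (sets (?V A)) (sets (?V B))" unfolding indep_var_vimage_eq by (elim conjE)
    then show ?thesis using that by (rule indep_setD)
  qed
  have abc: "prob (a \<inter> b \<inter> c) = prob a * prob b * prob c"
    if "a \<in> sets (?V A)" "b \<in> sets (?V B)" "c \<in> sets ?W" for a b c
  proof -
    have "a \<inter> b \<in> sets (?V {1..n})"
      using subsetD[OF sample_sets_subset[OF AB(1)] that(1)] subsetD[OF sample_sets_subset[OF AB(2)] that(2)] by (rule sets.Int)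
    then have "prob (a \<inter> b \<inter> c) = prob (a \<inter> b) * prob c"
      using indep_setD[OF indep_G[unfolded indep_of_sample_def] _ that(3)] by blast
    then show ?thesis using ab that by simp
  qed
  have I: "indep_set (sigma_sets (space M) (sets (?V A))) (sigma_sets (space M) {b \<inter> c | b c. b \<in> sets (?V B) \<and> c \<in> sets ?W})"
    by (rule indep_set_triple[OF abc]) (use evV sets.Int_stable sets.top[of "?V A"] in simp_all)
  have 1: "sets (vimage_algebra (space M) (\<lambda>\<omega>. f (sample A X \<omega>)) borel) \<subseteq> sigma_sets (space M) (sets (?V A))"
    by (rule order_trans[OF sets_vimage_algebra_compose[OF _ f] sigma_sets_superset_generator])
       (rule Pi_I, rule measurable_space[OF mA])
  \<comment> \<open>The joint sigma-algebra of the block \<open>B\<close> and \<open>G\<close>. Both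
    maps are measurable for it, hence so is every function of the pair.\<close>
  define S where "S = sigma (space M) {b \<inter> c | b c. b \<in> sets (?V B) \<and> c \<in> sets ?W}"
  have sub: "{b \<inter> c | b c. b \<in> sets (?V B) \<and> c \<in> sets ?W} \<subseteq> Pow (space M)"
  proof clarify
    fix x b c assume "b \<in> sets (?V B)" "x \<in> b"
    then show "x \<in> space M" using evV(2) sets.sets_into_space[of b M] by blast
  qed
  have setsS: "sets S = sigma_sets (space M) {b \<inter> c | b c. b \<in> sets (?V B) \<and> c \<in> sets ?W}"
    and spS: "space S = space M" unfolding S_def using sub by (auto simp: sets_measure_of)
  have b: "b \<in> sets S" if "b \<in> sets (?V B)" for b
  proof -
    have "b \<inter> space M \<in> {b \<inter> c | b c. b \<in> sets (?V B) \<and> c \<in> sets ?W}" using that sets.top[of ?W] by auto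
    moreover have "b \<inter> space M = b" using that evV sets.sets_into_space by blast
    ultimately have "b \<in> {b \<inter> c | b c. b \<in> sets (?V B) \<and> c \<in> sets ?W}" by (simp only:)
    then show ?thesis unfolding setsS by (rule sigma_sets.Basic)
  qed
  have c: "c \<in> sets S" if "c \<in> sets ?W" for c
  proof -
    have "space M \<inter> c \<in> {b \<inter> c | b c. b \<in> sets (?V B) \<and> c \<in> sets ?W}" using that sets.top[of "?V B"] by auto
    moreover have "space M \<inter> c = c" using that evV sets.sets_into_space by blast
    ultimately have "c \<in> {b \<inter> c | b c. b \<in> sets (?V B) \<and> c \<in> sets ?W}" by (simp only:)
    then show ?thesis unfolding setsS by (rule sigma_sets.Basic)
  qed
  have "sample B X \<in> S \<rightarrow>\<^sub>M (\<Pi>\<^sub>M t\<in>B. rvec p)" "G \<in> S \<rightarrow>\<^sub>M rvec p"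
    unfolding measurable_iff_sets spS
    using b c measurable_space[OF mB] measurable_space[OF measurable_G] by (simp_all add: subset_iff Pi_iff)
  then have "(\<lambda>\<omega>. g (?P \<omega>)) \<in> S \<rightarrow>\<^sub>M borel"
    using g by measurable
  then have 2: "sets (vimage_algebra (space M) (\<lambda>\<omega>. g (?P \<omega>)) borel) \<subseteq> sigma_sets (space M) {b \<inter> c | b c. b \<in> sets (?V B) \<and> c \<in> sets ?W}"
    unfolding measurable_iff_sets setsS spS by simp
  show ?thesis unfolding indep_var_vimage_eq
    using indep_set_mono[OF I 1 2] measurable_compose[OF mA f] measurable_compose[OF measurable_Pair[OF mB measurable_G] g]
    by (intro conjI)
qed

lemma indep_sample_G:
  assumes h: "h \<in> (\<Pi>\<^sub>M t\<in>{1..n}. rvec p) \<rightarrow>\<^sub>M rvec p"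
  shows "indep_var (rvec p) (\<lambda>\<omega>. h (sample {1..n} X \<omega>)) (rvec p) G"
proof -
  have m: "sample {1..n} X \<in> M \<rightarrow>\<^sub>M (\<Pi>\<^sub>M t\<in>{1..n}. rvec p)" by (rule measurable_sample) simp
  have "sets (vimage_algebra (space M) (\<lambda>\<omega>. h (sample {1..n} X \<omega>)) (rvec p))
    \<subseteq> sets (vimage_algebra (space M) (sample {1..n} X) (\<Pi>\<^sub>M t\<in>{1..n}. rvec p))"
    by (intro sets_vimage_algebra_compose[OF _ h] Pi_I measurable_space[OF m])
  then show ?thesis unfolding indep_var_vimage_eq
    using indep_set_mono[OF indep_G[unfolded indep_of_sample_def] _ order_refl] measurable_compose[OF m h] measurable_G
    by (intro conjI)
qed

end

section \<open>Interpolation between the sum and the normal vector\<close>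

text \<open>The mean value inequality turns the uniform bound on the derivative into a bound on all
  difference quotients, and dominated convergence applies along any sequence of increments.\<close>

lemma (in prob_space) has_real_derivative_expectation:
  fixes f f' :: "real \<Rightarrow> 'a \<Rightarrow> real"
  assumes der: "\<And>t \<omega>. \<omega> \<in> space M \<Longrightarrow> ((\<lambda>t. f t \<omega>) has_real_derivative f' t \<omega>) (at t)"
    and int: "\<And>t. integrable M (f t)" and meas: "\<And>t. f' t \<in> borel_measurable M"
    and dom: "\<And>t \<omega>. \<omega> \<in> space M \<Longrightarrow> \<bar>f' t \<omega>\<bar> \<le> w \<omega>" and w: "integrable M w"
  shows "((\<lambda>t. \<integral>\<omega>. f t \<omega> \<partial>M) has_real_derivative (\<integral>\<omega>. f' t \<omega> \<partial>M)) (at t)"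
  unfolding DERIV_def tendsto_at_iff_sequentially o_def
proof (intro allI impI)
  fix h :: "nat \<Rightarrow> real" assume h0: "\<forall>i. h i \<in> UNIV - {0}" and h: "h \<longlonglongrightarrow> 0"
  have hn: "h i \<noteq> 0" for i using h0 by auto
  have "(\<lambda>i. \<integral>\<omega>. (f (t + h i) \<omega> - f t \<omega>) / h i \<partial>M) \<longlonglongrightarrow> (\<integral>\<omega>. f' t \<omega> \<partial>M)"
  proof (rule integral_dominated_convergence[where w=w])
    show "AE \<omega> in M. (\<lambda>i. (f (t + h i) \<omega> - f t \<omega>) / h i) \<longlonglongrightarrow> f' t \<omega>"
    proof (rule AE_I2)
      fix \<omega> assume "\<omega> \<in> space M"
      from der[OF this, of t] show "(\<lambda>i. (f (t + h i) \<omega> - f t \<omega>) / h i) \<longlonglongrightarrow> f' t \<omega>"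
        unfolding DERIV_def tendsto_at_iff_sequentially o_def using h0 h by auto
    qed
    show "AE \<omega> in M. norm ((f (t + h i) \<omega> - f t \<omega>) / h i) \<le> w \<omega>" for i
    proof (rule AE_I2)
      fix \<omega> assume \<omega>: "\<omega> \<in> space M"
      have "norm (f (t + h i) \<omega> - f t \<omega>) \<le> w \<omega> * norm (t + h i - t)"
        using dom[OF \<omega>] der[OF \<omega>] by (intro field_differentiable_bound[where S=UNIV and f'="\<lambda>t. f' t \<omega>"]) (auto intro: has_field_derivative_at_within)
      then show "norm ((f (t + h i) \<omega> - f t \<omega>) / h i) \<le> w \<omega>"
        using hn[of i] by (simp add: field_simps)
    qed
    show "(\<lambda>\<omega>. (f (t + h i) \<omega> - f t \<omega>) / h i) \<in> borel_measurable M" for i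
      using int by (intro borel_measurable_divide borel_measurable_diff) auto
  qed (use meas w in auto)
  then show "(\<lambda>i. ((\<integral>\<omega>. f (t + h i) \<omega> \<partial>M) - (\<integral>\<omega>. f t \<omega> \<partial>M)) / h i) \<longlonglongrightarrow> (\<integral>\<omega>. f' t \<omega> \<partial>M)"
    using int by simp
qed

text \<open>Fubini for independent variables. It freezes the sum while Gaussian integration by parts
  is carried out in the other argument.\<close>

lemma (in prob_space) expectation_indep_var:
  fixes \<Psi> :: "'b \<times> 'b \<Rightarrow> real"
  assumes ind: "indep_var S U T V" and \<Psi> [measurable]: "\<Psi> \<in> borel_measurable (S \<Otimes>\<^sub>M T)"
    and int: "integrable M (\<lambda>\<omega>. \<Psi> (U \<omega>, V \<omega>))"
  shows "(\<integral>\<omega>. \<Psi> (U \<omega>, V \<omega>) \<partial>M) = (\<integral>\<omega>. (\<integral>\<omega>'. \<Psi> (U \<omega>, V \<omega>') \<partial>M) \<partial>M)"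
proof -
  have [measurable]: "U \<in> M \<rightarrow>\<^sub>M S" "V \<in> M \<rightarrow>\<^sub>M T" and
    eq: "distr M S U \<Otimes>\<^sub>M distr M T V = distr M (S \<Otimes>\<^sub>M T) (\<lambda>\<omega>. (U \<omega>, V \<omega>))"
    using ind unfolding indep_var_distribution_eq by auto
  interpret U: prob_space "distr M S U" by (rule prob_space_distr) measurable
  interpret V: prob_space "distr M T V" by (rule prob_space_distr) measurable
  interpret P: pair_prob_space "distr M S U" "distr M T V" ..
  have i: "integrable (distr M S U \<Otimes>\<^sub>M distr M T V) \<Psi>"
    unfolding eq using int by (subst integrable_distr_eq) measurable
  have "(\<integral>\<omega>. \<Psi> (U \<omega>, V \<omega>) \<partial>M) = (\<integral>x. \<Psi> x \<partial>(distr M S U \<Otimes>\<^sub>M distr M T V))"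
    unfolding eq by (subst integral_distr) measurable
  also have "\<dots> = (\<integral>x. (\<integral>y. \<Psi> (x, y) \<partial>distr M T V) \<partial>distr M S U)"
    by (rule P.integral_fst'[OF i, symmetric])
  also have "\<dots> = (\<integral>\<omega>. (\<integral>y. \<Psi> (U \<omega>, y) \<partial>distr M T V) \<partial>M)"
    by (subst integral_distr) measurable
  also have "\<dots> = (\<integral>\<omega>. (\<integral>\<omega>'. \<Psi> (U \<omega>, V \<omega>') \<partial>M) \<partial>M)"
  proof (intro Bochner_Integration.integral_cong refl)
    fix \<omega> assume "\<omega> \<in> space M"
    then have "U \<omega> \<in> space S" by (rule measurable_space[rotated]) measurable
    then show "(\<integral>y. \<Psi> (U \<omega>, y) \<partial>distr M T V) = (\<integral>\<omega>'. \<Psi> (U \<omega>, V \<omega>') \<partial>M)"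
      by (intro integral_distr) measurable
  qed
  finally show ?thesis .
qed

text \<open>The factor \<open>b\<close> scales the summands, \<open>v\<close> moves the corner of the orthant to the origin, and \<open>T\<close> is
  the truncation event.\<close>

locale interpolation = dependent_sample M n p X G E + normal: centered_normal M p \<Sigma> G
  for M :: "'a measure" and n p X G E \<Sigma> +
  fixes b a :: real and v :: "nat \<Rightarrow> real" and T :: "'a set" and \<delta> \<rho> \<zeta> :: real and D Ds :: nat
  assumes p1: "1 \<le> p" and b0: "0 \<le> b" and a0: "0 < a" "a \<le> 1"
    and mean: "\<And>t j. t \<in> {1..n} \<Longrightarrow> j \<in> {1..p} \<Longrightarrow> (\<integral>\<omega>. X t \<omega> j \<partial>M) = 0"
    and int3: "\<And>t j. t \<in> {1..n} \<Longrightarrow> j \<in> {1..p} \<Longrightarrow> integrable M (\<lambda>\<omega>. \<bar>X t \<omega> j\<bar> ^ 3)"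
    and cov: "\<And>j k. j \<in> {1..p} \<Longrightarrow> k \<in> {1..p} \<Longrightarrow>
      real n * \<Sigma> j k = (\<Sum>t=1..n. \<Sum>r\<in>nbhd n E t. \<integral>\<omega>. X t \<omega> j * X r \<omega> k \<partial>M)"
    and T: "T \<in> events" "\<And>\<omega> t j. \<omega> \<in> T \<Longrightarrow> t \<in> {1..n} \<Longrightarrow> j \<in> {1..p} \<Longrightarrow> \<bar>b * X t \<omega> j\<bar> \<le> \<delta>"
    and \<delta>: "0 \<le> \<delta>" "2 * real D * \<delta> \<le> 1"
    and deg: "\<And>t. t \<in> {1..n} \<Longrightarrow> card (nbhd n E t) \<le> D"
      "\<And>t r. t \<in> {1..n} \<Longrightarrow> r \<in> nbhd n E t \<Longrightarrow> card (nbhd n E t \<union> nbhd n E r) \<le> Ds"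
    and \<rho>: "\<And>t j. t \<in> {1..n} \<Longrightarrow> j \<in> {1..p} \<Longrightarrow> (\<integral>\<omega>. \<bar>b * X t \<omega> j\<bar> ^ 3 \<partial>M) \<le> \<rho>" "0 \<le> \<rho>"
    and \<zeta>: "\<And>t. t \<in> {1..n} \<Longrightarrow> (\<Sum>j=1..p. \<integral>\<omega>. indicator (space M - T) \<omega> * \<bar>b * X t \<omega> j\<bar> ^ 3 \<partial>M) \<le> \<zeta>"
begin

section \<open>The interpolating path and factorisation over separated indices\<close>

abbreviation N where "N \<equiv> nbhd n E"
definition y where "y t \<omega> j = b * X t \<omega> j"
definition c where "c = b * sqrt (real n)"
text \<open>The angle 0 is the Gaussian end, \<open>pi / 2\<close> the end of the sum. The set
  \<open>C\<close> lists indices removed from the sum, while the Gaussian part stays. The factor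
  \<open>c\<close> gives \<open>G\<close> the scale of the unnormalised sum of the
  \<open>y t\<close>.\<close>

definition Z where "Z \<theta> C \<omega> j = sin \<theta> * (\<Sum>t\<in>{1..n} - C. y t \<omega> j) + cos \<theta> * (c * G \<omega> j) - v j"

lemma N_sub: "N t \<subseteq> {1..n}" and finite_N: "finite (N t)"
  by (auto simp: nbhd_def)

lemma my [measurable]: "t \<in> {1..n} \<Longrightarrow> j \<in> {1..p} \<Longrightarrow> (\<lambda>\<omega>. y t \<omega> j) \<in> borel_measurable M"
  unfolding y_def using measurable_X_coord by measurable

lemma mZ: "j \<in> {1..p} \<Longrightarrow> (\<lambda>\<omega>. Z \<theta> C \<omega> j) \<in> borel_measurable M"
  unfolding Z_def using measurable_G_coord[of j]
  by (intro borel_measurable_diff borel_measurable_add borel_measurable_times borel_measurable_sum borel_measurable_const my) auto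

lemmas msm [measurable] = measurable_sm[of p "Z \<theta> C" M, OF mZ] for \<theta> C

lemma int_y3: "t \<in> {1..n} \<Longrightarrow> j \<in> {1..p} \<Longrightarrow> integrable M (\<lambda>\<omega>. \<bar>y t \<omega> j\<bar> ^ 3)"
  using int3 by (simp add: y_def abs_mult power_mult_distrib)

lemma int_yy:
  assumes "t \<in> {1..n}" "j \<in> {1..p}" "r \<in> {1..n}" "k \<in> {1..p}"
  shows "integrable M (\<lambda>\<omega>. y t \<omega> j * y r \<omega> k)"
proof (rule Bochner_Integration.integrable_bound)
  show "integrable M (\<lambda>\<omega>. \<bar>y t \<omega> j\<bar> ^ 3 + \<bar>y r \<omega> k\<bar> ^ 3 + 1 ^ 3)"
    using int_y3 assms by simp
  show "AE \<omega> in M. norm (y t \<omega> j * y r \<omega> k) \<le> norm (\<bar>y t \<omega> j\<bar> ^ 3 + \<bar>y r \<omega> k\<bar> ^ 3 + 1 ^ 3)"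
  proof (rule AE_I2)
    fix \<omega>
    have "\<bar>y t \<omega> j\<bar> * \<bar>y r \<omega> k\<bar> * 1 \<le> \<bar>y t \<omega> j\<bar> ^ 3 + \<bar>y r \<omega> k\<bar> ^ 3 + 1 ^ 3"
      by (intro prod3_le_cubes) auto
    then show "norm (y t \<omega> j * y r \<omega> k) \<le> norm (\<bar>y t \<omega> j\<bar> ^ 3 + \<bar>y r \<omega> k\<bar> ^ 3 + 1 ^ 3)"
      by (simp add: abs_mult)
  qed
qed (use my assms in measurable)

lemma int_y:
  assumes "t \<in> {1..n}" "j \<in> {1..p}"
  shows "integrable M (\<lambda>\<omega>. y t \<omega> j)"
proof (rule Bochner_Integration.integrable_bound)
  show "integrable M (\<lambda>\<omega>. \<bar>y t \<omega> j\<bar> ^ 3 + 1)"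
    using int_y3 assms by simp
  show "AE \<omega> in M. norm (y t \<omega> j) \<le> norm (\<bar>y t \<omega> j\<bar> ^ 3 + 1)"
  proof (rule AE_I2)
    fix \<omega>
    have "\<bar>y t \<omega> j\<bar> \<le> \<bar>y t \<omega> j\<bar> ^ 3 + 1"
      by (cases "\<bar>y t \<omega> j\<bar> \<le> 1") (simp add: add_increasing, use self_le_power[of "\<bar>y t \<omega> j\<bar>" 3] in linarith)
    then show "norm (y t \<omega> j) \<le> norm (\<bar>y t \<omega> j\<bar> ^ 3 + 1)" by simp
  qed
qed (use my assms in measurable)

lemma mean_y: "t \<in> {1..n} \<Longrightarrow> j \<in> {1..p} \<Longrightarrow> (\<integral>\<omega>. y t \<omega> j \<partial>M) = 0"
  using mean by (simp add: y_def)

lemma integrable_times_bounded: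
  assumes "integrable M f" and [measurable]: "g \<in> borel_measurable M" and b: "\<And>\<omega>. \<bar>g \<omega>\<bar> \<le> (K::real)"
  shows "integrable M (\<lambda>\<omega>. f \<omega> * g \<omega>)"
proof (rule Bochner_Integration.integrable_bound)
  show "integrable M (\<lambda>\<omega>. K * \<bar>f \<omega>\<bar>)" using assms(1) by simp
  have "0 \<le> K" using order_trans[OF abs_ge_zero b] .
  then have "norm (f \<omega> * g \<omega>) \<le> norm (K * \<bar>f \<omega>\<bar>)" for \<omega>
    using mult_left_mono[OF b abs_ge_zero, of "f \<omega>" \<omega>] by (simp add: abs_mult mult.commute)
  then show "AE \<omega> in M. norm (f \<omega> * g \<omega>) \<le> norm (K * \<bar>f \<omega>\<bar>)" by simp
qed (use assms(1) in measurable)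

text \<open>Once \<open>C\<close> contains all neighbours of \<open>A\<close>, the point
  \<open>Z \<theta> C\<close> is a function of a separated block and of \<open>G\<close>. Values of
  \<open>Z\<close> are not restricted to the coordinates up to \<open>p\<close> and hence need not
  lie in the space of \<open>rvec p\<close>; this is why measurability of \<open>\<Phi>\<close> is
  expressed through measurability of coordinates.\<close>

lemma expectation_separated:
  fixes f :: "(nat \<Rightarrow> nat \<Rightarrow> real) \<Rightarrow> real" and \<Phi> :: "(nat \<Rightarrow> real) \<Rightarrow> real"
  assumes A: "A \<subseteq> {1..n}" "\<And>t. t \<in> A \<Longrightarrow> N t \<subseteq> C"
    and f: "f \<in> borel_measurable (\<Pi>\<^sub>M t\<in>A. rvec p)" and fi: "integrable M (\<lambda>\<omega>. f (sample A X \<omega>))"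
    and \<Phi>: "\<And>w. (\<And>j. j \<in> {1..p} \<Longrightarrow> (\<lambda>x. w x j) \<in> borel_measurable ((\<Pi>\<^sub>M t\<in>{1..n} - C. rvec p) \<Otimes>\<^sub>M rvec p)) \<Longrightarrow>
      (\<lambda>x. \<Phi> (w x)) \<in> borel_measurable ((\<Pi>\<^sub>M t\<in>{1..n} - C. rvec p) \<Otimes>\<^sub>M rvec p)"
    and b: "\<And>w. \<bar>\<Phi> w\<bar> \<le> K"
  shows "(\<integral>\<omega>. f (sample A X \<omega>) * \<Phi> (Z \<theta> C \<omega>) \<partial>M) = (\<integral>\<omega>. f (sample A X \<omega>) \<partial>M) * (\<integral>\<omega>. \<Phi> (Z \<theta> C \<omega>) \<partial>M)"
proof -
  define w where "w x j = sin \<theta> * (\<Sum>t\<in>{1..n} - C. b * fst x t j) + cos \<theta> * (c * snd x j) - v j"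
    for x :: "(nat \<Rightarrow> nat \<Rightarrow> real) \<times> (nat \<Rightarrow> real)" and j
  have mw: "(\<lambda>x. w x j) \<in> borel_measurable ((\<Pi>\<^sub>M t\<in>{1..n} - C. rvec p) \<Otimes>\<^sub>M rvec p)" if j: "j \<in> {1..p}" for j
  proof -
    have 1: "(\<lambda>x. fst x t j) \<in> borel_measurable ((\<Pi>\<^sub>M t\<in>{1..n} - C. rvec p) \<Otimes>\<^sub>M rvec p)" if "t \<in> {1..n} - C" for t
      using measurable_compose[OF measurable_compose[OF measurable_fst measurable_component_singleton[OF that]]
          measurable_component_singleton[OF j]] .
    have 2: "(\<lambda>x. snd x j) \<in> borel_measurable ((\<Pi>\<^sub>M t\<in>{1..n} - C. rvec p) \<Otimes>\<^sub>M rvec p)"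
      using measurable_compose[OF measurable_snd measurable_component_singleton[OF j]] .
    show ?thesis unfolding w_def
      by (intro borel_measurable_diff borel_measurable_add borel_measurable_times borel_measurable_sum borel_measurable_const 1 2)
  qed
  have wZ: "w (sample ({1..n} - C) X \<omega>, G \<omega>) = Z \<theta> C \<omega>" for \<omega>
    by (auto simp: w_def Z_def y_def sample_def fun_eq_iff)
  have "b \<in> C" if "a \<in> A" "b \<in> {1..n}" "(a, b) \<in> E" for a b
  proof -
    have "b \<in> N a" using that by (simp add: nbhd_def)
    then show ?thesis using A(2)[OF that(1)] by blast
  qed
  then have "A \<times> ({1..n} - C) \<inter> E = {}" by blast
  then have ind: "indep_var borel (\<lambda>\<omega>. f (sample A X \<omega>)) borel (\<lambda>\<omega>. \<Phi> (w (sample ({1..n} - C) X \<omega>, G \<omega>)))"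
    using A(1) by (intro indep_separated f \<Phi> mw) auto
  have m\<Phi>: "(\<lambda>\<omega>. \<Phi> (Z \<theta> C \<omega>)) \<in> borel_measurable M"
    using ind unfolding wZ by (auto dest: indep_var_rv2)
  have "integrable M (\<lambda>\<omega>. \<Phi> (Z \<theta> C \<omega>))"
    by (rule integrable_const_bound[where B=K]) (use b m\<Phi> in auto)
  then show ?thesis using indep_var_lebesgue_integral[OF ind fi] unfolding wZ by simp
qed

lemma expectation_separated1:
  assumes t: "t \<in> {1..n}" and j: "j \<in> {1..p}" and C: "N t \<subseteq> C"
    and h: "(h :: real \<Rightarrow> real) \<in> borel_measurable borel" "integrable M (\<lambda>\<omega>. h (y t \<omega> j))"
    and \<Phi>: "\<And>w. (\<And>j. j \<in> {1..p} \<Longrightarrow> (\<lambda>x. w x j) \<in> borel_measurable ((\<Pi>\<^sub>M t\<in>{1..n} - C. rvec p) \<Otimes>\<^sub>M rvec p)) \<Longrightarrow>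
      (\<lambda>x. \<Phi> (w x)) \<in> borel_measurable ((\<Pi>\<^sub>M t\<in>{1..n} - C. rvec p) \<Otimes>\<^sub>M rvec p)"
    and b: "\<And>w. \<bar>\<Phi> w\<bar> \<le> K"
  shows "(\<integral>\<omega>. h (y t \<omega> j) * \<Phi> (Z \<theta> C \<omega>) \<partial>M) = (\<integral>\<omega>. h (y t \<omega> j) \<partial>M) * (\<integral>\<omega>. \<Phi> (Z \<theta> C \<omega>) \<partial>M)"
proof -
  have s: "sample {t} X \<omega> t = X t \<omega>" for \<omega> by (simp add: sample_def)
  have m: "(\<lambda>f. f t j) \<in> borel_measurable (\<Pi>\<^sub>M t\<in>{t}. rvec p)"
    using measurable_compose[OF measurable_component_singleton[of t "{t}"] measurable_component_singleton[OF j]] by simp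
  have hm: "(\<lambda>f. h (b * f t j)) \<in> borel_measurable (\<Pi>\<^sub>M t\<in>{t}. rvec p)"
    by (rule measurable_compose[OF borel_measurable_times[OF borel_measurable_const m] h(1)])
  have "(\<integral>\<omega>. h (b * sample {t} X \<omega> t j) * \<Phi> (Z \<theta> C \<omega>) \<partial>M)
    = (\<integral>\<omega>. h (b * sample {t} X \<omega> t j) \<partial>M) * (\<integral>\<omega>. \<Phi> (Z \<theta> C \<omega>) \<partial>M)"
  proof (rule expectation_separated[of "{t}" C "\<lambda>f. h (b * f t j)" \<Phi> K \<theta>, OF _ _ hm _ \<Phi> b])
    show "integrable M (\<lambda>\<omega>. h (b * sample {t} X \<omega> t j))"
      using h(2) unfolding s y_def .
  qed (use t C in auto)
  then show ?thesis unfolding s y_def .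
qed

lemma expectation_separated2:
  assumes t: "t \<in> {1..n}" "r \<in> {1..n}" and j: "j \<in> {1..p}" "k \<in> {1..p}" and C: "N t \<subseteq> C" "N r \<subseteq> C"
    and \<Phi>: "\<And>w. (\<And>j. j \<in> {1..p} \<Longrightarrow> (\<lambda>x. w x j) \<in> borel_measurable ((\<Pi>\<^sub>M t\<in>{1..n} - C. rvec p) \<Otimes>\<^sub>M rvec p)) \<Longrightarrow>
      (\<lambda>x. \<Phi> (w x)) \<in> borel_measurable ((\<Pi>\<^sub>M t\<in>{1..n} - C. rvec p) \<Otimes>\<^sub>M rvec p)"
    and b: "\<And>w. \<bar>\<Phi> w\<bar> \<le> K"
  shows "(\<integral>\<omega>. y t \<omega> j * y r \<omega> k * \<Phi> (Z \<theta> C \<omega>) \<partial>M) = (\<integral>\<omega>. y t \<omega> j * y r \<omega> k \<partial>M) * (\<integral>\<omega>. \<Phi> (Z \<theta> C \<omega>) \<partial>M)"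
proof -
  have s: "sample {t, r} X \<omega> t = X t \<omega>" "sample {t, r} X \<omega> r = X r \<omega>" for \<omega> by (simp_all add: sample_def)
  have m: "(\<lambda>f. f t j) \<in> borel_measurable (\<Pi>\<^sub>M t\<in>{t, r}. rvec p)"
    using measurable_compose[OF measurable_component_singleton[of t "{t, r}"] measurable_component_singleton[OF j(1)]] by simp
  have m': "(\<lambda>f. f r k) \<in> borel_measurable (\<Pi>\<^sub>M t\<in>{t, r}. rvec p)"
    using measurable_compose[OF measurable_component_singleton[of r "{t, r}"] measurable_component_singleton[OF j(2)]] by simp
  have mm: "(\<lambda>f. b * f t j * (b * f r k)) \<in> borel_measurable (\<Pi>\<^sub>M t\<in>{t, r}. rvec p)"
    by (intro borel_measurable_times borel_measurable_const m m')
  have "(\<integral>\<omega>. (b * sample {t, r} X \<omega> t j * (b * sample {t, r} X \<omega> r k)) * \<Phi> (Z \<theta> C \<omega>) \<partial>M)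
    = (\<integral>\<omega>. (b * sample {t, r} X \<omega> t j * (b * sample {t, r} X \<omega> r k)) \<partial>M) * (\<integral>\<omega>. \<Phi> (Z \<theta> C \<omega>) \<partial>M)"
  proof (rule expectation_separated[of "{t, r}" C "\<lambda>f. b * f t j * (b * f r k)" \<Phi> K \<theta>, OF _ _ mm _ \<Phi> b])
    show "integrable M (\<lambda>\<omega>. b * sample {t, r} X \<omega> t j * (b * sample {t, r} X \<omega> r k))"
      using int_yy[OF t(1) j(1) t(2) j(2)] unfolding s y_def .
  qed (use t C in auto)
  then show ?thesis unfolding s y_def .
qed

section \<open>Removing neighbourhoods from the path\<close>

lemma Z_insert:
  assumes "U \<subseteq> {1..n}"
  shows "Z \<theta> U \<omega> j + (\<Sum>u\<in>U. sin \<theta> * y u \<omega> j) = Z \<theta> {} \<omega> j"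
proof -
  have "(\<Sum>t\<in>{1..n}. y t \<omega> j) = (\<Sum>t\<in>{1..n} - U. y t \<omega> j) + (\<Sum>t\<in>U. y t \<omega> j)"
    using assms by (intro sum.subset_diff) auto
  then show ?thesis by (simp add: Z_def sum_distrib_left algebra_simps)
qed

lemma Z_diff:
  assumes "U \<subseteq> V" "V \<subseteq> {1..n}"
  shows "Z \<theta> U \<omega> j = Z \<theta> V \<omega> j + (\<Sum>u\<in>V - U. sin \<theta> * y u \<omega> j)"
proof -
  have "(\<Sum>t\<in>{1..n} - U. y t \<omega> j) = (\<Sum>t\<in>{1..n} - U - (V - U). y t \<omega> j) + (\<Sum>t\<in>V - U. y t \<omega> j)"
    using assms by (intro sum.subset_diff) auto
  moreover have "{1..n} - U - (V - U) = {1..n} - V" using assms by auto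
  ultimately show ?thesis by (simp add: Z_def sum_distrib_left algebra_simps)
qed

text \<open>On \<open>T\<close> each summand is at most \<open>\<delta>\<close>, and
  \<open>2 * D * \<delta>\<close> is at most one. The bound \<open>2 * D\<close> accommodates the
  union of two neighbourhoods, and the weights \<open>k\<close> allow partial removal, as at
  intermediate points of a mean value theorem.\<close>

lemma perturbation_le_1:
  assumes \<omega>: "\<omega> \<in> T" and U: "U \<subseteq> {1..n}" "card U \<le> 2 * D" and k: "\<And>u. u \<in> U \<Longrightarrow> \<bar>k u\<bar> \<le> 1" and j: "j \<in> {1..p}"
  shows "\<bar>\<Sum>u\<in>U. sin \<theta> * k u * y u \<omega> j\<bar> \<le> 1"
proof -
  have "\<bar>\<Sum>u\<in>U. sin \<theta> * k u * y u \<omega> j\<bar> \<le> (\<Sum>u\<in>U. \<delta>)"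
  proof (rule order_trans[OF sum_abs sum_mono])
    fix u assume u: "u \<in> U"
    have "\<bar>sin \<theta> * k u\<bar> \<le> 1" unfolding abs_mult using k[OF u] by (intro mult_le_one) auto
    then have "\<bar>sin \<theta> * k u\<bar> * \<bar>y u \<omega> j\<bar> \<le> 1 * \<delta>"
      using T(2)[OF \<omega>, of u j] u U j by (intro mult_mono) (auto simp: y_def)
    then show "\<bar>sin \<theta> * k u * y u \<omega> j\<bar> \<le> \<delta>" by (simp add: abs_mult)
  qed
  also have "\<dots> = real (card U) * \<delta>" by simp
  also have "\<dots> \<le> real (2 * D) * \<delta>" using U(2) \<delta>(1) by (intro mult_right_mono) auto
  finally show ?thesis using \<delta>(2) by simp
qed

text \<open>On \<open>T\<close> this dominates the softmax weights at every point between \<open>Z \<theta> {}\<close> and its versions with a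
  neighbourhood removed, as long as that point lies in the strip where the cutoff varies.\<close>

definition W where
  "W \<theta> \<omega> j = (if \<omega> \<in> T then exp 2 * softmax p (Z \<theta> {} \<omega>) j * of_bool (- 1 \<le> lse p (Z \<theta> {} \<omega>) \<and> lse p (Z \<theta> {} \<omega>) \<le> 1 / a + 1) else 1)"

lemma W_nonneg: "0 \<le> W \<theta> \<omega> j"
  by (simp add: W_def softmax_nonneg)

text \<open>A shift by at most one changes the soft maximum by at most one, which widens the strip
  accordingly, and a softmax weight by the factor \<open>exp 2\<close>. Off \<open>T\<close> the
  trivial bound one is used.\<close>

lemma softmax_le_W:
  assumes U: "U \<subseteq> {1..n}" "card U \<le> 2 * D" and k: "\<And>u. u \<in> U \<Longrightarrow> 0 \<le> k u \<and> k u \<le> 1" and j: "j \<in> {1..p}"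
    and \<xi>: "\<And>j. \<xi> j = Z \<theta> {} \<omega> j - (\<Sum>u\<in>U. sin \<theta> * k u * y u \<omega> j)"
    and strip: "0 < a * lse p \<xi>" "a * lse p \<xi> < 1"
  shows "softmax p \<xi> j \<le> W \<theta> \<omega> j"
proof (cases "\<omega> \<in> T")
  case False
  then show ?thesis using softmax_le_one[OF p1 j] by (simp add: W_def)
next
  case True
  have d: "\<bar>\<xi> j - Z \<theta> {} \<omega> j\<bar> \<le> 1" if "j \<in> {1..p}" for j
    using perturbation_le_1[OF True U, of k j \<theta>] k that by (simp add: \<xi>)
  have l: "\<bar>lse p \<xi> - lse p (Z \<theta> {} \<omega>)\<bar> \<le> 1" by (rule lse_perturb[OF p1 d])
  have "0 < lse p \<xi>" "lse p \<xi> < 1 / a" using strip a0 by (auto simp: zero_less_mult_iff field_simps)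
  then have "- 1 \<le> lse p (Z \<theta> {} \<omega>) \<and> lse p (Z \<theta> {} \<omega>) \<le> 1 / a + 1" using l by linarith
  moreover have "softmax p \<xi> j \<le> exp (2 * 1) * softmax p (Z \<theta> {} \<omega>) j" by (rule softmax_perturb[OF p1 d j])
  ultimately show ?thesis using True by (simp add: W_def)
qed

text \<open>The number \<open>k u\<close> is the fraction of the summand \<open>u\<close> that is
  present at \<open>\<xi>\<close>. All softmax weights along the segment are dominated by the single
  random weight \<open>W\<close>, which refers to the complete point
  \<open>Z \<theta> {}\<close>.\<close>

lemma sm2_local:
  assumes U: "U \<subseteq> {1..n}" "card U \<le> 2 * D" and k: "\<And>u. u \<in> U \<Longrightarrow> 0 \<le> k u \<and> k u \<le> 1"
    and \<xi>: "\<And>j. \<xi> j = Z \<theta> U \<omega> j + (\<Sum>u\<in>U. sin \<theta> * k u * y u \<omega> j)"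
  shows "\<bar>sm2 a p \<xi> x x' - sm2 a p (Z \<theta> U \<omega>) x x'\<bar>
    \<le> 52000 * a * (\<Sum>u\<in>U. \<Sum>j=1..p. W \<theta> \<omega> j * (\<bar>x j\<bar> ^ 3 + \<bar>x' j\<bar> ^ 3 + \<bar>y u \<omega> j\<bar> ^ 3))"
proof -
  have fin: "finite U" using U(1) finite_subset by blast
  have "\<xi> = (\<lambda>j. Z \<theta> U \<omega> j + (\<Sum>u\<in>U. sin \<theta> * k u * y u \<omega> j))" using \<xi> by auto
  then have "\<bar>sm2 a p \<xi> x x' - sm2 a p (Z \<theta> U \<omega>) x x'\<bar>
    \<le> 52000 * a * (\<Sum>u\<in>U. \<Sum>j=1..p. W \<theta> \<omega> j * (\<bar>x j\<bar> ^ 3 + \<bar>x' j\<bar> ^ 3 + \<bar>sin \<theta> * k u * y u \<omega> j\<bar> ^ 3))"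
  proof (simp only:, intro sm2_diff_bound[OF p1 a0 fin] W_nonneg)
    fix s :: real and j assume s: "0 < s" "s < 1" and j: "j \<in> {1..p}"
    let ?\<zeta> = "\<lambda>j. Z \<theta> U \<omega> j + s * (\<Sum>u\<in>U. sin \<theta> * k u * y u \<omega> j)"
    assume st: "0 < a * lse p ?\<zeta>" "a * lse p ?\<zeta> < 1"
    show "softmax p ?\<zeta> j \<le> W \<theta> \<omega> j"
    \<comment> \<open>At time \<open>s\<close> of the segment the fraction \<open>s * k u\<close> is
      present, so seen from the complete point \<open>1 - s * k u\<close> is missing.\<close>
    proof (rule softmax_le_W[OF U _ j _ st, where k="\<lambda>u. 1 - s * k u"])
      show "0 \<le> 1 - s * k u \<and> 1 - s * k u \<le> 1" if "u \<in> U" for u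
        using k[OF that] s mult_le_one[of s "k u"] by auto
      show "Z \<theta> U \<omega> j + s * (\<Sum>u\<in>U. sin \<theta> * k u * y u \<omega> j) = Z \<theta> {} \<omega> j - (\<Sum>u\<in>U. sin \<theta> * (1 - s * k u) * y u \<omega> j)" for j
        unfolding Z_insert[OF U(1), symmetric]
        by (simp add: sum_distrib_left algebra_simps sum_subtractf)
    qed
  qed
  also have "\<dots> \<le> 52000 * a * (\<Sum>u\<in>U. \<Sum>j=1..p. W \<theta> \<omega> j * (\<bar>x j\<bar> ^ 3 + \<bar>x' j\<bar> ^ 3 + \<bar>y u \<omega> j\<bar> ^ 3))"
  proof (intro mult_left_mono sum_mono add_mono order_refl W_nonneg)
    fix u j assume u: "u \<in> U"
    have "\<bar>sin \<theta> * k u\<bar> \<le> 1" unfolding abs_mult using k[OF u] by (intro mult_le_one) auto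
    then have "\<bar>sin \<theta> * k u * y u \<omega> j\<bar> \<le> \<bar>y u \<omega> j\<bar>"
      unfolding abs_mult[of "sin \<theta> * k u"] by (intro mult_left_le_one_le) auto
    then show "\<bar>sin \<theta> * k u * y u \<omega> j\<bar> ^ 3 \<le> \<bar>y u \<omega> j\<bar> ^ 3" by (intro power_mono) auto
  qed (use a0 in auto)
  finally show ?thesis .
qed

section \<open>Taylor expansion around the removed neighbourhoods and its remainder\<close>

definition H where "H \<theta> r \<omega> = (\<Sum>j=1..p. W \<theta> \<omega> j * \<bar>y r \<omega> j\<bar> ^ 3)"

lemma card_union_le:
  assumes "t \<in> {1..n}" "r \<in> N t"
  shows "card (N t \<union> N r) \<le> 2 * D"
proof -
  have "r \<in> {1..n}" using assms(2) N_sub by blast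
  then show ?thesis using card_Un_le[of "N t" "N r"] deg(1)[OF assms(1)] deg(1)[of r] by linarith
qed

text \<open>Removing \<open>N t\<close> produces second derivatives along \<open>y t\<close> and
  \<open>y r\<close>; their base point is then moved to
  \<open>Z \<theta> (N t \<union> N r)\<close>, from which both directions are separated. The
  intermediate point depends on the outcome, but the bound does not mention it, so its measurability
  is never an issue.\<close>

lemma sm1_expansion:
  assumes t: "t \<in> {1..n}"
  shows "\<bar>sm1 a p (Z \<theta> {} \<omega>) (y t \<omega>) - sm1 a p (Z \<theta> (N t) \<omega>) (y t \<omega>)
      - sin \<theta> * (\<Sum>r\<in>N t. sm2 a p (Z \<theta> (N t \<union> N r) \<omega>) (y t \<omega>) (y r \<omega>))\<bar>
    \<le> 52000 * a * (\<Sum>r\<in>N t. \<Sum>u\<in>N t \<union> N r. H \<theta> t \<omega> + H \<theta> r \<omega> + H \<theta> u \<omega>)"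
proof -
  let ?\<xi> = "\<lambda>s j. Z \<theta> (N t) \<omega> j + s * (\<Sum>u\<in>N t. sin \<theta> * y u \<omega> j)"
  have Z0: "(\<lambda>j. Z \<theta> (N t) \<omega> j + (\<Sum>u\<in>N t. sin \<theta> * y u \<omega> j)) = Z \<theta> {} \<omega>"
    using Z_insert[OF N_sub] by auto
  obtain s where s: "0 < s" "s < 1" and
    eq: "sm1 a p (Z \<theta> {} \<omega>) (y t \<omega>) - sm1 a p (Z \<theta> (N t) \<omega>) (y t \<omega>)
      = (\<Sum>r\<in>N t. sm2 a p (?\<xi> s) (y t \<omega>) (\<lambda>j. sin \<theta> * y r \<omega> j))"
    using sm1_diff[OF p1 finite_N[of t], where a=a and A="Z \<theta> (N t) \<omega>" and z="\<lambda>u j. sin \<theta> * y u \<omega> j" and x="y t \<omega>"]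
    unfolding Z0 by (elim exE conjE)
  have "\<bar>sm2 a p (?\<xi> s) (y t \<omega>) (y r \<omega>) - sm2 a p (Z \<theta> (N t \<union> N r) \<omega>) (y t \<omega>) (y r \<omega>)\<bar>
     \<le> 52000 * a * (\<Sum>u\<in>N t \<union> N r. H \<theta> t \<omega> + H \<theta> r \<omega> + H \<theta> u \<omega>)" if r: "r \<in> N t" for r
  proof -
    \<comment> \<open>Relative to the point without \<open>N t \<union> N r\<close>, the fraction
      \<open>s\<close> of \<open>N t\<close> and all of the remaining part of \<open>N r\<close> are
      present.\<close>
    define k where "k u = (if u \<in> N t then s else 1)" for u
    have U: "N t \<union> N r \<subseteq> {1..n}" using N_sub by auto
    have e: "?\<xi> s j = Z \<theta> (N t \<union> N r) \<omega> j + (\<Sum>u\<in>N t \<union> N r. sin \<theta> * k u * y u \<omega> j)" for j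
    proof -
      have "(\<Sum>u\<in>N t \<union> N r. sin \<theta> * k u * y u \<omega> j) = (\<Sum>u\<in>(N t \<union> N r) - N t. sin \<theta> * k u * y u \<omega> j) + (\<Sum>u\<in>N t. sin \<theta> * k u * y u \<omega> j)"
        by (intro sum.subset_diff) (auto simp: finite_N)
      also have "(\<Sum>u\<in>(N t \<union> N r) - N t. sin \<theta> * k u * y u \<omega> j) = (\<Sum>u\<in>(N t \<union> N r) - N t. sin \<theta> * y u \<omega> j)"
        by (intro sum.cong) (auto simp: k_def)
      also have "(\<Sum>u\<in>N t. sin \<theta> * k u * y u \<omega> j) = s * (\<Sum>u\<in>N t. sin \<theta> * y u \<omega> j)"
        unfolding sum_distrib_left by (intro sum.cong) (auto simp: k_def)
      finally show ?thesis using Z_diff[of "N t" "N t \<union> N r" \<theta> \<omega> j] U by simp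
    qed
    have "\<bar>sm2 a p (?\<xi> s) (y t \<omega>) (y r \<omega>) - sm2 a p (Z \<theta> (N t \<union> N r) \<omega>) (y t \<omega>) (y r \<omega>)\<bar>
      \<le> 52000 * a * (\<Sum>u\<in>N t \<union> N r. \<Sum>j=1..p. W \<theta> \<omega> j * (\<bar>y t \<omega> j\<bar> ^ 3 + \<bar>y r \<omega> j\<bar> ^ 3 + \<bar>y u \<omega> j\<bar> ^ 3))"
      by (rule sm2_local[OF U card_union_le[OF t r] _ e]) (use s in \<open>auto simp: k_def\<close>)
    then show ?thesis by (simp add: H_def sum.distrib distrib_left)
  qed
  then have *: "\<bar>\<Sum>r\<in>N t. sm2 a p (?\<xi> s) (y t \<omega>) (y r \<omega>) - sm2 a p (Z \<theta> (N t \<union> N r) \<omega>) (y t \<omega>) (y r \<omega>)\<bar>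
     \<le> (\<Sum>r\<in>N t. 52000 * a * (\<Sum>u\<in>N t \<union> N r. H \<theta> t \<omega> + H \<theta> r \<omega> + H \<theta> u \<omega>))"
    by (intro order_trans[OF sum_abs] sum_mono)
  have eq2: "sm1 a p (Z \<theta> {} \<omega>) (y t \<omega>) - sm1 a p (Z \<theta> (N t) \<omega>) (y t \<omega>)
      - sin \<theta> * (\<Sum>r\<in>N t. sm2 a p (Z \<theta> (N t \<union> N r) \<omega>) (y t \<omega>) (y r \<omega>))
    = sin \<theta> * (\<Sum>r\<in>N t. sm2 a p (?\<xi> s) (y t \<omega>) (y r \<omega>) - sm2 a p (Z \<theta> (N t \<union> N r) \<omega>) (y t \<omega>) (y r \<omega>))"
    unfolding eq sm2_scale by (simp add: sum_distrib_left sum_subtractf algebra_simps)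
  have "\<bar>sin \<theta> * x\<bar> \<le> \<bar>x\<bar>" for x
    unfolding abs_mult by (intro mult_left_le_one_le) auto
  then show ?thesis unfolding eq2
    by (rule order_trans) (rule order_trans[OF *], simp only: sum_distrib_left order_refl)
qed

text \<open>The strip has been widened three times by one: in passing from a partially removed point
  to the complete one, from there to the point without a neighbourhood, and back.\<close>

definition q where "q \<theta> = prob {\<omega> \<in> space M. - 3 \<le> lse p (Z \<theta> {} \<omega>) \<and> lse p (Z \<theta> {} \<omega>) \<le> 1 / a + 3}"
definition \<eta> where "\<eta> = prob (space M - T)"
text \<open>A bound for the expected weighted cubes: third moment times strip probability, plus the
  contribution of the exceptional event, where all \<open>p\<close> weights are bounded by
  one.\<close>

definition Bd where "Bd \<theta> = \<rho> * (exp 4 * (q \<theta> + \<eta>) + real p * \<eta>) + \<zeta>"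

lemma mW [measurable]:
  assumes "j \<in> {1..p}" shows "(\<lambda>\<omega>. W \<theta> \<omega> j) \<in> borel_measurable M"
proof -
  note [measurable] = T(1) msm(2)[OF _ assms, of \<theta> "{}"] msm(1)[of \<theta> "{}"]
  show ?thesis unfolding W_def using assms by (intro measurable_If) measurable
qed

lemma W_le: "j \<in> {1..p} \<Longrightarrow> W \<theta> \<omega> j \<le> exp 2"
  using softmax_le_one[OF p1, of j "Z \<theta> {} \<omega>"] by (auto simp: W_def)

lemma \<eta>_nonneg: "0 \<le> \<eta>" and q_nonneg: "0 \<le> q \<theta>"
  by (simp_all add: \<eta>_def q_def)

lemma q_set: "{\<omega> \<in> space M. - 3 \<le> lse p (Z \<theta> {} \<omega>) \<and> lse p (Z \<theta> {} \<omega>) \<le> 1 / a + 3} \<in> events"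
proof -
  note [measurable] = msm(1)[of \<theta> "{}"]
  show ?thesis by measurable
qed

lemma integral_indicator_prob: "A \<in> events \<Longrightarrow> (\<integral>\<omega>. indicator A \<omega> \<partial>M) = prob A"
  using sets.sets_into_space[of A M] by (simp add: Int_absorb2)

lemma int_ind: "A \<in> events \<Longrightarrow> integrable M (indicator A :: 'a \<Rightarrow> real)"
  by (simp add: emeasure_finite less_top[symmetric])

lemma int_indicators:
  "integrable M (\<lambda>\<omega>. exp 2 * indicator {\<omega> \<in> space M. - 3 \<le> lse p (Z \<theta> {} \<omega>) \<and> lse p (Z \<theta> {} \<omega>) \<le> 1 / a + 3} \<omega>
     + real p * indicator (space M - T) \<omega> :: real)"
  "integrable M (\<lambda>\<omega>. indicator {\<omega> \<in> space M. - 3 \<le> lse p (Z \<theta> {} \<omega>) \<and> lse p (Z \<theta> {} \<omega>) \<le> 1 / a + 3} \<omega>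
     + indicator (space M - T) \<omega> :: real)"
  using q_set T(1) by (auto intro!: Bochner_Integration.integrable_add integrable_mult_right integrable_real_indicator
    simp: emeasure_finite less_top[symmetric])

lemma \<zeta>_nonneg: "t \<in> {1..n} \<Longrightarrow> 0 \<le> \<zeta>"
  by (rule order_trans[OF _ \<zeta>]) (auto intro!: sum_nonneg integral_nonneg)

text \<open>The softmax weights sum to one on \<open>T\<close>, leaving the probability of the
  strip. The bound is stated in the weaker form that occurs in \<open>Bd\<close>.\<close>

lemma sum_W_expectation:
  "(\<Sum>j=1..p. \<integral>\<omega>. W \<theta> \<omega> j \<partial>M) \<le> exp 4 * (q \<theta> + \<eta>) + real p * \<eta>"
proof -
  let ?S = "{\<omega> \<in> space M. - 3 \<le> lse p (Z \<theta> {} \<omega>) \<and> lse p (Z \<theta> {} \<omega>) \<le> 1 / a + 3}"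
  note [measurable] = T(1) q_set mW
  have iW: "integrable M (\<lambda>\<omega>. W \<theta> \<omega> j)" if "j \<in> {1..p}" for j
    by (rule integrable_const_bound[where B="exp 2"]) (use that W_le W_nonneg mW in auto)
  have "(\<Sum>j=1..p. \<integral>\<omega>. W \<theta> \<omega> j \<partial>M) = (\<integral>\<omega>. (\<Sum>j=1..p. W \<theta> \<omega> j) \<partial>M)"
    using iW by (subst Bochner_Integration.integral_sum) auto
  also have "\<dots> \<le> (\<integral>\<omega>. exp 2 * indicator ?S \<omega> + real p * indicator (space M - T) \<omega> \<partial>M)"
  proof (rule integral_mono)
    fix \<omega> assume \<omega>: "\<omega> \<in> space M"
    show "(\<Sum>j=1..p. W \<theta> \<omega> j) \<le> exp 2 * indicator ?S \<omega> + real p * indicator (space M - T) \<omega>"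
    proof (cases "\<omega> \<in> T")
      case True
      have "(\<Sum>j=1..p. W \<theta> \<omega> j) = exp 2 * (\<Sum>j=1..p. softmax p (Z \<theta> {} \<omega>) j) * of_bool (- 1 \<le> lse p (Z \<theta> {} \<omega>) \<and> lse p (Z \<theta> {} \<omega>) \<le> 1 / a + 1)"
        using True by (simp add: W_def sum_distrib_left sum_distrib_right)
      also have "\<dots> \<le> exp 2 * indicator ?S \<omega>"
        unfolding sum_softmax[OF p1] using \<omega> by (auto simp: indicator_def)
      finally show ?thesis using True by simp
    next
      case False
      then show ?thesis using \<omega> by (simp add: W_def)
    qed
  qed (use iW int_indicators in auto)
  also have "\<dots> = exp 2 * q \<theta> + real p * \<eta>"
    using int_ind q_set T(1) by (simp add: q_def \<eta>_def integral_indicator_prob)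
  also have "\<dots> \<le> exp 4 * (q \<theta> + \<eta>) + real p * \<eta>"
    using q_nonneg \<eta>_nonneg by (intro add_right_mono mult_mono) auto
  finally show ?thesis .
qed

text \<open>The weight and the cube of \<open>y r\<close> are dependent. On \<open>T\<close> the
  weight is replaced by its counterpart at the point without \<open>N r\<close>, which is separated
  from \<open>r\<close>; the expectation factors, and the strip event is carried back to the
  complete point. Off \<open>T\<close> the weight is one and the cubes are collected in
  \<open>\<zeta>\<close>.\<close>

lemma H_expectation:
  assumes r: "r \<in> {1..n}"
  shows "integrable M (H \<theta> r)" "(\<integral>\<omega>. H \<theta> r \<omega> \<partial>M) \<le> Bd \<theta>"
proof -
  let ?S = "{\<omega> \<in> space M. - 3 \<le> lse p (Z \<theta> {} \<omega>) \<and> lse p (Z \<theta> {} \<omega>) \<le> 1 / a + 3}"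
  \<comment> \<open>A softmax weight on the strip widened by two, to be evaluated at the point
    without \<open>N r\<close>.\<close>
  define \<Phi> where "\<Phi> j w = softmax p w j * of_bool (- 2 \<le> lse p w \<and> lse p w \<le> 1 / a + 2)" for j w
  define g where "g \<omega> j = exp 4 * (\<bar>y r \<omega> j\<bar> ^ 3 * \<Phi> j (Z \<theta> (N r) \<omega>)) + indicator (space M - T) \<omega> * \<bar>y r \<omega> j\<bar> ^ 3" for \<omega> j
  note [measurable] = T(1) q_set
  have b\<Phi>: "\<bar>\<Phi> j w\<bar> \<le> 1" if "j \<in> {1..p}" for j w
    using softmax_le_one[OF p1 that] softmax_nonneg by (auto simp: \<Phi>_def)
  have m\<Phi>: "(\<lambda>x. \<Phi> j (w x)) \<in> borel_measurable L"
    if "j \<in> {1..p}" "\<And>j. j \<in> {1..p} \<Longrightarrow> (\<lambda>x. w x j) \<in> borel_measurable L" for j w and L :: "'z measure"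
  proof -
    note [measurable] = measurable_sm(1)[OF that(2)] measurable_sm(2)[OF that(2) that(1)]
    show ?thesis unfolding \<Phi>_def by measurable
  qed
  have m\<Phi>Z: "(\<lambda>\<omega>. \<Phi> j (Z \<theta> C \<omega>)) \<in> borel_measurable M" if "j \<in> {1..p}" for j C
    by (rule m\<Phi>[OF that mZ])
  have i\<Phi>: "integrable M (\<lambda>\<omega>. \<Phi> j (Z \<theta> C \<omega>))" if "j \<in> {1..p}" for j C
    by (rule integrable_const_bound[where B=1]) (use b\<Phi>[OF that] m\<Phi>Z[OF that] in auto)
  have i1: "integrable M (\<lambda>\<omega>. \<bar>y r \<omega> j\<bar> ^ 3 * \<Phi> j (Z \<theta> (N r) \<omega>))" if "j \<in> {1..p}" for j
    using int_y3[OF r that] m\<Phi>Z[OF that] b\<Phi>[OF that] by (rule integrable_times_bounded)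
  have i2: "integrable M (\<lambda>\<omega>. indicator (space M - T) \<omega> * \<bar>y r \<omega> j\<bar> ^ 3)" if "j \<in> {1..p}" for j
    by (subst mult.commute, rule integrable_times_bounded[OF int_y3[OF r that], where K=1]) (auto simp: indicator_def)
  have ig: "integrable M (\<lambda>\<omega>. \<Sum>j=1..p. g \<omega> j)"
    unfolding g_def using i1 i2 by (intro Bochner_Integration.integrable_sum Bochner_Integration.integrable_add integrable_mult_right) auto
  have near: "\<bar>Z \<theta> (N r) \<omega> j - Z \<theta> {} \<omega> j\<bar> \<le> 1" if "\<omega> \<in> T" "j \<in> {1..p}" for \<omega> j
  proof -
    have "card (N r) \<le> 2 * D" using deg(1)[OF r] by simp
    then show ?thesis using perturbation_le_1[OF that(1) N_sub, of r "\<lambda>_. 1" j \<theta>] that(2) Z_insert[OF N_sub, of \<theta> r \<omega> j]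
      by (simp add: abs_minus_commute)
  qed
  have Hg: "H \<theta> r \<omega> \<le> (\<Sum>j=1..p. g \<omega> j)" if \<omega>: "\<omega> \<in> space M" for \<omega>
    unfolding H_def
  proof (rule sum_mono)
    fix j assume j: "j \<in> {1..p}"
    show "W \<theta> \<omega> j * \<bar>y r \<omega> j\<bar> ^ 3 \<le> g \<omega> j"
    proof (cases "\<omega> \<in> T")
      case True
      have n': "\<bar>Z \<theta> {} \<omega> j - Z \<theta> (N r) \<omega> j\<bar> \<le> 1" if "j \<in> {1..p}" for j
        using near[OF True that] by (simp add: abs_minus_commute)
      have l: "\<bar>lse p (Z \<theta> {} \<omega>) - lse p (Z \<theta> (N r) \<omega>)\<bar> \<le> 1" by (rule lse_perturb[OF p1 n'])
      have s: "softmax p (Z \<theta> {} \<omega>) j \<le> exp (2 * 1) * softmax p (Z \<theta> (N r) \<omega>) j" by (rule softmax_perturb[OF p1 n' j])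
      have e: "exp 2 * exp 2 = exp (4::real)" by (simp add: exp_add[symmetric])
      have "W \<theta> \<omega> j \<le> exp 4 * \<Phi> j (Z \<theta> (N r) \<omega>)"
      proof (cases "- 1 \<le> lse p (Z \<theta> {} \<omega>) \<and> lse p (Z \<theta> {} \<omega>) \<le> 1 / a + 1")
        case strip: True
        then have "- 2 \<le> lse p (Z \<theta> (N r) \<omega>) \<and> lse p (Z \<theta> (N r) \<omega>) \<le> 1 / a + 2" using l by linarith
        moreover have "exp 2 * softmax p (Z \<theta> {} \<omega>) j \<le> exp 2 * (exp 2 * softmax p (Z \<theta> (N r) \<omega>) j)"
          using s by simp
        ultimately show ?thesis using strip True by (simp add: W_def \<Phi>_def mult.assoc[symmetric] e)
      next
        case False
        then have "W \<theta> \<omega> j = 0" using True by (simp only: W_def) simp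
        then show ?thesis by (simp add: \<Phi>_def softmax_nonneg)
      qed
      from mult_right_mono[OF this, of "\<bar>y r \<omega> j\<bar> ^ 3"] show ?thesis using True by (simp add: g_def ac_simps)
    next
      case False
      have "0 \<le> exp 4 * (\<bar>y r \<omega> j\<bar> ^ 3 * \<Phi> j (Z \<theta> (N r) \<omega>))"
        by (simp add: \<Phi>_def softmax_nonneg)
      then show ?thesis using False \<omega> by (simp add: W_def g_def)
    qed
  qed
  have H0: "0 \<le> H \<theta> r \<omega>" for \<omega> unfolding H_def by (intro sum_nonneg mult_nonneg_nonneg W_nonneg) auto
  show iH: "integrable M (H \<theta> r)"
  proof (rule Bochner_Integration.integrable_bound[OF ig])
    show "H \<theta> r \<in> borel_measurable M"
      unfolding H_def[abs_def] using my[OF r] mW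
      by (intro borel_measurable_sum borel_measurable_times borel_measurable_power borel_measurable_abs) auto
    show "AE \<omega> in M. norm (H \<theta> r \<omega>) \<le> norm (\<Sum>j=1..p. g \<omega> j)"
      using Hg H0 by (intro AE_I2) (simp add: order_trans[OF _ abs_ge_self])
  qed
  have "(\<integral>\<omega>. H \<theta> r \<omega> \<partial>M) \<le> (\<integral>\<omega>. (\<Sum>j=1..p. g \<omega> j) \<partial>M)"
    by (rule integral_mono[OF iH ig Hg])
  also have "\<dots> = (\<Sum>j=1..p. exp 4 * (\<integral>\<omega>. \<bar>y r \<omega> j\<bar> ^ 3 * \<Phi> j (Z \<theta> (N r) \<omega>) \<partial>M)) + (\<Sum>j=1..p. \<integral>\<omega>. indicator (space M - T) \<omega> * \<bar>y r \<omega> j\<bar> ^ 3 \<partial>M)"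
  proof -
    have "(\<integral>\<omega>. (\<Sum>j=1..p. g \<omega> j) \<partial>M) = (\<Sum>j=1..p. \<integral>\<omega>. g \<omega> j \<partial>M)"
      unfolding g_def using i1 i2 by (intro Bochner_Integration.integral_sum Bochner_Integration.integrable_add integrable_mult_right) auto
    also have "\<dots> = (\<Sum>j=1..p. exp 4 * (\<integral>\<omega>. \<bar>y r \<omega> j\<bar> ^ 3 * \<Phi> j (Z \<theta> (N r) \<omega>) \<partial>M) + (\<integral>\<omega>. indicator (space M - T) \<omega> * \<bar>y r \<omega> j\<bar> ^ 3 \<partial>M))"
      unfolding g_def using i1 i2 by (intro sum.cong refl) (subst Bochner_Integration.integral_add, auto)
    finally show ?thesis by (simp add: sum.distrib)
  qed
  also have "(\<Sum>j=1..p. \<integral>\<omega>. indicator (space M - T) \<omega> * \<bar>y r \<omega> j\<bar> ^ 3 \<partial>M) \<le> \<zeta>"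
    using \<zeta>[OF r] by (simp add: y_def)
  also have "(\<Sum>j=1..p. exp 4 * (\<integral>\<omega>. \<bar>y r \<omega> j\<bar> ^ 3 * \<Phi> j (Z \<theta> (N r) \<omega>) \<partial>M))
     \<le> (\<Sum>j=1..p. exp 4 * (\<rho> * (\<integral>\<omega>. \<Phi> j (Z \<theta> (N r) \<omega>) \<partial>M)))"
  proof (intro sum_mono mult_left_mono)
    fix j assume j: "j \<in> {1..p}"
    have "(\<integral>\<omega>. \<bar>y r \<omega> j\<bar> ^ 3 * \<Phi> j (Z \<theta> (N r) \<omega>) \<partial>M) = (\<integral>\<omega>. \<bar>y r \<omega> j\<bar> ^ 3 \<partial>M) * (\<integral>\<omega>. \<Phi> j (Z \<theta> (N r) \<omega>) \<partial>M)"
      by (rule expectation_separated1[OF r j order_refl _ int_y3[OF r j] m\<Phi>[OF j] b\<Phi>[OF j]]) auto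
    also have "\<dots> \<le> \<rho> * (\<integral>\<omega>. \<Phi> j (Z \<theta> (N r) \<omega>) \<partial>M)"
      using \<rho>(1)[OF r j] by (intro mult_right_mono integral_nonneg) (auto simp: y_def \<Phi>_def softmax_nonneg)
    finally show "(\<integral>\<omega>. \<bar>y r \<omega> j\<bar> ^ 3 * \<Phi> j (Z \<theta> (N r) \<omega>) \<partial>M) \<le> \<rho> * (\<integral>\<omega>. \<Phi> j (Z \<theta> (N r) \<omega>) \<partial>M)" .
  qed simp
  \<comment> \<open>The uniform moment bound is outside the sum by now, so the weights can be summed
    to the indicator of the strip. No maximum over coordinates is taken inside an
    expectation.\<close>
  also have "\<dots> = \<rho> * exp 4 * (\<integral>\<omega>. (\<Sum>j=1..p. \<Phi> j (Z \<theta> (N r) \<omega>)) \<partial>M)"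
    using i\<Phi> by (subst Bochner_Integration.integral_sum) (auto simp: sum_distrib_left ac_simps)
  also have "(\<integral>\<omega>. (\<Sum>j=1..p. \<Phi> j (Z \<theta> (N r) \<omega>)) \<partial>M) \<le> (\<integral>\<omega>. indicator ?S \<omega> + indicator (space M - T) \<omega> \<partial>M)"
  proof (rule integral_mono)
    show "integrable M (\<lambda>\<omega>. \<Sum>j=1..p. \<Phi> j (Z \<theta> (N r) \<omega>))" using i\<Phi> by (intro Bochner_Integration.integrable_sum) auto
    fix \<omega> assume \<omega>: "\<omega> \<in> space M"
    have sm: "(\<Sum>j=1..p. \<Phi> j (Z \<theta> (N r) \<omega>)) = of_bool (- 2 \<le> lse p (Z \<theta> (N r) \<omega>) \<and> lse p (Z \<theta> (N r) \<omega>) \<le> 1 / a + 2)"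
      unfolding \<Phi>_def sum_distrib_right[symmetric] sum_softmax[OF p1] by simp
    show "(\<Sum>j=1..p. \<Phi> j (Z \<theta> (N r) \<omega>)) \<le> indicator ?S \<omega> + indicator (space M - T) \<omega>"
    proof (cases "\<omega> \<in> T")
      case True
      have l: "\<bar>lse p (Z \<theta> (N r) \<omega>) - lse p (Z \<theta> {} \<omega>)\<bar> \<le> 1" by (rule lse_perturb[OF p1 near[OF True]])
      have "- 3 \<le> lse p (Z \<theta> {} \<omega>) \<and> lse p (Z \<theta> {} \<omega>) \<le> 1 / a + 3"
        if "- 2 \<le> lse p (Z \<theta> (N r) \<omega>) \<and> lse p (Z \<theta> (N r) \<omega>) \<le> 1 / a + 2" using l that by linarith
      then show ?thesis using \<omega> unfolding sm by (auto simp: indicator_def)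
    next
      case False
      then show ?thesis using \<omega> unfolding sm by (auto simp: indicator_def)
    qed
  qed (rule int_indicators(2))
  also have "(\<integral>\<omega>. indicator ?S \<omega> + indicator (space M - T) \<omega> \<partial>M) = q \<theta> + \<eta>"
    using int_ind q_set T(1) by (simp add: q_def \<eta>_def integral_indicator_prob)
  finally have "(\<integral>\<omega>. H \<theta> r \<omega> \<partial>M) \<le> \<rho> * exp 4 * (q \<theta> + \<eta>) + \<zeta>"
    using \<rho>(2) by (simp add: mult_left_mono)
  also have "\<dots> \<le> Bd \<theta>" using \<rho>(2) \<eta>_nonneg by (simp add: Bd_def algebra_simps)
  finally show "(\<integral>\<omega>. H \<theta> r \<omega> \<partial>M) \<le> Bd \<theta>" .
qed

section \<open>Expected first and second order terms\<close>

abbreviation e where "e \<equiv> unit_vec"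

definition \<sigma> where "\<sigma> t r j k = (\<integral>\<omega>. y t \<omega> j * y r \<omega> k \<partial>M)"

lemma msm2 [measurable]:
  "(\<lambda>\<omega>. sm1 a p (Z \<theta> C \<omega>) x) \<in> borel_measurable M"
  "(\<lambda>\<omega>. sm2 a p (Z \<theta> C \<omega>) x x') \<in> borel_measurable M"
  by (rule measurable_sm(5), rule mZ, assumption) (rule measurable_sm(6), rule mZ, assumption)

lemma integrable_sm2: "integrable M (\<lambda>\<omega>. sm2 a p (Z \<theta> C \<omega>) (e j) (e k))"
  by (rule integrable_const_bound[where B=12000]) (auto intro!: AE_I2 sm_unit_vec_bounds[OF p1 a0])

lemma integrable_y_sm1:
  assumes "t \<in> {1..n}" "j \<in> {1..p}" shows "integrable M (\<lambda>\<omega>. y t \<omega> j * sm1 a p (Z \<theta> C \<omega>) (e k))"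
  using int_y[OF assms] msm2(1) sm_unit_vec_bounds(1)[OF p1 a0] by (rule integrable_times_bounded)

lemma integrable_yy_sm2:
  assumes "t \<in> {1..n}" "r \<in> {1..n}" "j \<in> {1..p}" "k \<in> {1..p}"
  shows "integrable M (\<lambda>\<omega>. y t \<omega> j * y r \<omega> k * sm2 a p (Z \<theta> C \<omega>) (e j) (e k))"
  using int_yy[OF assms(1,3,2,4)] msm2(2) sm_unit_vec_bounds(2)[OF p1 a0] by (rule integrable_times_bounded)

lemma integrable_sm1_y:
  assumes t: "t \<in> {1..n}" shows "integrable M (\<lambda>\<omega>. sm1 a p (Z \<theta> C \<omega>) (y t \<omega>))"
  unfolding sm1_expand[of a p _ "y t _"]
  by (intro Bochner_Integration.integrable_sum integrable_y_sm1 t)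

lemma integrable_sm2_y:
  assumes t: "t \<in> {1..n}" "r \<in> {1..n}" shows "integrable M (\<lambda>\<omega>. sm2 a p (Z \<theta> C \<omega>) (y t \<omega>) (y r \<omega>))"
  unfolding sm2_expand[of a p _ "y t _"]
  by (intro Bochner_Integration.integrable_sum integrable_yy_sm2 t)

lemma integral_sum_sum:
  fixes f :: "'i \<Rightarrow> 'j \<Rightarrow> 'a \<Rightarrow> real"
  assumes "\<And>j k. j \<in> A \<Longrightarrow> k \<in> B \<Longrightarrow> integrable M (f j k)"
  shows "(\<integral>\<omega>. (\<Sum>j\<in>A. \<Sum>k\<in>B. f j k \<omega>) \<partial>M) = (\<Sum>j\<in>A. \<Sum>k\<in>B. \<integral>\<omega>. f j k \<omega> \<partial>M)"
proof -
  have "(\<integral>\<omega>. (\<Sum>j\<in>A. \<Sum>k\<in>B. f j k \<omega>) \<partial>M) = (\<Sum>j\<in>A. \<integral>\<omega>. (\<Sum>k\<in>B. f j k \<omega>) \<partial>M)"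
    using assms by (intro Bochner_Integration.integral_sum Bochner_Integration.integrable_sum) auto
  also have "\<dots> = (\<Sum>j\<in>A. \<Sum>k\<in>B. \<integral>\<omega>. f j k \<omega> \<partial>M)"
    using assms by (intro sum.cong refl Bochner_Integration.integral_sum) auto
  finally show ?thesis .
qed

text \<open>The base point is separated from \<open>t\<close>, so the expectation factors and
  centring makes each coordinate vanish.\<close>

lemma expectation_sm1_far:
  assumes t: "t \<in> {1..n}" shows "(\<integral>\<omega>. sm1 a p (Z \<theta> (N t) \<omega>) (y t \<omega>) \<partial>M) = 0"
proof -
  have "(\<integral>\<omega>. y t \<omega> j * sm1 a p (Z \<theta> (N t) \<omega>) (e j) \<partial>M) = 0" if j: "j \<in> {1..p}" for j
  proof -
    have "(\<integral>\<omega>. y t \<omega> j * sm1 a p (Z \<theta> (N t) \<omega>) (e j) \<partial>M) = (\<integral>\<omega>. y t \<omega> j \<partial>M) * (\<integral>\<omega>. sm1 a p (Z \<theta> (N t) \<omega>) (e j) \<partial>M)"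
      by (rule expectation_separated1[OF t j order_refl _ int_y[OF t j] measurable_sm(5) sm_unit_vec_bounds(1)[OF p1 a0]]) auto
    then show ?thesis by (simp add: mean_y[OF t j])
  qed
  then show ?thesis
    unfolding sm1_expand[of a p _ "y t _"]
    using integrable_y_sm1[OF t] by (subst Bochner_Integration.integral_sum) auto
qed

lemma expectation_sm2_far:
  assumes t: "t \<in> {1..n}" "r \<in> {1..n}" and C: "N t \<subseteq> C" "N r \<subseteq> C"
  shows "(\<integral>\<omega>. sm2 a p (Z \<theta> C \<omega>) (y t \<omega>) (y r \<omega>) \<partial>M)
    = (\<Sum>j=1..p. \<Sum>k=1..p. \<sigma> t r j k * (\<integral>\<omega>. sm2 a p (Z \<theta> C \<omega>) (e j) (e k) \<partial>M))"
proof -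
  have s: "(\<integral>\<omega>. y t \<omega> j * y r \<omega> k * sm2 a p (Z \<theta> C \<omega>) (e j) (e k) \<partial>M) = \<sigma> t r j k * (\<integral>\<omega>. sm2 a p (Z \<theta> C \<omega>) (e j) (e k) \<partial>M)"
    if "j \<in> {1..p}" "k \<in> {1..p}" for j k
    unfolding \<sigma>_def
    by (rule expectation_separated2[OF t that C measurable_sm(6) sm_unit_vec_bounds(2)[OF p1 a0]]) auto
  have "(\<integral>\<omega>. sm2 a p (Z \<theta> C \<omega>) (y t \<omega>) (y r \<omega>) \<partial>M)
     = (\<Sum>j=1..p. \<Sum>k=1..p. (\<integral>\<omega>. y t \<omega> j * y r \<omega> k * sm2 a p (Z \<theta> C \<omega>) (e j) (e k) \<partial>M))"
    unfolding sm2_expand[of a p _ "y t _"]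
    by (intro integral_sum_sum integrable_yy_sm2 t)
  then show ?thesis using s by simp
qed

lemma Bd_nonneg: "t \<in> {1..n} \<Longrightarrow> 0 \<le> Bd \<theta>"
  unfolding Bd_def using \<rho>(2) q_nonneg \<eta>_nonneg \<zeta>_nonneg by simp

lemma sum_N_le:
  assumes t: "t \<in> {1..n}" and b: "\<And>r. r \<in> N t \<Longrightarrow> f r \<le> K" and K: "0 \<le> K"
  shows "(\<Sum>r\<in>N t. f r) \<le> real D * K"
proof -
  have "(\<Sum>r\<in>N t. f r) \<le> real (card (N t)) * K" using sum_bounded_above[of "N t" f K] b by simp
  also have "\<dots> \<le> real D * K" using deg(1)[OF t] K by (intro mult_right_mono) auto
  finally show ?thesis .
qed

lemma sum_N2_le:
  assumes t: "t \<in> {1..n}" "r \<in> N t" and b: "\<And>u. u \<in> N t \<union> N r \<Longrightarrow> f u \<le> K" and K: "0 \<le> K"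
  shows "(\<Sum>u\<in>N t \<union> N r. f u) \<le> real Ds * K"
proof -
  have "(\<Sum>u\<in>N t \<union> N r. f u) \<le> real (card (N t \<union> N r)) * K" using sum_bounded_above[of "N t \<union> N r" f K] b by simp
  also have "\<dots> \<le> real Ds * K" using deg(2)[OF t] K by (intro mult_right_mono) auto
  finally show ?thesis .
qed

text \<open>The distant first order term vanishes, the distant second order terms factor into
  covariances. The error has at most \<open>D\<close> choices of \<open>r\<close> and
  \<open>Ds\<close> choices of \<open>u\<close>, with three weighted cubes each; this is where the
  product of the two degrees arises.\<close>

lemma first_order_remainder:
  assumes t: "t \<in> {1..n}"
  shows "\<bar>(\<integral>\<omega>. sm1 a p (Z \<theta> {} \<omega>) (y t \<omega>) \<partial>M)
     - sin \<theta> * (\<Sum>r\<in>N t. \<Sum>j=1..p. \<Sum>k=1..p. \<sigma> t r j k * (\<integral>\<omega>. sm2 a p (Z \<theta> (N t \<union> N r) \<omega>) (e j) (e k) \<partial>M))\<bar>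
    \<le> 52000 * a * (real D * (real Ds * (3 * Bd \<theta>)))"
proof -
  define R where "R \<omega> = sm1 a p (Z \<theta> {} \<omega>) (y t \<omega>) - sm1 a p (Z \<theta> (N t) \<omega>) (y t \<omega>)
      - sin \<theta> * (\<Sum>r\<in>N t. sm2 a p (Z \<theta> (N t \<union> N r) \<omega>) (y t \<omega>) (y r \<omega>))" for \<omega>
  define h where "h \<omega> = 52000 * a * (\<Sum>r\<in>N t. \<Sum>u\<in>N t \<union> N r. H \<theta> t \<omega> + H \<theta> r \<omega> + H \<theta> u \<omega>)" for \<omega>
  have N: "r \<in> {1..n}" if "r \<in> N u" for r u using that N_sub by blast
  have i2: "integrable M (\<lambda>\<omega>. \<Sum>r\<in>N t. sm2 a p (Z \<theta> (N t \<union> N r) \<omega>) (y t \<omega>) (y r \<omega>))"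
    by (intro Bochner_Integration.integrable_sum integrable_sm2_y t N)
  have iR: "integrable M R" unfolding R_def
    by (intro Bochner_Integration.integrable_diff integrable_mult_right integrable_sm1_y t i2)
  have ih: "integrable M h" unfolding h_def
    using N by (intro integrable_mult_right Bochner_Integration.integrable_sum Bochner_Integration.integrable_add H_expectation(1) t) auto
  have "\<bar>\<integral>\<omega>. R \<omega> \<partial>M\<bar> \<le> (\<integral>\<omega>. \<bar>R \<omega>\<bar> \<partial>M)" by (rule integral_abs_bound)
  also have "\<dots> \<le> (\<integral>\<omega>. h \<omega> \<partial>M)"
    by (rule integral_mono[OF integrable_abs[OF iR] ih]) (unfold R_def h_def, rule sm1_expansion[OF t])
  also have "\<dots> = 52000 * a * (\<Sum>r\<in>N t. \<Sum>u\<in>N t \<union> N r. (\<integral>\<omega>. H \<theta> t \<omega> \<partial>M) + (\<integral>\<omega>. H \<theta> r \<omega> \<partial>M) + (\<integral>\<omega>. H \<theta> u \<omega> \<partial>M))"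
  proof -
    have "(\<integral>\<omega>. (\<Sum>u\<in>N t \<union> N r. H \<theta> t \<omega> + H \<theta> r \<omega> + H \<theta> u \<omega>) \<partial>M)
       = (\<Sum>u\<in>N t \<union> N r. (\<integral>\<omega>. H \<theta> t \<omega> \<partial>M) + (\<integral>\<omega>. H \<theta> r \<omega> \<partial>M) + (\<integral>\<omega>. H \<theta> u \<omega> \<partial>M))" if r: "r \<in> N t" for r
    proof -
      have "integrable M (H \<theta> t)" "integrable M (H \<theta> r)" "\<And>u. u \<in> N t \<union> N r \<Longrightarrow> integrable M (H \<theta> u)"
        using H_expectation(1) t N[OF r] N by blast+
      then show ?thesis by (subst Bochner_Integration.integral_sum) auto
    qed
    moreover have "integrable M (\<lambda>\<omega>. \<Sum>u\<in>N t \<union> N r. H \<theta> t \<omega> + H \<theta> r \<omega> + H \<theta> u \<omega>)" if r: "r \<in> N t" for r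
      using N N[OF r] by (intro Bochner_Integration.integrable_sum Bochner_Integration.integrable_add H_expectation(1) t) auto
    ultimately show ?thesis unfolding h_def integral_mult_right_zero by (subst Bochner_Integration.integral_sum) auto
  qed
  also have "\<dots> \<le> 52000 * a * (real D * (real Ds * (3 * Bd \<theta>)))"
  proof (intro mult_left_mono sum_N_le sum_N2_le t)
    fix r u assume r: "r \<in> N t" and u: "u \<in> N t \<union> N r"
    have "r \<in> {1..n}" "u \<in> {1..n}" using r u N by blast+
    then show "(\<integral>\<omega>. H \<theta> t \<omega> \<partial>M) + (\<integral>\<omega>. H \<theta> r \<omega> \<partial>M) + (\<integral>\<omega>. H \<theta> u \<omega> \<partial>M) \<le> 3 * Bd \<theta>"
      using H_expectation(2)[OF t, of \<theta>] H_expectation(2)[of r \<theta>] H_expectation(2)[of u \<theta>] by linarith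
  qed (use a0 Bd_nonneg[OF t, of \<theta>] in auto)
  also have "(\<integral>\<omega>. R \<omega> \<partial>M) = (\<integral>\<omega>. sm1 a p (Z \<theta> {} \<omega>) (y t \<omega>) \<partial>M)
     - sin \<theta> * (\<Sum>r\<in>N t. \<integral>\<omega>. sm2 a p (Z \<theta> (N t \<union> N r) \<omega>) (y t \<omega>) (y r \<omega>) \<partial>M)"
    unfolding R_def using integrable_sm1_y[OF t] i2 integrable_sm2_y[OF t N]
    by (simp add: expectation_sm1_far[OF t] Bochner_Integration.integral_sum)
  also have "(\<Sum>r\<in>N t. \<integral>\<omega>. sm2 a p (Z \<theta> (N t \<union> N r) \<omega>) (y t \<omega>) (y r \<omega>) \<partial>M)
    = (\<Sum>r\<in>N t. \<Sum>j=1..p. \<Sum>k=1..p. \<sigma> t r j k * (\<integral>\<omega>. sm2 a p (Z \<theta> (N t \<union> N r) \<omega>) (e j) (e k) \<partial>M))"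
    by (intro sum.cong refl expectation_sm2_far t N) auto
  finally show ?thesis .
qed

text \<open>Returns from the separated base points to the complete one, so that the derivative no
  longer depends on the pair of indices and the covariances can be summed to those of
  \<open>G\<close>.\<close>

lemma second_order_remainder:
  assumes t: "t \<in> {1..n}" and r: "r \<in> N t"
  shows "\<bar>(\<Sum>j=1..p. \<Sum>k=1..p. \<sigma> t r j k * (\<integral>\<omega>. sm2 a p (Z \<theta> {} \<omega>) (e j) (e k) \<partial>M))
     - (\<Sum>j=1..p. \<Sum>k=1..p. \<sigma> t r j k * (\<integral>\<omega>. sm2 a p (Z \<theta> (N t \<union> N r) \<omega>) (e j) (e k) \<partial>M))\<bar>
    \<le> 52000 * a * (real Ds * (3 * Bd \<theta>))"
proof -
  let ?U = "N t \<union> N r"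
  have N: "r \<in> {1..n}" if "r \<in> N u" for r u using that N_sub by blast
  have r': "r \<in> {1..n}" using N[OF r] .
  have U: "?U \<subseteq> {1..n}" using N_sub by blast
  define A where "A C \<omega> = (\<Sum>j=1..p. \<Sum>k=1..p. \<sigma> t r j k * sm2 a p (Z \<theta> C \<omega>) (e j) (e k))" for C \<omega>
  have iA: "integrable M (A C)" for C unfolding A_def
    by (intro Bochner_Integration.integrable_sum integrable_mult_right integrable_sm2)
  have EA: "(\<Sum>j=1..p. \<Sum>k=1..p. \<sigma> t r j k * (\<integral>\<omega>. sm2 a p (Z \<theta> C \<omega>) (e j) (e k) \<partial>M)) = (\<integral>\<omega>. A C \<omega> \<partial>M)" for C
    unfolding A_def by (subst integral_sum_sum) (simp_all add: integrable_sm2)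
  \<comment> \<open>The covariances act as an independent copy: the directions are integrated over
    \<open>\<omega>\<close> while the base point stays at \<open>\<omega>'\<close>. The local bound
    holds for arbitrary directions and thus applies under this integral.\<close>
  have A2: "A C \<omega>' = (\<integral>\<omega>. sm2 a p (Z \<theta> C \<omega>') (y t \<omega>) (y r \<omega>) \<partial>M)"
     "integrable M (\<lambda>\<omega>. sm2 a p (Z \<theta> C \<omega>') (y t \<omega>) (y r \<omega>))" for C \<omega>'
  proof -
    have i: "integrable M (\<lambda>\<omega>. y t \<omega> j * y r \<omega> k * sm2 a p (Z \<theta> C \<omega>') (e j) (e k))" if "j \<in> {1..p}" "k \<in> {1..p}" for j k
      by (intro integrable_mult_left int_yy t r' that)
    show "A C \<omega>' = (\<integral>\<omega>. sm2 a p (Z \<theta> C \<omega>') (y t \<omega>) (y r \<omega>) \<partial>M)"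
      unfolding sm2_expand[of a p _ "y t _"] A_def \<sigma>_def
      by (subst integral_sum_sum[OF i]) simp_all
    show "integrable M (\<lambda>\<omega>. sm2 a p (Z \<theta> C \<omega>') (y t \<omega>) (y r \<omega>))"
      unfolding sm2_expand[of a p _ "y t _"] by (intro Bochner_Integration.integrable_sum i)
  qed
  define \<mu> where "\<mu> s j = (\<integral>\<omega>. \<bar>y s \<omega> j\<bar> ^ 3 \<partial>M)" for s j
  have pw: "\<bar>A {} \<omega>' - A ?U \<omega>'\<bar> \<le> 52000 * a * (\<Sum>u\<in>?U. (\<Sum>j=1..p. W \<theta> \<omega>' j * (\<mu> t j + \<mu> r j)) + H \<theta> u \<omega>')" for \<omega>'
  proof -
    define h where "h \<omega> = 52000 * a * (\<Sum>u\<in>?U. \<Sum>j=1..p. W \<theta> \<omega>' j * (\<bar>y t \<omega> j\<bar> ^ 3 + \<bar>y r \<omega> j\<bar> ^ 3 + \<bar>y u \<omega>' j\<bar> ^ 3))" for \<omega>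
    have ih: "integrable M h" unfolding h_def
      by (intro integrable_mult_right Bochner_Integration.integrable_sum Bochner_Integration.integrable_add int_y3 t r') auto
    have "\<bar>A {} \<omega>' - A ?U \<omega>'\<bar> = \<bar>\<integral>\<omega>. sm2 a p (Z \<theta> {} \<omega>') (y t \<omega>) (y r \<omega>) - sm2 a p (Z \<theta> ?U \<omega>') (y t \<omega>) (y r \<omega>) \<partial>M\<bar>"
      unfolding A2(1) using A2(2) by simp
    also have "\<dots> \<le> (\<integral>\<omega>. \<bar>sm2 a p (Z \<theta> {} \<omega>') (y t \<omega>) (y r \<omega>) - sm2 a p (Z \<theta> ?U \<omega>') (y t \<omega>) (y r \<omega>)\<bar> \<partial>M)"
      by (rule integral_abs_bound)
    also have "\<dots> \<le> (\<integral>\<omega>. h \<omega> \<partial>M)"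
    proof (rule integral_mono[OF _ ih])
      show "integrable M (\<lambda>\<omega>. \<bar>sm2 a p (Z \<theta> {} \<omega>') (y t \<omega>) (y r \<omega>) - sm2 a p (Z \<theta> ?U \<omega>') (y t \<omega>) (y r \<omega>)\<bar>)"
        by (intro integrable_abs Bochner_Integration.integrable_diff A2)
      show "\<bar>sm2 a p (Z \<theta> {} \<omega>') (y t \<omega>) (y r \<omega>) - sm2 a p (Z \<theta> ?U \<omega>') (y t \<omega>) (y r \<omega>)\<bar> \<le> h \<omega>" for \<omega>
        unfolding h_def
        by (rule sm2_local[OF U card_union_le[OF t r], where k="\<lambda>_. 1"]) (simp_all add: Z_insert[OF U])
    qed
    also have "\<dots> = 52000 * a * (\<Sum>u\<in>?U. \<Sum>j=1..p. W \<theta> \<omega>' j * (\<mu> t j + \<mu> r j + \<bar>y u \<omega>' j\<bar> ^ 3))"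
      unfolding h_def \<mu>_def using int_y3[OF t] int_y3[OF r']
      by (subst integral_mult_right_zero, subst integral_sum_sum) (simp_all add: prob_space)
    also have "\<dots> = 52000 * a * (\<Sum>u\<in>?U. (\<Sum>j=1..p. W \<theta> \<omega>' j * (\<mu> t j + \<mu> r j)) + H \<theta> u \<omega>')"
      unfolding H_def sum.distrib[symmetric] by (simp add: distrib_left)
    finally show ?thesis .
  qed
  have iW: "integrable M (\<lambda>\<omega>. W \<theta> \<omega> j)" if "j \<in> {1..p}" for j
    by (rule integrable_const_bound[where B="exp 2"]) (use that W_le W_nonneg mW in auto)
  have iWs: "integrable M (\<lambda>\<omega>. \<Sum>j=1..p. W \<theta> \<omega> j * (\<mu> t j + \<mu> r j))"
    by (intro Bochner_Integration.integrable_sum integrable_mult_left iW)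
  have irhs: "integrable M (\<lambda>\<omega>. (\<Sum>j=1..p. W \<theta> \<omega> j * (\<mu> t j + \<mu> r j)) + H \<theta> u \<omega>)" if "u \<in> ?U" for u
    using U that by (intro Bochner_Integration.integrable_add iWs H_expectation(1)) auto
  have EW: "(\<integral>\<omega>. (\<Sum>j=1..p. W \<theta> \<omega> j * (\<mu> t j + \<mu> r j)) \<partial>M) \<le> 2 * Bd \<theta>"
  proof -
    have "(\<integral>\<omega>. (\<Sum>j=1..p. W \<theta> \<omega> j * (\<mu> t j + \<mu> r j)) \<partial>M) = (\<Sum>j=1..p. (\<integral>\<omega>. W \<theta> \<omega> j \<partial>M) * (\<mu> t j + \<mu> r j))"
      using iW by (subst Bochner_Integration.integral_sum) auto
    also have "\<dots> \<le> (\<Sum>j=1..p. (\<integral>\<omega>. W \<theta> \<omega> j \<partial>M) * (2 * \<rho>))"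
    proof (intro sum_mono mult_left_mono)
      fix j assume j: "j \<in> {1..p}"
      show "\<mu> t j + \<mu> r j \<le> 2 * \<rho>" using \<rho>(1)[OF t j] \<rho>(1)[OF r' j] by (simp add: \<mu>_def y_def)
    qed (auto intro!: Bochner_Integration.integral_nonneg W_nonneg)
    also have "\<dots> = 2 * \<rho> * (\<Sum>j=1..p. (\<integral>\<omega>. W \<theta> \<omega> j \<partial>M))" by (simp add: sum_distrib_left ac_simps)
    also have "\<dots> \<le> 2 * \<rho> * (exp 4 * (q \<theta> + \<eta>) + real p * \<eta>)"
      using \<rho>(2) sum_W_expectation by (intro mult_left_mono) auto
    also have "\<dots> \<le> 2 * Bd \<theta>" using \<zeta>_nonneg[OF t] by (simp add: Bd_def)
    finally show ?thesis .
  qed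
  have "\<bar>(\<integral>\<omega>. A {} \<omega> \<partial>M) - (\<integral>\<omega>. A ?U \<omega> \<partial>M)\<bar> = \<bar>\<integral>\<omega>. A {} \<omega> - A ?U \<omega> \<partial>M\<bar>"
    using iA by simp
  also have "\<dots> \<le> (\<integral>\<omega>. \<bar>A {} \<omega> - A ?U \<omega>\<bar> \<partial>M)" by (rule integral_abs_bound)
  also have "\<dots> \<le> (\<integral>\<omega>. 52000 * a * (\<Sum>u\<in>?U. (\<Sum>j=1..p. W \<theta> \<omega> j * (\<mu> t j + \<mu> r j)) + H \<theta> u \<omega>) \<partial>M)"
    by (intro integral_mono integrable_abs Bochner_Integration.integrable_diff iA integrable_mult_right Bochner_Integration.integrable_sum irhs pw)
  also have "\<dots> = 52000 * a * (\<Sum>u\<in>?U. (\<integral>\<omega>. (\<Sum>j=1..p. W \<theta> \<omega> j * (\<mu> t j + \<mu> r j)) \<partial>M) + (\<integral>\<omega>. H \<theta> u \<omega> \<partial>M))"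
  proof -
    have "(\<integral>\<omega>. (\<Sum>j=1..p. W \<theta> \<omega> j * (\<mu> t j + \<mu> r j)) + H \<theta> u \<omega> \<partial>M)
      = (\<integral>\<omega>. (\<Sum>j=1..p. W \<theta> \<omega> j * (\<mu> t j + \<mu> r j)) \<partial>M) + (\<integral>\<omega>. H \<theta> u \<omega> \<partial>M)" if u: "u \<in> ?U" for u
      using iWs H_expectation(1)[of u \<theta>] U u by (intro Bochner_Integration.integral_add) blast+
    then show ?thesis unfolding integral_mult_right_zero
      by (subst Bochner_Integration.integral_sum[OF irhs]) auto
  qed
  also have "\<dots> \<le> 52000 * a * (real Ds * (3 * Bd \<theta>))"
  proof (intro mult_left_mono sum_N2_le t r)
    fix u assume "u \<in> ?U"
    then have "u \<in> {1..n}" using U by blast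
    then show "(\<integral>\<omega>. (\<Sum>j=1..p. W \<theta> \<omega> j * (\<mu> t j + \<mu> r j)) \<partial>M) + (\<integral>\<omega>. H \<theta> u \<omega> \<partial>M) \<le> 3 * Bd \<theta>"
      using EW H_expectation(2)[of u \<theta>] by linarith
  qed (use a0 Bd_nonneg[OF t, of \<theta>] in auto)
  finally show ?thesis unfolding EA .
qed

section \<open>Cancellation against the Gaussian term\<close>

definition K where "K \<theta> = (\<Sum>j=1..p. \<Sum>k=1..p. c\<^sup>2 * \<Sigma> j k * (\<integral>\<omega>. sm2 a p (Z \<theta> {} \<omega>) (e j) (e k) \<partial>M))"

text \<open>Matching of covariances: the matrix of the normal vector, rescaled, is the sum of the
  covariances of neighbouring summands.\<close>

lemma K_eq: "K \<theta> = (\<Sum>t=1..n. \<Sum>r\<in>N t. \<Sum>j=1..p. \<Sum>k=1..p. \<sigma> t r j k * (\<integral>\<omega>. sm2 a p (Z \<theta> {} \<omega>) (e j) (e k) \<partial>M))"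
proof -
  have s: "c\<^sup>2 * \<Sigma> j k = (\<Sum>t=1..n. \<Sum>r\<in>N t. \<sigma> t r j k)" if "j \<in> {1..p}" "k \<in> {1..p}" for j k
  proof -
    have "c\<^sup>2 * \<Sigma> j k = b\<^sup>2 * (real n * \<Sigma> j k)" by (simp add: c_def power_mult_distrib)
    also have "\<dots> = (\<Sum>t=1..n. \<Sum>r\<in>N t. b\<^sup>2 * (\<integral>\<omega>. X t \<omega> j * X r \<omega> k \<partial>M))"
      unfolding cov[OF that] by (simp add: sum_distrib_left)
    also have "\<dots> = (\<Sum>t=1..n. \<Sum>r\<in>N t. \<sigma> t r j k)"
      by (simp add: \<sigma>_def y_def power2_eq_square ac_simps flip: integral_mult_right_zero)
    finally show ?thesis .
  qed
  define g where "g j k = (\<integral>\<omega>. sm2 a p (Z \<theta> {} \<omega>) (e j) (e k) \<partial>M)" for j k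
  have "K \<theta> = (\<Sum>j=1..p. \<Sum>k=1..p. (\<Sum>t=1..n. \<Sum>r\<in>N t. \<sigma> t r j k * g j k))"
    unfolding K_def g_def[symmetric] by (intro sum.cong refl) (simp only: s sum_distrib_right)
  also have "\<dots> = (\<Sum>j=1..p. \<Sum>t=1..n. \<Sum>k=1..p. \<Sum>r\<in>N t. \<sigma> t r j k * g j k)"
    by (intro sum.cong refl sum.swap)
  also have "\<dots> = (\<Sum>t=1..n. \<Sum>j=1..p. \<Sum>k=1..p. \<Sum>r\<in>N t. \<sigma> t r j k * g j k)" by (rule sum.swap)
  also have "\<dots> = (\<Sum>t=1..n. \<Sum>j=1..p. \<Sum>r\<in>N t. \<Sum>k=1..p. \<sigma> t r j k * g j k)"
    by (intro sum.cong refl sum.swap)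
  also have "\<dots> = (\<Sum>t=1..n. \<Sum>r\<in>N t. \<Sum>j=1..p. \<Sum>k=1..p. \<sigma> t r j k * g j k)"
    by (intro sum.cong refl sum.swap)
  finally show ?thesis by (simp only: g_def)
qed

lemma stein_sum:
  "\<bar>(\<Sum>t=1..n. \<integral>\<omega>. sm1 a p (Z \<theta> {} \<omega>) (y t \<omega>) \<partial>M) - sin \<theta> * K \<theta>\<bar>
    \<le> real n * (52000 * a * (real D * (real Ds * (6 * Bd \<theta>))))"
proof -
  define g where "g C t r = (\<Sum>j=1..p. \<Sum>k=1..p. \<sigma> t r j k * (\<integral>\<omega>. sm2 a p (Z \<theta> C \<omega>) (e j) (e k) \<partial>M))" for C t r
  have "\<bar>(\<integral>\<omega>. sm1 a p (Z \<theta> {} \<omega>) (y t \<omega>) \<partial>M) - sin \<theta> * (\<Sum>r\<in>N t. g {} t r)\<bar>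
      \<le> 52000 * a * (real D * (real Ds * (6 * Bd \<theta>)))" if t: "t \<in> {1..n}" for t
  proof -
    have "\<bar>(\<Sum>r\<in>N t. g {} t r - g (N t \<union> N r) t r)\<bar> \<le> (\<Sum>r\<in>N t. 52000 * a * (real Ds * (3 * Bd \<theta>)))"
      unfolding g_def by (intro order_trans[OF sum_abs] sum_mono second_order_remainder t)
    also have "\<dots> \<le> real D * (52000 * a * (real Ds * (3 * Bd \<theta>)))"
      using a0 Bd_nonneg[OF t, of \<theta>] by (intro sum_N_le[OF t]) auto
    finally have 1: "\<bar>(\<Sum>r\<in>N t. g {} t r) - (\<Sum>r\<in>N t. g (N t \<union> N r) t r)\<bar> \<le> real D * (52000 * a * (real Ds * (3 * Bd \<theta>)))"
      by (simp add: sum_subtractf)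
    have "\<bar>sin \<theta> * ((\<Sum>r\<in>N t. g {} t r) - (\<Sum>r\<in>N t. g (N t \<union> N r) t r))\<bar> \<le> \<bar>(\<Sum>r\<in>N t. g {} t r) - (\<Sum>r\<in>N t. g (N t \<union> N r) t r)\<bar>"
      unfolding abs_mult by (intro mult_left_le_one_le) auto
    then have 1: "\<bar>sin \<theta> * (\<Sum>r\<in>N t. g {} t r) - sin \<theta> * (\<Sum>r\<in>N t. g (N t \<union> N r) t r)\<bar> \<le> real D * (52000 * a * (real Ds * (3 * Bd \<theta>)))"
      using 1 by (simp only: right_diff_distrib)
    have 2: "\<bar>(\<integral>\<omega>. sm1 a p (Z \<theta> {} \<omega>) (y t \<omega>) \<partial>M) - sin \<theta> * (\<Sum>r\<in>N t. g (N t \<union> N r) t r)\<bar>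
       \<le> 52000 * a * (real D * (real Ds * (3 * Bd \<theta>)))"
      unfolding g_def by (rule first_order_remainder[OF t])
    have "real D * (52000 * a * (real Ds * (3 * Bd \<theta>))) + 52000 * a * (real D * (real Ds * (3 * Bd \<theta>)))
      = 52000 * a * (real D * (real Ds * (6 * Bd \<theta>)))" by simp
    with 1 2 show ?thesis by linarith
  qed
  then have "\<bar>\<Sum>t=1..n. (\<integral>\<omega>. sm1 a p (Z \<theta> {} \<omega>) (y t \<omega>) \<partial>M) - sin \<theta> * (\<Sum>r\<in>N t. g {} t r)\<bar>
     \<le> (\<Sum>t=1..n. 52000 * a * (real D * (real Ds * (6 * Bd \<theta>))))"
    by (intro order_trans[OF sum_abs] sum_mono)
  moreover have "K \<theta> = (\<Sum>t=1..n. \<Sum>r\<in>N t. g {} t r)" unfolding K_eq g_def ..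
  ultimately show ?thesis by (simp add: sum_subtractf sum_distrib_left)
qed

text \<open>Gaussian integration by parts with the sum frozen. The chain rule contributes
  \<open>cos \<theta> * c\<close>, the direction another \<open>c\<close>, and together with
  \<open>\<Sigma>\<close> they form the coefficients of \<open>K\<close>.\<close>

lemma normal_term:
  "integrable M (\<lambda>\<omega>. sm1 a p (Z \<theta> {} \<omega>) (\<lambda>j. c * G \<omega> j))"
  "(\<integral>\<omega>. sm1 a p (Z \<theta> {} \<omega>) (\<lambda>j. c * G \<omega> j) \<partial>M) = cos \<theta> * K \<theta>"
proof -
  define h where "h s = (\<lambda>j\<in>{1..p}. sin \<theta> * (\<Sum>t=1..n. b * s t j) - v j)" for s :: "nat \<Rightarrow> nat \<Rightarrow> real"
  define S where "S \<omega> = h (sample {1..n} X \<omega>)" for \<omega>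
  have mh: "h \<in> (\<Pi>\<^sub>M t\<in>{1..n}. rvec p) \<rightarrow>\<^sub>M rvec p"
    unfolding h_def
  proof (rule measurable_restrict)
    fix j assume j: "j \<in> {1..p}"
    have "(\<lambda>s. s t j) \<in> borel_measurable (\<Pi>\<^sub>M t\<in>{1..n}. rvec p)" if "t \<in> {1..n}" for t
      using measurable_compose[OF measurable_component_singleton[OF that] measurable_component_singleton[OF j]] .
    then show "(\<lambda>s. sin \<theta> * (\<Sum>t=1..n. b * s t j) - v j) \<in> borel_measurable (\<Pi>\<^sub>M t\<in>{1..n}. rvec p)"
      by (intro borel_measurable_diff borel_measurable_times borel_measurable_sum borel_measurable_const)
  qed
  have ind: "indep_var (rvec p) S (rvec p) G"
    unfolding S_def by (rule indep_sample_G[OF mh])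
  \<comment> \<open>The path as a function of a frozen sum \<open>s\<close>, with the corner already
    subtracted, and of the Gaussian argument \<open>g\<close>.\<close>
  define w where "w s g = (\<lambda>i. s i + cos \<theta> * (c * g i))" for s g :: "nat \<Rightarrow> real"
  have Zw: "Z \<theta> {} \<omega> j = w (S \<omega>) (G \<omega>) j" if "j \<in> {1..p}" for \<omega> j
    using that by (simp add: Z_def w_def S_def h_def y_def sample_def)
  have sm1Z: "sm1 a p (Z \<theta> {} \<omega>) x = sm1 a p (w (S \<omega>) (G \<omega>)) x"
    and sm2Z: "sm2 a p (Z \<theta> {} \<omega>) x x' = sm2 a p (w (S \<omega>) (G \<omega>)) x x'" for \<omega> x x'
    by (intro sm_cong_point Zw; assumption)+
  have mw: "(\<lambda>x. w (fst x) (snd x) j) \<in> borel_measurable (rvec p \<Otimes>\<^sub>M rvec p)" if j: "j \<in> {1..p}" for j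
  proof -
    have "(\<lambda>x. fst x j) \<in> borel_measurable (rvec p \<Otimes>\<^sub>M rvec p)" "(\<lambda>x. snd x j) \<in> borel_measurable (rvec p \<Otimes>\<^sub>M rvec p)"
      by (rule measurable_compose[OF measurable_fst measurable_component_singleton[OF j]]
        measurable_compose[OF measurable_snd measurable_component_singleton[OF j]])+
    then show ?thesis unfolding w_def by (intro borel_measurable_add borel_measurable_times borel_measurable_const)
  qed
  have mw': "(\<lambda>g. w s g j) \<in> borel_measurable (rvec p)" if j: "j \<in> {1..p}" for j s
    unfolding w_def using measurable_component_singleton[OF j]
    by (intro borel_measurable_add borel_measurable_times borel_measurable_const) auto
  have igs: "integrable M (\<lambda>\<omega>. G \<omega> j * sm1 a p (Z \<theta> {} \<omega>) (e j))" if "j \<in> {1..p}" for j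
    using normal.integrable_G[OF that] msm2(1) sm_unit_vec_bounds(1)[OF p1 a0] by (rule integrable_times_bounded)
  have main: "(\<integral>\<omega>. G \<omega> j * sm1 a p (Z \<theta> {} \<omega>) (e j) \<partial>M)
     = (\<Sum>k=1..p. \<Sigma> j k * (cos \<theta> * c * (\<integral>\<omega>. sm2 a p (Z \<theta> {} \<omega>) (e j) (e k) \<partial>M)))" if j: "j \<in> {1..p}" for j
  proof -
    define \<Psi> where "\<Psi> x = snd x j * sm1 a p (w (fst x) (snd x)) (e j)" for x
    define \<Psi>' where "\<Psi>' x = (\<Sum>k=1..p. \<Sigma> j k * (cos \<theta> * c * sm2 a p (w (fst x) (snd x)) (e j) (e k)))" for x
    have m\<Psi>: "\<Psi> \<in> borel_measurable (rvec p \<Otimes>\<^sub>M rvec p)"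
      unfolding \<Psi>_def using measurable_compose[OF measurable_snd measurable_component_singleton[OF j]]
      by (intro borel_measurable_times measurable_sm(5) mw) auto
    have m\<Psi>': "\<Psi>' \<in> borel_measurable (rvec p \<Otimes>\<^sub>M rvec p)"
      unfolding \<Psi>'_def by (intro borel_measurable_sum borel_measurable_times borel_measurable_const measurable_sm(6) mw)
    have i\<Psi>: "integrable M (\<lambda>\<omega>. \<Psi> (S \<omega>, G \<omega>))"
      using igs[OF j] by (simp add: \<Psi>_def sm1Z)
    have i\<Psi>': "integrable M (\<lambda>\<omega>. \<Psi>' (S \<omega>, G \<omega>))"
      unfolding \<Psi>'_def fst_conv snd_conv sm2Z[symmetric]
      by (intro Bochner_Integration.integrable_sum integrable_mult_right integrable_sm2)
    have inner: "(\<integral>\<omega>'. \<Psi> (s, G \<omega>') \<partial>M) = (\<integral>\<omega>'. \<Psi>' (s, G \<omega>') \<partial>M)" for s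
    proof -
      define C where "C = 4000 + \<bar>cos \<theta> * c\<bar> * 12000"
      define F where "F g = sm1 a p (w s g) (e j)" for g
      define Df where "Df g k = cos \<theta> * c * sm2 a p (w s g) (e j) (e k)" for g k
      have der_w: "((\<lambda>z. w s (\<lambda>k\<in>{1..p}. b' k * z + r k) i) has_real_derivative cos \<theta> * c * b' i) (at z)"
        if "i \<in> {1..p}" for b' r :: "nat \<Rightarrow> real" and i z
        unfolding w_def using that by (auto intro!: derivative_eq_intros)
      have "(\<integral>\<omega>. G \<omega> j * F (G \<omega>) \<partial>M) = (\<Sum>k=1..p. \<Sigma> j k * (\<integral>\<omega>. Df (G \<omega>) k \<partial>M))"
      proof (rule normal.integration_by_parts(2)[OF j, where C=C])
        show "F \<in> borel_measurable (rvec p)" unfolding F_def by (intro measurable_sm(5) mw')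
        show "(\<lambda>g. Df g k) \<in> borel_measurable (rvec p)" for k
          unfolding Df_def by (intro borel_measurable_times borel_measurable_const measurable_sm(6) mw')
        show "((\<lambda>z. F (\<lambda>k\<in>{1..p}. b' k * z + r k)) has_real_derivative
          (\<Sum>k=1..p. b' k * Df (\<lambda>k\<in>{1..p}. b' k * z + r k) k)) (at z)" for b' r z
        proof -
          have "((\<lambda>z. F (\<lambda>k\<in>{1..p}. b' k * z + r k)) has_real_derivative
            sm2 a p (w s (\<lambda>k\<in>{1..p}. b' k * z + r k)) (e j) (\<lambda>i. cos \<theta> * c * b' i)) (at z)"
            unfolding F_def by (rule has_real_derivative_sm1[OF p1 der_w])
          also have "sm2 a p (w s (\<lambda>k\<in>{1..p}. b' k * z + r k)) (e j) (\<lambda>i. cos \<theta> * c * b' i)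
            = (\<Sum>k=1..p. b' k * Df (\<lambda>k\<in>{1..p}. b' k * z + r k) k)"
            by (subst sm2_expand_right) (simp add: Df_def ac_simps)
          finally show ?thesis .
        qed
        show "isCont (\<lambda>z. Df (\<lambda>k\<in>{1..p}. b' k * z + r k) k) z" for b' r z k
          unfolding Df_def by (intro continuous_intros DERIV_isCont[OF has_real_derivative_sm2[OF p1 der_w]])
        show "\<bar>F g\<bar> \<le> C" for g
          using sm_unit_vec_bounds(1)[OF p1 a0, of "w s g" j] abs_ge_zero[of "cos \<theta> * c"] unfolding F_def C_def by linarith
        show "\<bar>Df g k\<bar> \<le> C" for g k
          unfolding Df_def C_def abs_mult[of "cos \<theta> * c"]
          by (intro add_increasing mult_left_mono sm_unit_vec_bounds(2)[OF p1 a0]) auto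
      qed
      moreover have "integrable M (\<lambda>\<omega>. Df (G \<omega>) k)" for k
      proof (rule integrable_const_bound[where B="\<bar>cos \<theta> * c\<bar> * 12000"])
        have "(\<lambda>g. Df g k) \<in> borel_measurable (rvec p)"
          unfolding Df_def by (intro borel_measurable_times borel_measurable_const measurable_sm(6) mw')
        then show "(\<lambda>\<omega>. Df (G \<omega>) k) \<in> borel_measurable M" by measurable
        have "\<bar>Df g k\<bar> \<le> \<bar>cos \<theta> * c\<bar> * 12000" for g
          unfolding Df_def abs_mult[of "cos \<theta> * c"] by (intro mult_left_mono sm_unit_vec_bounds(2)[OF p1 a0]) auto
        then show "AE \<omega> in M. norm (Df (G \<omega>) k) \<le> \<bar>cos \<theta> * c\<bar> * 12000" by simp
      qed
      ultimately show ?thesis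
        unfolding \<Psi>_def \<Psi>'_def fst_conv snd_conv F_def[symmetric] Df_def[symmetric]
        by (subst Bochner_Integration.integral_sum) auto
    qed
    have "(\<integral>\<omega>. G \<omega> j * sm1 a p (Z \<theta> {} \<omega>) (e j) \<partial>M) = (\<integral>\<omega>. \<Psi> (S \<omega>, G \<omega>) \<partial>M)"
      by (simp add: \<Psi>_def sm1Z)
    also have "\<dots> = (\<integral>\<omega>. \<Psi>' (S \<omega>, G \<omega>) \<partial>M)"
      unfolding expectation_indep_var[OF ind m\<Psi> i\<Psi>] expectation_indep_var[OF ind m\<Psi>' i\<Psi>'] inner ..
    also have "\<dots> = (\<Sum>k=1..p. \<Sigma> j k * (cos \<theta> * c * (\<integral>\<omega>. sm2 a p (Z \<theta> {} \<omega>) (e j) (e k) \<partial>M)))"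
      unfolding \<Psi>'_def fst_conv snd_conv sm2Z[symmetric]
      using integrable_sm2 by (subst Bochner_Integration.integral_sum) auto
    finally show ?thesis .
  qed
  have ex: "sm1 a p (Z \<theta> {} \<omega>) (\<lambda>j. c * G \<omega> j) = (\<Sum>j=1..p. c * (G \<omega> j * sm1 a p (Z \<theta> {} \<omega>) (e j)))" for \<omega>
    by (subst sm1_expand) (simp add: mult.assoc)
  show "integrable M (\<lambda>\<omega>. sm1 a p (Z \<theta> {} \<omega>) (\<lambda>j. c * G \<omega> j))"
    unfolding ex by (intro Bochner_Integration.integrable_sum integrable_mult_right igs)
  have "(\<integral>\<omega>. sm1 a p (Z \<theta> {} \<omega>) (\<lambda>j. c * G \<omega> j) \<partial>M) = (\<Sum>j=1..p. c * (\<integral>\<omega>. G \<omega> j * sm1 a p (Z \<theta> {} \<omega>) (e j) \<partial>M))"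
    unfolding ex using igs by (subst Bochner_Integration.integral_sum) auto
  also have "\<dots> = cos \<theta> * K \<theta>"
    unfolding K_def using main by (simp add: sum_distrib_left power2_eq_square ac_simps)
  finally show "(\<integral>\<omega>. sm1 a p (Z \<theta> {} \<omega>) (\<lambda>j. c * G \<omega> j) \<partial>M) = cos \<theta> * K \<theta>" .
qed

section \<open>Differentiation in the angle\<close>

definition Z' where "Z' \<theta> \<omega> j = cos \<theta> * (\<Sum>t=1..n. y t \<omega> j) + - sin \<theta> * (c * G \<omega> j)"

lemma sm1_Z': "sm1 a p w (Z' \<theta> \<omega>) = cos \<theta> * (\<Sum>t=1..n. sm1 a p w (y t \<omega>)) + - sin \<theta> * sm1 a p w (\<lambda>j. c * G \<omega> j)"
  unfolding Z'_def[abs_def] sm1_add sm1_scale sm1_sum ..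

lemma derivative_expectation:
  "((\<lambda>\<theta>. \<integral>\<omega>. sm0 a p (Z \<theta> {} \<omega>) \<partial>M) has_real_derivative (\<integral>\<omega>. sm1 a p (Z \<theta> {} \<omega>) (Z' \<theta> \<omega>) \<partial>M)) (at \<theta>)"
proof (rule has_real_derivative_expectation[where w="\<lambda>\<omega>. \<Sum>j=1..p. ((\<Sum>t=1..n. \<bar>y t \<omega> j\<bar>) + \<bar>c\<bar> * \<bar>G \<omega> j\<bar>) * 4000"])
  show "((\<lambda>\<theta>. sm0 a p (Z \<theta> {} \<omega>)) has_real_derivative sm1 a p (Z \<theta> {} \<omega>) (Z' \<theta> \<omega>)) (at \<theta>)" for \<theta> \<omega>
  proof (rule has_real_derivative_sm0[OF p1])
    show "((\<lambda>\<theta>. Z \<theta> {} \<omega> j) has_real_derivative Z' \<theta> \<omega> j) (at \<theta>)" for j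
      unfolding Z_def Z'_def by (auto intro!: derivative_eq_intros)
  qed
  show "integrable M (\<lambda>\<omega>. sm0 a p (Z \<theta> {} \<omega>))" for \<theta>
  proof (rule integrable_const_bound[where B=1])
    show "(\<lambda>\<omega>. sm0 a p (Z \<theta> {} \<omega>)) \<in> borel_measurable M" by (rule measurable_sm(4)) (rule mZ)
  qed (use cut0_bounds in \<open>auto simp: sm0_def\<close>)
  show "(\<lambda>\<omega>. sm1 a p (Z \<theta> {} \<omega>) (Z' \<theta> \<omega>)) \<in> borel_measurable M" for \<theta>
    unfolding sm1_Z' using borel_measurable_integrable[OF integrable_sm1_y] borel_measurable_integrable[OF normal_term(1)]
    by (intro borel_measurable_add borel_measurable_times borel_measurable_const borel_measurable_sum) auto
  show "integrable M (\<lambda>\<omega>. \<Sum>j=1..p. ((\<Sum>t=1..n. \<bar>y t \<omega> j\<bar>) + \<bar>c\<bar> * \<bar>G \<omega> j\<bar>) * 4000)"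
    by (intro Bochner_Integration.integrable_sum integrable_mult_left integrable_mult_right Bochner_Integration.integrable_add
      integrable_abs int_y normal.integrable_G)
  show "\<bar>sm1 a p (Z \<theta> {} \<omega>) (Z' \<theta> \<omega>)\<bar> \<le> (\<Sum>j=1..p. ((\<Sum>t=1..n. \<bar>y t \<omega> j\<bar>) + \<bar>c\<bar> * \<bar>G \<omega> j\<bar>) * 4000)" for \<theta> \<omega>
  proof (subst sm1_expand, rule order_trans[OF sum_abs sum_mono])
    fix j
    have "\<bar>Z' \<theta> \<omega> j\<bar> \<le> \<bar>cos \<theta>\<bar> * \<bar>\<Sum>t=1..n. y t \<omega> j\<bar> + \<bar>sin \<theta>\<bar> * \<bar>c * G \<omega> j\<bar>"
      unfolding Z'_def by (rule order_trans[OF abs_triangle_ineq]) (simp add: abs_mult)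
    also have "\<dots> \<le> 1 * (\<Sum>t=1..n. \<bar>y t \<omega> j\<bar>) + 1 * (\<bar>c\<bar> * \<bar>G \<omega> j\<bar>)"
      by (intro add_mono mult_mono sum_abs) (auto simp: abs_mult)
    finally have "\<bar>Z' \<theta> \<omega> j\<bar> \<le> (\<Sum>t=1..n. \<bar>y t \<omega> j\<bar>) + \<bar>c\<bar> * \<bar>G \<omega> j\<bar>" by simp
    then show "\<bar>Z' \<theta> \<omega> j * sm1 a p (Z \<theta> {} \<omega>) (e j)\<bar> \<le> ((\<Sum>t=1..n. \<bar>y t \<omega> j\<bar>) + \<bar>c\<bar> * \<bar>G \<omega> j\<bar>) * 4000"
      unfolding abs_mult by (intro mult_mono sm_unit_vec_bounds(1)[OF p1 a0]) auto
  qed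
qed

text \<open>The sum contributes \<open>cos \<theta>\<close> times
  \<open>sin \<theta> * K \<theta>\<close> plus the remainder, the Gaussian part contributes
  \<open>- sin \<theta> * cos \<theta> * K \<theta>\<close>. The second order terms cancel
  exactly.\<close>

lemma derivative_bound:
  "\<bar>\<integral>\<omega>. sm1 a p (Z \<theta> {} \<omega>) (Z' \<theta> \<omega>) \<partial>M\<bar> \<le> real n * (52000 * a * (real D * (real Ds * (6 * Bd \<theta>))))"
proof -
  have "(\<integral>\<omega>. sm1 a p (Z \<theta> {} \<omega>) (Z' \<theta> \<omega>) \<partial>M)
    = cos \<theta> * (\<Sum>t=1..n. \<integral>\<omega>. sm1 a p (Z \<theta> {} \<omega>) (y t \<omega>) \<partial>M) + - sin \<theta> * (\<integral>\<omega>. sm1 a p (Z \<theta> {} \<omega>) (\<lambda>j. c * G \<omega> j) \<partial>M)"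
  proof -
    have "integrable M (\<lambda>\<omega>. \<Sum>t=1..n. sm1 a p (Z \<theta> {} \<omega>) (y t \<omega>))"
      by (intro Bochner_Integration.integrable_sum integrable_sm1_y)
    moreover have "(\<integral>\<omega>. (\<Sum>t=1..n. sm1 a p (Z \<theta> {} \<omega>) (y t \<omega>)) \<partial>M) = (\<Sum>t=1..n. \<integral>\<omega>. sm1 a p (Z \<theta> {} \<omega>) (y t \<omega>) \<partial>M)"
      by (intro Bochner_Integration.integral_sum integrable_sm1_y)
    ultimately show ?thesis unfolding sm1_Z' using normal_term(1) by simp
  qed
  then have eq: "(\<integral>\<omega>. sm1 a p (Z \<theta> {} \<omega>) (Z' \<theta> \<omega>) \<partial>M) = cos \<theta> * ((\<Sum>t=1..n. \<integral>\<omega>. sm1 a p (Z \<theta> {} \<omega>) (y t \<omega>) \<partial>M) - sin \<theta> * K \<theta>)"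
    unfolding normal_term(2) by (simp only: algebra_simps)
  have "\<bar>cos \<theta> * ((\<Sum>t=1..n. \<integral>\<omega>. sm1 a p (Z \<theta> {} \<omega>) (y t \<omega>) \<partial>M) - sin \<theta> * K \<theta>)\<bar>
    \<le> \<bar>(\<Sum>t=1..n. \<integral>\<omega>. sm1 a p (Z \<theta> {} \<omega>) (y t \<omega>) \<partial>M) - sin \<theta> * K \<theta>\<bar>"
    unfolding abs_mult[of "cos \<theta>"] by (intro mult_left_le_one_le) auto
  then show ?thesis unfolding eq by (rule order_trans[OF _ stein_sum])
qed

text \<open>The mean value theorem in the angle. The strip probability is assumed bounded at all
  angles because the intermediate one is unknown. The constant is \<open>2 * 6 * 52000\<close>, with
  2 bounding the length of the angular interval.\<close>

theorem smooth_comparison: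
  assumes \<theta>: "0 \<le> \<theta>" "\<theta> \<le> pi / 2" and q: "\<And>\<phi>. 0 \<le> \<phi> \<Longrightarrow> \<phi> \<le> pi / 2 \<Longrightarrow> q \<phi> \<le> Q"
  shows "\<bar>(\<integral>\<omega>. sm0 a p (Z \<theta> {} \<omega>) \<partial>M) - (\<integral>\<omega>. sm0 a p (Z 0 {} \<omega>) \<partial>M)\<bar>
    \<le> 624000 * (a * real n * real D * real Ds) * (\<rho> * (exp 4 * (Q + \<eta>) + real p * \<eta>) + \<zeta>)"
proof (cases "\<theta> = 0")
  case False
  then have t: "0 < \<theta>" using \<theta> by simp
  define f where "f \<theta> = (\<integral>\<omega>. sm0 a p (Z \<theta> {} \<omega>) \<partial>M)" for \<theta>
  define f' where "f' \<theta> = (\<integral>\<omega>. sm1 a p (Z \<theta> {} \<omega>) (Z' \<theta> \<omega>) \<partial>M)" for \<theta>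
  obtain z where z: "0 < z" "z < \<theta>" "f \<theta> - f 0 = (\<theta> - 0) * f' z"
    using MVT2[OF t, of f f'] derivative_expectation unfolding f_def f'_def by blast
  have "Bd z \<le> \<rho> * (exp 4 * (Q + \<eta>) + real p * \<eta>) + \<zeta>"
    unfolding Bd_def using q[of z] z \<theta> \<rho>(2) by (intro add_mono mult_left_mono) auto
  then have "312000 * (a * real n * real D * real Ds) * Bd z
     \<le> 312000 * (a * real n * real D * real Ds) * (\<rho> * (exp 4 * (Q + \<eta>) + real p * \<eta>) + \<zeta>)"
    using a0 by (intro mult_left_mono) auto
  moreover have "real n * (52000 * a * (real D * (real Ds * (6 * Bd z)))) = 312000 * (a * real n * real D * real Ds) * Bd z"
    by simp
  ultimately have "real n * (52000 * a * (real D * (real Ds * (6 * Bd z))))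
     \<le> 312000 * (a * real n * real D * real Ds) * (\<rho> * (exp 4 * (Q + \<eta>) + real p * \<eta>) + \<zeta>)"
    by (simp only:)
  then have b: "\<bar>f' z\<bar> \<le> 312000 * (a * real n * real D * real Ds) * (\<rho> * (exp 4 * (Q + \<eta>) + real p * \<eta>) + \<zeta>)"
    unfolding f'_def by (rule order_trans[OF derivative_bound])
  have "\<theta> \<le> 2" using \<theta>(2) pi_less_4 by linarith
  then have "\<theta> * \<bar>f' z\<bar> \<le> 2 * (312000 * (a * real n * real D * real Ds) * (\<rho> * (exp 4 * (Q + \<eta>) + real p * \<eta>) + \<zeta>))"
    using b t by (intro mult_mono) auto
  then show ?thesis using z(3) t unfolding f_def[symmetric] by (simp add: abs_mult)
next
  case True
  have q0: "0 \<le> Q" using q[of 0] q_nonneg[of 0] by simp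
  show ?thesis
  \<comment> \<open>Nonnegativity of \<open>\<zeta>\<close> is inherited from sums attached to an
    index, so it takes at least one index.\<close>
  proof (cases "n = 0")
    case False
    then have "0 \<le> \<zeta>" using \<zeta>_nonneg[of 1] by simp
    then show ?thesis using True q0 \<eta>_nonneg \<rho>(2) a0 by simp
  qed (use True in simp)
qed

end

section \<open>The central limit theorem\<close>

lemma (in prob_space) max_exp_tail:
  fixes \<xi> :: "nat \<Rightarrow> nat \<Rightarrow> 'a \<Rightarrow> real"
  assumes m: "\<And>t j. t \<in> {1..n} \<Longrightarrow> j \<in> {1..p} \<Longrightarrow> \<xi> t j \<in> borel_measurable M"
    and b: "\<And>t j. t \<in> {1..n} \<Longrightarrow> j \<in> {1..p} \<Longrightarrow> prob {\<omega> \<in> space M. \<tau> < \<bar>\<xi> t j \<omega>\<bar>} \<le> x"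
  shows "{\<omega> \<in> space M. \<forall>t\<in>{1..n}. \<forall>j\<in>{1..p}. \<bar>\<xi> t j \<omega>\<bar> \<le> \<tau>} \<in> events"
    "prob (space M - {\<omega> \<in> space M. \<forall>t\<in>{1..n}. \<forall>j\<in>{1..p}. \<bar>\<xi> t j \<omega>\<bar> \<le> \<tau>}) \<le> real n * real p * x"
proof -
  have ev: "{\<omega> \<in> space M. \<tau> < \<bar>\<xi> t j \<omega>\<bar>} \<in> events" if "t \<in> {1..n}" "j \<in> {1..p}" for t j
  proof -
    note [measurable] = m[OF that]
    show ?thesis by measurable
  qed
  have eq: "space M - {\<omega> \<in> space M. \<forall>t\<in>{1..n}. \<forall>j\<in>{1..p}. \<bar>\<xi> t j \<omega>\<bar> \<le> \<tau>}
    = (\<Union>t\<in>{1..n}. \<Union>j\<in>{1..p}. {\<omega> \<in> space M. \<tau> < \<bar>\<xi> t j \<omega>\<bar>})" unfolding not_le[symmetric] by blast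
  have U: "(\<Union>j\<in>{1..p}. {\<omega> \<in> space M. \<tau> < \<bar>\<xi> t j \<omega>\<bar>}) \<in> events" if "t \<in> {1..n}" for t
    using ev that by (intro sets.finite_UN) auto
  then have UU: "(\<Union>t\<in>{1..n}. \<Union>j\<in>{1..p}. {\<omega> \<in> space M. \<tau> < \<bar>\<xi> t j \<omega>\<bar>}) \<in> events" by (rule sets.finite_UN[OF finite_atLeastAtMost])
  have "{\<omega> \<in> space M. \<forall>t\<in>{1..n}. \<forall>j\<in>{1..p}. \<bar>\<xi> t j \<omega>\<bar> \<le> \<tau>}
    = space M - (\<Union>t\<in>{1..n}. \<Union>j\<in>{1..p}. {\<omega> \<in> space M. \<tau> < \<bar>\<xi> t j \<omega>\<bar>})" unfolding not_le[symmetric] by blast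
  then show "{\<omega> \<in> space M. \<forall>t\<in>{1..n}. \<forall>j\<in>{1..p}. \<bar>\<xi> t j \<omega>\<bar> \<le> \<tau>} \<in> events" using UU by auto
  have "prob (\<Union>t\<in>{1..n}. \<Union>j\<in>{1..p}. {\<omega> \<in> space M. \<tau> < \<bar>\<xi> t j \<omega>\<bar>})
     \<le> (\<Sum>t=1..n. prob (\<Union>j\<in>{1..p}. {\<omega> \<in> space M. \<tau> < \<bar>\<xi> t j \<omega>\<bar>}))"
    using U by (intro finite_measure_subadditive_finite) auto
  also have "\<dots> \<le> (\<Sum>t=1..n. \<Sum>j=1..p. prob {\<omega> \<in> space M. \<tau> < \<bar>\<xi> t j \<omega>\<bar>})"
    using ev by (intro sum_mono finite_measure_subadditive_finite) auto
  also have "\<dots> \<le> (\<Sum>t=1..n. \<Sum>j=1..p. x)" by (intro sum_mono b) auto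
  also have "\<dots> = real n * real p * x" by simp
  finally show "prob (space M - {\<omega> \<in> space M. \<forall>t\<in>{1..n}. \<forall>j\<in>{1..p}. \<bar>\<xi> t j \<omega>\<bar> \<le> \<tau>}) \<le> real n * real p * x"
    unfolding eq .
qed

lemma max_degree_ge:
  assumes "t \<in> {1..n}" shows "card (nbhd n E t) \<le> max_degree n E"
proof -
  have "card (nbhd n E t) = (\<Sum>s=1..n. of_bool ((t, s) \<in> E))"
    by (simp add: nbhd_def sum.If_cases of_bool_def Int_def)
  also have "\<dots> \<le> max_degree n E"
    unfolding max_degree_def using assms by (intro Max_ge) auto
  finally show ?thesis .
qed

text \<open>The loop at \<open>t\<close> puts \<open>N t\<close> itself among the neighbourhoods of
  neighbours, so the union lies in the second neighbourhood of \<open>t\<close>.\<close>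

lemma max_degree2_ge:
  assumes t: "t \<in> {1..n}" and r: "r \<in> nbhd n E t" and self: "t \<in> nbhd n E t"
  shows "card (nbhd n E t \<union> nbhd n E r) \<le> max_degree2 n E"
proof -
  have "card (nbhd n E t \<union> nbhd n E r) \<le> card {s \<in> {1..n}. s \<in> (\<Union>l\<in>nbhd n E t. nbhd n E l)}"
    using r self by (intro card_mono) (auto simp: nbhd_def)
  also have "\<dots> = (\<Sum>s=1..n. of_bool (s \<in> (\<Union>l\<in>nbhd n E t. nbhd n E l)))"
    by (simp add: sum.If_cases of_bool_def Int_def)
  also have "\<dots> \<le> max_degree2 n E"
    unfolding max_degree2_def using t by (intro Max_ge) auto
  finally show ?thesis .
qed

text \<open>The non-asymptotic setting for one fixed \<open>n\<close>. The bound
  \<open>3 \<le> p\<close> gives \<open>1 \<le> ln p\<close>, which absorbs additive constants; it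
  holds for all large \<open>n\<close> because \<open>p\<close> is at least a positive power of
  \<open>n\<close>.\<close>

locale clt_setting = prob_space M for M :: "'a measure" +
  fixes n p :: nat and X :: "nat \<Rightarrow> 'a \<Rightarrow> nat \<Rightarrow> real" and G :: "'a \<Rightarrow> nat \<Rightarrow> real"
    and E :: "(nat \<times> nat) set" and B \<kappa> \<gamma> K3 :: real
  assumes n1: "1 \<le> n" and p3: "3 \<le> p" and \<kappa>: "0 < \<kappa>" and pn: "real n powr \<kappa> \<le> real p"
    and \<gamma>: "1 \<le> \<gamma>" and K3: "0 < K3" and B1: "1 \<le> B"
    and measX: "\<And>t. t \<in> {1..n} \<Longrightarrow> X t \<in> M \<rightarrow>\<^sub>M rvec p"
    and meanX: "\<And>t j. t \<in> {1..n} \<Longrightarrow> j \<in> {1..p} \<Longrightarrow> expectation (\<lambda>\<omega>. X t \<omega> j) = 0"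
    and psi: "\<And>t j. t \<in> {1..n} \<Longrightarrow> j \<in> {1..p} \<Longrightarrow> psi_norm M \<gamma> (\<lambda>\<omega>. X t \<omega> j) \<le> ennreal B"
    and varX: "\<And>j. j \<in> {1..p} \<Longrightarrow> variance (\<lambda>\<omega>. normalized_sum n X \<omega> j) \<ge> K3"
    and normalG: "multivariate_normal M p (\<lambda>_. 0)
         (\<lambda>j k. covariance M (\<lambda>\<omega>. normalized_sum n X \<omega> j) (\<lambda>\<omega>. normalized_sum n X \<omega> k)) G"
    and indepG: "indep_of_sample M n p X G"
    and graphE: "dependency_graph M n p X E"
begin

definition \<Xi> where "\<Xi> = (\<lambda>j k. covariance M (\<lambda>\<omega>. normalized_sum n X \<omega> j) (\<lambda>\<omega>. normalized_sum n X \<omega> k))"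

lemma \<Xi>_sym: "\<Xi> j k = \<Xi> k j"
  by (simp add: \<Xi>_def covariance_def mult.commute)

lemma \<Xi>_ge: "j \<in> {1..p} \<Longrightarrow> K3 \<le> \<Xi> j j"
  using varX[of j] by (simp add: \<Xi>_def covariance_def power2_eq_square)

sublocale dependent_sample M n p X G E
proof unfold_locales
  show "random_variable (rvec p) G" using normalG by (simp add: multivariate_normal_def)
  show "random_variable (rvec p) (X t)" if "t \<in> {1..n}" for t using measX[OF that] .
qed (rule graphE, rule indepG)

sublocale normal: centered_normal M p \<Xi> G
proof unfold_locales
  show "multivariate_normal M p (\<lambda>_. 0) \<Xi> G" using normalG by (simp add: \<Xi>_def)
  show "0 < \<Xi> j j" if "j \<in> {1..p}" for j using \<Xi>_ge[OF that] K3 by simp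
qed (rule \<Xi>_sym)

lemma mX: "t \<in> {1..n} \<Longrightarrow> j \<in> {1..p} \<Longrightarrow> (\<lambda>\<omega>. X t \<omega> j) \<in> borel_measurable M"
  by (rule measurable_X_coord)

lemma B0: "0 < B" using B1 by simp

lemma moment:
  assumes "t \<in> {1..n}" "j \<in> {1..p}" "0 < k"
  shows "integrable M (\<lambda>\<omega>. \<bar>X t \<omega> j\<bar> ^ k)" "(\<integral>\<omega>. \<bar>X t \<omega> j\<bar> ^ k \<partial>M) \<le> 6 * (2 * real k) ^ k * B ^ k"
  by (rule psi_norm_moment[OF mX[OF assms(1,2)] \<gamma> B0 psi[OF assms(1,2)] assms(3)])+

lemma integrable_X: "t \<in> {1..n} \<Longrightarrow> j \<in> {1..p} \<Longrightarrow> integrable M (\<lambda>\<omega>. X t \<omega> j)"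
  by (rule integrable_abs_cancel) (use moment(1)[of t j 1] mX[of t j] in simp_all)

lemma integrable_XX:
  assumes "t \<in> {1..n}" "j \<in> {1..p}" "r \<in> {1..n}" "k \<in> {1..p}"
  shows "integrable M (\<lambda>\<omega>. X t \<omega> j * X r \<omega> k)"
proof (rule Bochner_Integration.integrable_bound)
  show "integrable M (\<lambda>\<omega>. \<bar>X t \<omega> j\<bar> ^ 2 + \<bar>X r \<omega> k\<bar> ^ 2)"
    by (intro Bochner_Integration.integrable_add moment(1) assms) auto
  have "norm (X t \<omega> j * X r \<omega> k) \<le> norm (\<bar>X t \<omega> j\<bar> ^ 2 + \<bar>X r \<omega> k\<bar> ^ 2)" for \<omega>
  proof -
    have "0 \<le> (\<bar>X t \<omega> j\<bar> - \<bar>X r \<omega> k\<bar>)\<^sup>2" "0 \<le> \<bar>X t \<omega> j\<bar>\<^sup>2" "0 \<le> \<bar>X r \<omega> k\<bar>\<^sup>2" by simp_all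
    then have "\<bar>X t \<omega> j\<bar> * \<bar>X r \<omega> k\<bar> \<le> \<bar>X t \<omega> j\<bar>\<^sup>2 + \<bar>X r \<omega> k\<bar>\<^sup>2"
      unfolding power2_diff by linarith
    then show ?thesis by (simp add: abs_mult)
  qed
  then show "AE \<omega> in M. norm (X t \<omega> j * X r \<omega> k) \<le> norm (\<bar>X t \<omega> j\<bar> ^ 2 + \<bar>X r \<omega> k\<bar> ^ 2)" by simp
qed (intro borel_measurable_times mX assms)

lemma uncorrelated:
  assumes "t \<in> {1..n}" "j \<in> {1..p}" "r \<in> {1..n}" "k \<in> {1..p}" "(t, r) \<notin> E"
  shows "(\<integral>\<omega>. X t \<omega> j * X r \<omega> k \<partial>M) = 0"
proof -
  have "indep_var (rvec p) (X t) (rvec p) (X r)"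
    using dependency_graph_pairwise_indep[OF prob_space_axioms graphE] assms by blast
  then have "indep_var borel ((\<lambda>x. x j) \<circ> X t) borel ((\<lambda>x. x k) \<circ> X r)"
    by (rule indep_var_compose) (use assms in \<open>auto intro: measurable_component_singleton\<close>)
  then have "(\<integral>\<omega>. X t \<omega> j * X r \<omega> k \<partial>M) = (\<integral>\<omega>. X t \<omega> j \<partial>M) * (\<integral>\<omega>. X r \<omega> k \<partial>M)"
    using indep_var_lebesgue_integral integrable_X assms unfolding o_def by blast
  then show ?thesis using meanX assms by simp
qed

lemma covariance_sum:
  assumes j: "j \<in> {1..p}" and k: "k \<in> {1..p}"
  shows "real n * \<Xi> j k = (\<Sum>t=1..n. \<Sum>r\<in>nbhd n E t. \<integral>\<omega>. X t \<omega> j * X r \<omega> k \<partial>M)"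
proof -
  have m0: "(\<integral>\<omega>. normalized_sum n X \<omega> j \<partial>M) = 0" if "j \<in> {1..p}" for j
    unfolding normalized_sum_def using integrable_X meanX that by simp
  have "\<Xi> j k = (\<integral>\<omega>. normalized_sum n X \<omega> j * normalized_sum n X \<omega> k \<partial>M)"
    unfolding \<Xi>_def covariance_def m0[OF j] m0[OF k] by simp
  also have "\<dots> = (\<integral>\<omega>. (\<Sum>t=1..n. \<Sum>r=1..n. X t \<omega> j * X r \<omega> k) / real n \<partial>M)"
    by (simp add: normalized_sum_def sum_product)
  also have "\<dots> = (\<integral>\<omega>. (\<Sum>t=1..n. \<Sum>r=1..n. X t \<omega> j * X r \<omega> k) \<partial>M) / real n" by simp
  also have "(\<integral>\<omega>. (\<Sum>t=1..n. \<Sum>r=1..n. X t \<omega> j * X r \<omega> k) \<partial>M) = (\<Sum>t=1..n. \<integral>\<omega>. (\<Sum>r=1..n. X t \<omega> j * X r \<omega> k) \<partial>M)"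
    by (intro Bochner_Integration.integral_sum Bochner_Integration.integrable_sum integrable_XX j k)
  also have "\<dots> = (\<Sum>t=1..n. \<Sum>r=1..n. \<integral>\<omega>. X t \<omega> j * X r \<omega> k \<partial>M)"
    by (intro sum.cong refl Bochner_Integration.integral_sum integrable_XX j k)
  also have "\<dots> = (\<Sum>t=1..n. \<Sum>r\<in>nbhd n E t. \<integral>\<omega>. X t \<omega> j * X r \<omega> k \<partial>M)"
  proof (rule sum.cong[OF refl])
    fix t assume t: "t \<in> {1..n}"
    show "(\<Sum>r=1..n. \<integral>\<omega>. X t \<omega> j * X r \<omega> k \<partial>M) = (\<Sum>r\<in>nbhd n E t. \<integral>\<omega>. X t \<omega> j * X r \<omega> k \<partial>M)"
    proof (rule sum.mono_neutral_right)
      show "nbhd n E t \<subseteq> {1..n}" by (auto simp: nbhd_def)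
      show "\<forall>r\<in>{1..n} - nbhd n E t. (\<integral>\<omega>. X t \<omega> j * X r \<omega> k \<partial>M) = 0"
        using uncorrelated[OF t j _ k] by (simp add: nbhd_def)
    qed simp
  qed
  finally show ?thesis using n1 by simp
qed

lemma mG: "j \<in> {1..p} \<Longrightarrow> (\<lambda>\<omega>. G \<omega> j) \<in> borel_measurable M"
  by (rule measurable_G_coord)

lemma mS: "j \<in> {1..p} \<Longrightarrow> (\<lambda>\<omega>. normalized_sum n X \<omega> j) \<in> borel_measurable M"
  unfolding normalized_sum_def by (intro borel_measurable_divide borel_measurable_sum mX borel_measurable_const)

section \<open>Distribution functions of the mixtures\<close>

definition mix where "mix \<nu> \<omega> j = sqrt \<nu> * normalized_sum n X \<omega> j + sqrt (1 - \<nu>) * G \<omega> j"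

definition P where "P \<nu> u = prob {\<omega> \<in> space M. \<forall>j\<in>{1..p}. mix \<nu> \<omega> j \<le> u j}"
definition P0 where "P0 u = prob {\<omega> \<in> space M. \<forall>j\<in>{1..p}. G \<omega> j \<le> u j}"

lemma mmix: "j \<in> {1..p} \<Longrightarrow> (\<lambda>\<omega>. mix \<nu> \<omega> j) \<in> borel_measurable M"
  unfolding mix_def using mS mG by (intro borel_measurable_add borel_measurable_times borel_measurable_const) auto

lemma events_mix: "{\<omega> \<in> space M. \<forall>j\<in>{1..p}. mix \<nu> \<omega> j \<le> u j} \<in> events"
proof -
  have "{\<omega> \<in> space M. mix \<nu> \<omega> j \<le> u j} \<in> events" if "j \<in> {1..p}" for j
    using mmix[OF that] by measurable
  then show ?thesis by (intro sets.sets_Collect_finite_All) auto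
qed

lemma mix_0: "mix 0 \<omega> j = G \<omega> j"
  by (simp add: mix_def)

lemma P_0: "P 0 u = P0 u"
  by (simp add: P_def P0_def mix_0)

lemma varrho_eq: "varrho M n p X G = (SUP (u, \<nu>) \<in> UNIV \<times> {0..1}. \<bar>P \<nu> u - P0 u\<bar>)"
  by (simp add: varrho_def P_def P0_def mix_def)

lemma abs_P_le_1: "\<bar>P \<nu> u - P0 u\<bar> \<le> 1"
proof -
  have "0 \<le> P \<nu> u" "P \<nu> u \<le> 1" "0 \<le> P0 u" "P0 u \<le> 1"
    unfolding P_def P0_def by (rule measure_nonneg prob_le_1)+
  then show ?thesis by linarith
qed

text \<open>A supremum of reals is an upper bound only for a bounded family; differences of
  probabilities are bounded by one.\<close>

lemma varrho_ge: "0 \<le> \<nu> \<Longrightarrow> \<nu> \<le> 1 \<Longrightarrow> \<bar>P \<nu> u - P0 u\<bar> \<le> varrho M n p X G"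
proof -
  assume \<nu>: "0 \<le> \<nu>" "\<nu> \<le> 1"
  have "bdd_above ((\<lambda>(u, \<nu>). \<bar>P \<nu> u - P0 u\<bar>) ` (UNIV \<times> {0..1}))"
    by (rule bdd_aboveI2[where M=1]) (auto simp: abs_P_le_1 split: prod.split)
  from cSUP_upper[OF _ this, of "(u, \<nu>)"] show ?thesis unfolding varrho_eq using \<nu> by simp
qed

lemma varrho_le:
  assumes "\<And>u \<nu>. 0 \<le> \<nu> \<Longrightarrow> \<nu> \<le> 1 \<Longrightarrow> \<bar>P \<nu> u - P0 u\<bar> \<le> x"
  shows "varrho M n p X G \<le> x"
  unfolding varrho_eq by (rule cSUP_least) (use assms in auto)

lemma ln_p: "1 \<le> ln (real p)"
proof -
  have "exp 1 \<le> real p" using exp_le p3 by linarith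
  then show ?thesis using p3 by (subst ln_ge_iff) auto
qed

text \<open>The growth of \<open>p\<close> relative to \<open>n\<close> converts the truncation
  level into a multiple of \<open>B * ln p\<close>.\<close>

lemma ln_np: "ln (real n * real p) \<le> (1 + 1 / \<kappa>) * ln (real p)"
proof -
  have "\<kappa> * ln (real n) \<le> ln (real p)"
    using pn n1 p3 ln_mono[OF pn] by (simp add: ln_powr)
  then have "ln (real n) \<le> ln (real p) / \<kappa>" using \<kappa> by (simp add: field_simps)
  then show ?thesis using n1 p3 by (simp add: ln_mult algebra_simps)
qed

lemma anti_conc:
  assumes "0 \<le> \<delta>"
  shows "P0 (\<lambda>j. u j + \<delta>) - P0 u \<le> 4 * exp 4 * sqrt (ln p) * (\<delta> / sqrt K3)"
  unfolding P0_def by (rule normal.anti_concentration[OF p3 K3 \<Xi>_ge assms])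

text \<open>The cubic moments on the exceptional event are absorbed by the pointwise bound
  \<open>2 \<bar>y\<bar>\<^sup>3 \<le> y\<^sup>6 / (n p) + n p\<close>.\<close>

lemma truncation:
  defines "\<tau> \<equiv> 6 * B * ln (real n * real p)"
  defines "T \<equiv> {\<omega> \<in> space M. \<forall>t\<in>{1..n}. \<forall>j\<in>{1..p}. \<bar>X t \<omega> j\<bar> \<le> \<tau>}"
  shows "T \<in> events" "prob (space M - T) \<le> 6 / (real n * real p)\<^sup>2"
    "\<And>t. t \<in> {1..n} \<Longrightarrow> (\<Sum>j=1..p. \<integral>\<omega>. indicator (space M - T) \<omega> * \<bar>X t \<omega> j\<bar> ^ 3 \<partial>M) \<le> 9000000 * B ^ 3 / n"
proof -
  define N where "N = real n * real p"
  have N1: "1 \<le> N" unfolding N_def using n1 p3 mult_mono[of 1 "real n" 1 "real p"] by simp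
  \<comment> \<open>The factor 6 in the truncation level is tuned to a tail of order
    \<open>N^-3\<close>, so that \<open>N^-2\<close> is left after the union over all
    \<open>N = n * p\<close> entries.\<close>
  have e: "exp (- \<tau> / (2 * B)) = 1 / N ^ 3"
  proof -
    have "- \<tau> / (2 * B) = - (3 * ln N)" using B0 by (simp add: \<tau>_def N_def)
    also have "exp \<dots> = inverse (exp (3 * ln N))" by (rule exp_minus)
    also have "exp (3 * ln N) = N ^ 3" using N1 exp_of_nat_mult[of 3 "ln N"] by simp
    finally show ?thesis by (simp add: inverse_eq_divide)
  qed
  have tail: "prob {\<omega> \<in> space M. \<tau> < \<bar>X t \<omega> j\<bar>} \<le> 6 * (1 / N ^ 3)" if "t \<in> {1..n}" "j \<in> {1..p}" for t j
    using psi_norm_tail[OF mX[OF that] \<gamma> B0 psi[OF that], of \<tau>] unfolding e .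
  show T: "T \<in> events" unfolding T_def by (rule max_exp_tail(1)[where x="6 * (1 / N ^ 3)"]) (use mX tail in auto)
  have "prob (space M - T) \<le> real n * real p * (6 * (1 / N ^ 3))"
    unfolding T_def by (rule max_exp_tail(2)) (use mX tail in auto)
  also have "\<dots> = 6 / N\<^sup>2" unfolding N_def[symmetric] using N1 by (simp add: power3_eq_cube power2_eq_square)
  finally show pT: "prob (space M - T) \<le> 6 / (real n * real p)\<^sup>2" by (simp add: N_def)
  fix t assume t: "t \<in> {1..n}"
  have one: "(\<integral>\<omega>. indicator (space M - T) \<omega> * \<bar>X t \<omega> j\<bar> ^ 3 \<partial>M) \<le> 9000000 * B ^ 3 / N" if j: "j \<in> {1..p}" for j
  proof -
    \<comment> \<open>Completing the square for the cube \<open>z\<close> with pivot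
      \<open>N * B ^ 3\<close> balances the sixth moment against the probability of the exceptional
      event.\<close>
    define h where "h \<omega> = (1 / (2 * N * B ^ 3)) * \<bar>X t \<omega> j\<bar> ^ 6 + (N * B ^ 3 / 2) * indicator (space M - T) \<omega>" for \<omega>
    have i6: "integrable M (\<lambda>\<omega>. \<bar>X t \<omega> j\<bar> ^ 6)" by (rule moment(1)[OF t j]) simp
    have ii: "integrable M (indicator (space M - T) :: 'a \<Rightarrow> real)" using T by (simp add: emeasure_finite less_top[symmetric])
    have ih: "integrable M h" unfolding h_def using i6 ii by simp
    have pw: "indicator (space M - T) \<omega> * \<bar>X t \<omega> j\<bar> ^ 3 \<le> h \<omega>" for \<omega>
    proof -
      define z where "z = \<bar>X t \<omega> j\<bar> ^ 3"
      have z: "0 \<le> z" "\<bar>X t \<omega> j\<bar> ^ 6 = z\<^sup>2" by (simp_all add: z_def power_mult[symmetric])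
      define c where "c = N * B ^ 3"
      have c: "0 < c" using N1 B0 by (simp add: c_def)
      have "0 \<le> (z - c)\<^sup>2 / (2 * c)" using c by simp
      also have "(z - c)\<^sup>2 / (2 * c) = z\<^sup>2 / (2 * c) + c / 2 - z" using c by (simp add: power2_eq_square field_simps)
      finally have "z \<le> z\<^sup>2 / (2 * c) + c / 2" by simp
      moreover have "0 \<le> z\<^sup>2 / (2 * c)" using c by simp
      ultimately show ?thesis unfolding h_def z z_def[symmetric] c_def by (auto simp: indicator_def mult.assoc)
    qed
    have "(\<integral>\<omega>. indicator (space M - T) \<omega> * \<bar>X t \<omega> j\<bar> ^ 3 \<partial>M) \<le> (\<integral>\<omega>. h \<omega> \<partial>M)"
    proof (rule integral_mono[OF _ ih pw])
      show "integrable M (\<lambda>\<omega>. indicator (space M - T) \<omega> * \<bar>X t \<omega> j\<bar> ^ 3)"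
      proof (rule Bochner_Integration.integrable_bound[OF moment(1)[OF t j, of 3]])
        show "(\<lambda>\<omega>. indicator (space M - T) \<omega> * \<bar>X t \<omega> j\<bar> ^ 3) \<in> borel_measurable M"
          using T mX[OF t j] by measurable
      qed (auto simp: indicator_def)
    qed
    also have "\<dots> = (1 / (2 * N * B ^ 3)) * (\<integral>\<omega>. \<bar>X t \<omega> j\<bar> ^ 6 \<partial>M) + (N * B ^ 3 / 2) * prob (space M - T)"
    proof -
      have "(\<integral>\<omega>. indicator (space M - T) \<omega> \<partial>M) = prob (space M - T)"
        using T by (simp add: Int_absorb2)
      then show ?thesis unfolding h_def using i6 ii by simp
    qed
    also have "\<dots> \<le> (1 / (2 * N * B ^ 3)) * (6 * (2 * real 6) ^ 6 * B ^ 6) + (N * B ^ 3 / 2) * (6 / N\<^sup>2)"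
      using moment(2)[OF t j, of 6] pT N1 B0 by (intro add_mono mult_left_mono) (auto simp: N_def)
    \<comment> \<open>The sixth moment gives \<open>6 * 12^6 / 2 = 8957952\<close>, the probability
      term gives 3.\<close>
    also have "\<dots> = 8957955 * B ^ 3 / N"
    proof -
      have "B ^ 6 = B ^ 3 * B ^ 3" by (simp add: power_add[symmetric])
      then show ?thesis using N1 B0 by (simp add: field_simps power2_eq_square)
    qed
    also have "\<dots> \<le> 9000000 * B ^ 3 / N" using N1 B0 by (intro divide_right_mono mult_right_mono) auto
    finally show ?thesis .
  qed
  have "(\<Sum>j=1..p. \<integral>\<omega>. indicator (space M - T) \<omega> * \<bar>X t \<omega> j\<bar> ^ 3 \<partial>M) \<le> (\<Sum>j=1..p. 9000000 * B ^ 3 / N)"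
    by (intro sum_mono one)
  also have "\<dots> = 9000000 * B ^ 3 / n" using p3 by (simp add: N_def)
  finally show "(\<Sum>j=1..p. \<integral>\<omega>. indicator (space M - T) \<omega> * \<bar>X t \<omega> j\<bar> ^ 3 \<partial>M) \<le> 9000000 * B ^ 3 / n" .
qed

lemma self_edge: "t \<in> {1..n} \<Longrightarrow> t \<in> nbhd n E t"
  using graphE by (auto simp: nbhd_def dependency_graph_def)

lemma degrees_ge_1: "1 \<le> max_degree n E" "1 \<le> max_degree2 n E"
proof -
  have t: "1 \<in> {1..n}" using n1 by simp
  have "finite (nbhd n E 1)" by (simp add: nbhd_def)
  then have c: "1 \<le> card (nbhd n E 1)" "1 \<le> card (nbhd n E 1 \<union> nbhd n E 1)" using self_edge[OF t] by (auto simp: Suc_le_eq card_gt_0_iff)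
  show "1 \<le> max_degree n E" using c(1) max_degree_ge[OF t, of E] by linarith
  show "1 \<le> max_degree2 n E" using c(2) max_degree2_ge[OF t self_edge[OF t] self_edge[OF t]] by linarith
qed

section \<open>Comparison at a fixed scale\<close>

abbreviation "D \<equiv> max_degree n E"
abbreviation "Ds \<equiv> max_degree2 n E"
abbreviation "\<rr> \<equiv> varrho M n p X G"

text \<open>When the soft maximum lies in the strip, the point is inside the orthant with corner
  \<open>u1\<close> but outside the one with corner \<open>u2\<close>. Both probabilities are
  replaced by Gaussian ones at the cost of \<open>varrho\<close> each, which uses the supremum over
  \<open>\<nu>\<close>, and Gaussian anti-concentration handles the rest. The width
  \<open>2 * L + 7\<close> is at most \<open>9 * L\<close>, whence
  \<open>36 = 4 * 9\<close>.\<close>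

lemma strip_prob:
  assumes \<beta>: "0 < \<beta>" and \<nu>: "0 \<le> \<nu>" "\<nu> \<le> 1"
  shows "prob {\<omega> \<in> space M. - 3 \<le> lse p (\<lambda>j. \<beta> * mix \<nu> \<omega> j - v j) \<and> lse p (\<lambda>j. \<beta> * mix \<nu> \<omega> j - v j) \<le> ln p + 3}
    \<le> 2 * \<rr> + 36 * exp 4 * sqrt (ln p) * (ln p / \<beta>) / sqrt K3"
proof -
  define L where "L = ln (real p)"
  have L: "1 \<le> L" using ln_p by (simp add: L_def)
  define u1 where "u1 j = (v j + L + 3) / \<beta>" for j
  \<comment> \<open>Inside this orthant the soft maximum is at most -4, strictly below the lower end
    -3 of the strip.\<close>
  define u2 where "u2 j = (v j - L - 4) / \<beta>" for j
  have u12: "u1 = (\<lambda>j. u2 j + (2 * L + 7) / \<beta>)"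
    by (auto simp: u1_def u2_def add_divide_distrib[symmetric])
  have d0: "0 \<le> (2 * L + 7) / \<beta>" using L \<beta> by simp
  let ?Z = "\<lambda>\<omega> j. \<beta> * mix \<nu> \<omega> j - v j"
  have p1: "1 \<le> p" using p3 by simp
  have "prob {\<omega> \<in> space M. - 3 \<le> lse p (?Z \<omega>) \<and> lse p (?Z \<omega>) \<le> ln p + 3}
     \<le> prob ({\<omega> \<in> space M. \<forall>j\<in>{1..p}. mix \<nu> \<omega> j \<le> u1 j} - {\<omega> \<in> space M. \<forall>j\<in>{1..p}. mix \<nu> \<omega> j \<le> u2 j})"
  proof (rule finite_measure_mono)
    show "{\<omega> \<in> space M. \<forall>j\<in>{1..p}. mix \<nu> \<omega> j \<le> u1 j} - {\<omega> \<in> space M. \<forall>j\<in>{1..p}. mix \<nu> \<omega> j \<le> u2 j} \<in> events"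
      by (intro sets.Diff events_mix)
    show "{\<omega> \<in> space M. - 3 \<le> lse p (?Z \<omega>) \<and> lse p (?Z \<omega>) \<le> ln p + 3}
      \<subseteq> {\<omega> \<in> space M. \<forall>j\<in>{1..p}. mix \<nu> \<omega> j \<le> u1 j} - {\<omega> \<in> space M. \<forall>j\<in>{1..p}. mix \<nu> \<omega> j \<le> u2 j}"
    proof
      fix \<omega> assume "\<omega> \<in> {\<omega> \<in> space M. - 3 \<le> lse p (?Z \<omega>) \<and> lse p (?Z \<omega>) \<le> ln p + 3}"
      then have \<omega>: "\<omega> \<in> space M" and l: "- 3 \<le> lse p (?Z \<omega>)" "lse p (?Z \<omega>) \<le> L + 3" by (auto simp: L_def)
      have "mix \<nu> \<omega> j \<le> u1 j" if "j \<in> {1..p}" for j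
        using le_lse[OF that, of "?Z \<omega>"] l(2) \<beta> by (simp add: u1_def field_simps)
      moreover have "\<not> (\<forall>j\<in>{1..p}. mix \<nu> \<omega> j \<le> u2 j)"
      proof
        assume "\<forall>j\<in>{1..p}. mix \<nu> \<omega> j \<le> u2 j"
        then have "?Z \<omega> j \<le> - L - 4" if "j \<in> {1..p}" for j using that \<beta> by (auto simp: u2_def field_simps)
        then have "lse p (?Z \<omega>) \<le> (- L - 4) + ln p" by (rule lse_le[OF p1])
        then show False using l(1) by (simp add: L_def)
      qed
      ultimately show "\<omega> \<in> {\<omega> \<in> space M. \<forall>j\<in>{1..p}. mix \<nu> \<omega> j \<le> u1 j} - {\<omega> \<in> space M. \<forall>j\<in>{1..p}. mix \<nu> \<omega> j \<le> u2 j}"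
        using \<omega> by blast
    qed
  qed
  also have "\<dots> = P \<nu> u1 - P \<nu> u2"
    unfolding P_def using d0 by (intro finite_measure_Diff events_mix) (auto simp: u12 intro: add_increasing2)
  also have "\<dots> \<le> 2 * \<rr> + (P0 u1 - P0 u2)"
    using varrho_ge[OF \<nu>, of u1] varrho_ge[OF \<nu>, of u2] unfolding abs_le_iff by linarith
  also have "P0 u1 - P0 u2 \<le> 4 * exp 4 * sqrt (ln p) * (((2 * L + 7) / \<beta>) / sqrt K3)"
    unfolding u12 by (rule anti_conc[OF d0])
  also have "\<dots> \<le> 4 * exp 4 * sqrt (ln p) * ((9 * L / \<beta>) / sqrt K3)"
    using L \<beta> K3 ln_p by (intro mult_left_mono divide_right_mono) auto
  also have "\<dots> = 36 * exp 4 * sqrt (ln p) * (ln p / \<beta>) / sqrt K3"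
    by (simp add: L_def)
  finally show ?thesis by simp
qed

text \<open>Specialises the comparison to \<open>a = 1 / ln p\<close> and the corner-shifted
  mixtures. The third moment constant is \<open>1296 = 6 * 6^3\<close>, and the exceptional
  probability of order \<open>1 / (n * p)^2\<close> is at most \<open>6 / n\<close> even after
  multiplication by \<open>p\<close>.\<close>

lemma smooth_mix:
  assumes b: "0 < b" and small: "2 * real D * (b * (6 * B * ln (real n * real p))) \<le> 1" and \<nu>: "0 \<le> \<nu>" "\<nu> \<le> 1"
  defines "\<beta> \<equiv> b * sqrt (real n)"
  defines "Q \<equiv> 2 * \<rr> + 36 * exp 4 * sqrt (ln p) * (ln p / \<beta>) / sqrt K3"
  shows "\<bar>(\<integral>\<omega>. sm0 (1 / ln p) p (\<lambda>j. \<beta> * mix \<nu> \<omega> j - v j) \<partial>M) - (\<integral>\<omega>. sm0 (1 / ln p) p (\<lambda>j. \<beta> * G \<omega> j - v j) \<partial>M)\<bar>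
    \<le> 624000 * (1 / ln p * real n * real D * real Ds) *
      (1296 * (b * B) ^ 3 * (exp 4 * (Q + 6 / n) + 6 / n) + 9000000 * (b * B) ^ 3 / n)"
proof -
  define \<tau> where "\<tau> = 6 * B * ln (real n * real p)"
  define T where "T = {\<omega> \<in> space M. \<forall>t\<in>{1..n}. \<forall>j\<in>{1..p}. \<bar>X t \<omega> j\<bar> \<le> \<tau>}"
  note tr = truncation[folded \<tau>_def, folded T_def]
  have N1: "1 \<le> real n * real p" using n1 p3 mult_mono[of 1 "real n" 1 "real p"] by simp
  have \<tau>0: "0 \<le> \<tau>" using B0 N1 by (simp add: \<tau>_def)
  have \<beta>: "0 < \<beta>" using b n1 by (simp add: \<beta>_def)
  interpret I: interpolation M n p X G E \<Xi> b "1 / ln p" v T "b * \<tau>" "1296 * (b * B) ^ 3" "9000000 * (b * B) ^ 3 / n" D Ds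
  proof unfold_locales
    show "1 \<le> p" using p3 by simp
    show "0 \<le> b" using b by simp
    show "0 < 1 / ln (real p)" "1 / ln (real p) \<le> 1" using ln_p by auto
    fix t j assume t: "t \<in> {1..n}"
    { assume j: "j \<in> {1..p}"
      show "(\<integral>\<omega>. X t \<omega> j \<partial>M) = 0" by (rule meanX[OF t j])
      show "integrable M (\<lambda>\<omega>. \<bar>X t \<omega> j\<bar> ^ 3)" by (rule moment(1)[OF t j]) simp
      have "(\<integral>\<omega>. \<bar>b * X t \<omega> j\<bar> ^ 3 \<partial>M) = b ^ 3 * (\<integral>\<omega>. \<bar>X t \<omega> j\<bar> ^ 3 \<partial>M)"
        using b by (simp add: abs_mult power_mult_distrib)
      also have "\<dots> \<le> b ^ 3 * (6 * (2 * real 3) ^ 3 * B ^ 3)"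
        using moment(2)[OF t j, of 3] b by (intro mult_left_mono) auto
      finally show "(\<integral>\<omega>. \<bar>b * X t \<omega> j\<bar> ^ 3 \<partial>M) \<le> 1296 * (b * B) ^ 3"
        by (simp add: power_mult_distrib)
      show "\<bar>b * X t \<omega> j\<bar> \<le> b * \<tau>" if "\<omega> \<in> T" for \<omega>
        using that t j b by (auto simp: T_def abs_mult) }
    show "card (nbhd n E t) \<le> D" by (rule max_degree_ge[OF t])
    show "card (nbhd n E t \<union> nbhd n E r) \<le> Ds" if "r \<in> nbhd n E t" for r
      by (rule max_degree2_ge[OF t that self_edge[OF t]])
    have "(\<Sum>j=1..p. \<integral>\<omega>. indicator (space M - T) \<omega> * \<bar>b * X t \<omega> j\<bar> ^ 3 \<partial>M)
      = b ^ 3 * (\<Sum>j=1..p. \<integral>\<omega>. indicator (space M - T) \<omega> * \<bar>X t \<omega> j\<bar> ^ 3 \<partial>M)"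
      using b by (simp add: abs_mult power_mult_distrib sum_distrib_left mult.left_commute)
    also have "\<dots> \<le> b ^ 3 * (9000000 * B ^ 3 / n)"
      using tr(3)[OF t] b by (intro mult_left_mono) auto
    finally show "(\<Sum>j=1..p. \<integral>\<omega>. indicator (space M - T) \<omega> * \<bar>b * X t \<omega> j\<bar> ^ 3 \<partial>M) \<le> 9000000 * (b * B) ^ 3 / n"
      by (simp add: power_mult_distrib mult.left_commute)
  next
    show "real n * \<Xi> j k = (\<Sum>t=1..n. \<Sum>r\<in>nbhd n E t. \<integral>\<omega>. X t \<omega> j * X r \<omega> k \<partial>M)"
      if "j \<in> {1..p}" "k \<in> {1..p}" for j k using that by (rule covariance_sum)
    show "T \<in> events" by (rule tr(1))
    show "0 \<le> b * \<tau>" using b \<tau>0 by simp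
    show "2 * real D * (b * \<tau>) \<le> 1" using small by (simp add: \<tau>_def)
    show "0 \<le> 1296 * (b * B) ^ 3" using b B0 by simp
  qed
  \<comment> \<open>On the quarter circle sine and cosine are nonnegative, hence equal to
    \<open>sqrt \<nu>\<close> and \<open>sqrt (1 - \<nu>)\<close> for the squared sine
    \<open>\<nu>\<close>.\<close>
  have Zmix: "I.Z \<phi> {} \<omega> = (\<lambda>j. \<beta> * mix ((sin \<phi>)\<^sup>2) \<omega> j - v j)" if \<phi>: "0 \<le> \<phi>" "\<phi> \<le> pi / 2" for \<phi> \<omega>
  proof
    fix j
    have s: "0 \<le> sin \<phi>" using \<phi> pi_gt_zero by (intro sin_ge_zero) linarith+
    have c: "0 \<le> cos \<phi>" using \<phi> pi_gt_zero by (intro cos_ge_zero) linarith+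
    have "sqrt (1 - (sin \<phi>)\<^sup>2) = cos \<phi>" using c by (simp add: cos_squared_eq[symmetric])
    moreover have "sqrt ((sin \<phi>)\<^sup>2) = sin \<phi>" using s by simp
    moreover have "sqrt (real n) * normalized_sum n X \<omega> j = (\<Sum>t=1..n. X t \<omega> j)"
      using n1 by (simp add: normalized_sum_def)
    then have "(\<Sum>t=1..n. b * X t \<omega> j) = b * (sqrt (real n) * normalized_sum n X \<omega> j)"
      by (simp only: sum_distrib_left)
    ultimately show "I.Z \<phi> {} \<omega> j = \<beta> * mix ((sin \<phi>)\<^sup>2) \<omega> j - v j"
      by (simp add: I.Z_def I.y_def I.c_def mix_def \<beta>_def algebra_simps)
  qed
  have q: "I.q \<phi> \<le> Q" if \<phi>: "0 \<le> \<phi>" "\<phi> \<le> pi / 2" for \<phi>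
    unfolding I.q_def Zmix[OF \<phi>] Q_def
    using strip_prob[OF \<beta>, of "(sin \<phi>)\<^sup>2" v] abs_sin_le_one[of \<phi>] by (simp add: abs_square_le_1)
  define \<theta> where "\<theta> = arcsin (sqrt \<nu>)"
  have sq: "0 \<le> sqrt \<nu>" "sqrt \<nu> \<le> 1" using \<nu> by auto
  have \<theta>: "0 \<le> \<theta>" "\<theta> \<le> pi / 2" unfolding \<theta>_def
    using sq arcsin_ubound[OF order_trans[OF _ sq(1)] sq(2)] arcsin_le_arcsin[of 0 "sqrt \<nu>"] by simp_all
  have "- 1 \<le> sqrt \<nu>" using sq by linarith
  from sin_arcsin[OF this sq(2)] have sin\<theta>: "(sin \<theta>)\<^sup>2 = \<nu>" unfolding \<theta>_def using \<nu> by simp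
  have p0: "0 \<le> (0::real)" "(0::real) \<le> pi / 2" using pi_gt_zero by linarith+
  have \<eta>: "I.\<eta> \<le> 6 / n" "real p * I.\<eta> \<le> 6 / n"
  proof -
    have e: "I.\<eta> \<le> 6 / (real n * real p)\<^sup>2" unfolding I.\<eta>_def by (rule tr(2))
    have "real p * I.\<eta> \<le> real p * (6 / (real n * real p)\<^sup>2)" by (rule mult_left_mono[OF e]) simp
    also have "\<dots> = 6 / (real n * (real n * real p))" using n1 p3 by (simp add: power2_eq_square)
    also have "\<dots> \<le> 6 / (real n * 1)" using N1 n1 by (intro divide_left_mono mult_left_mono) auto
    finally show *: "real p * I.\<eta> \<le> 6 / n" by simp
    have "1 * I.\<eta> \<le> real p * I.\<eta>" using p3 I.\<eta>_nonneg by (intro mult_right_mono) auto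
    with * show "I.\<eta> \<le> 6 / n" by simp
  qed
  have "\<bar>(\<integral>\<omega>. sm0 (1 / ln p) p (I.Z \<theta> {} \<omega>) \<partial>M) - (\<integral>\<omega>. sm0 (1 / ln p) p (I.Z 0 {} \<omega>) \<partial>M)\<bar>
    \<le> 624000 * (1 / ln p * real n * real D * real Ds) *
      (1296 * (b * B) ^ 3 * (exp 4 * (Q + I.\<eta>) + real p * I.\<eta>) + 9000000 * (b * B) ^ 3 / n)"
    by (rule I.smooth_comparison[OF \<theta> q])
  also have "\<dots> \<le> 624000 * (1 / ln p * real n * real D * real Ds) *
      (1296 * (b * B) ^ 3 * (exp 4 * (Q + 6 / n) + 6 / n) + 9000000 * (b * B) ^ 3 / n)"
    using \<eta> ln_p b B0 by (intro mult_left_mono add_mono add_left_mono order_refl) auto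
  finally show ?thesis
    unfolding Zmix[OF \<theta>] Zmix[OF p0] sin\<theta> by (simp add: mix_0)
qed

lemma sm0_le_1: "sm0 a p w \<le> 1" and sm0_ge_0: "0 \<le> sm0 a p w"
  using cut0_bounds by (auto simp: sm0_def)

lemma P_eq_integral: "P \<nu> u = (\<integral>\<omega>. indicator {\<omega> \<in> space M. \<forall>j\<in>{1..p}. mix \<nu> \<omega> j \<le> u j} \<omega> \<partial>M)"
  unfolding P_def using events_mix by (simp add: Int_absorb2)

text \<open>With the corner raised by \<open>ln p\<close>, the soft maximum is nonpositive on the
  orthant and the cutoff is one. With the corner lowered by \<open>ln p\<close>, a single violated
  coordinate pushes the soft maximum to at least \<open>ln p\<close>, where the cutoff is
  zero.\<close>

lemma sandwich:
  assumes \<beta>: "0 < \<beta>"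
  shows "P \<nu> u \<le> (\<integral>\<omega>. sm0 (1 / ln p) p (\<lambda>j. \<beta> * mix \<nu> \<omega> j - (\<beta> * u j + ln p)) \<partial>M)"
    "(\<integral>\<omega>. sm0 (1 / ln p) p (\<lambda>j. \<beta> * mix \<nu> \<omega> j - (\<beta> * u j - ln p)) \<partial>M) \<le> P \<nu> u"
proof -
  define L where "L = ln (real p)"
  have L: "1 \<le> L" using ln_p by (simp add: L_def)
  have p1: "1 \<le> p" using p3 by simp
  have i: "integrable M (\<lambda>\<omega>. sm0 (1 / L) p (\<lambda>j. \<beta> * mix \<nu> \<omega> j - w j))" for w
  proof (rule integrable_const_bound[where B=1])
    show "(\<lambda>\<omega>. sm0 (1 / L) p (\<lambda>j. \<beta> * mix \<nu> \<omega> j - w j)) \<in> borel_measurable M"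
      by (rule measurable_sm(4)) (intro borel_measurable_diff borel_measurable_times borel_measurable_const mmix)
  qed (use sm0_le_1 sm0_ge_0 in auto)
  have ii: "integrable M (indicator {\<omega> \<in> space M. \<forall>j\<in>{1..p}. mix \<nu> \<omega> j \<le> u j} :: 'a \<Rightarrow> real)"
    using events_mix by (simp add: emeasure_finite less_top[symmetric])
  show "P \<nu> u \<le> (\<integral>\<omega>. sm0 (1 / ln p) p (\<lambda>j. \<beta> * mix \<nu> \<omega> j - (\<beta> * u j + ln p)) \<partial>M)"
    unfolding P_eq_integral L_def[symmetric]
  proof (rule integral_mono[OF ii i])
    fix \<omega> assume "\<omega> \<in> space M"
    let ?w = "\<lambda>j. \<beta> * mix \<nu> \<omega> j - (\<beta> * u j + L)"
    show "indicator {\<omega> \<in> space M. \<forall>j\<in>{1..p}. mix \<nu> \<omega> j \<le> u j} \<omega> \<le> sm0 (1 / L) p ?w"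
    proof (cases "\<forall>j\<in>{1..p}. mix \<nu> \<omega> j \<le> u j")
      case True
      then have "?w j \<le> - L" if "j \<in> {1..p}" for j using that \<beta> by auto
      then have "lse p ?w \<le> - L + ln p" by (rule lse_le[OF p1])
      then have "1 / L * lse p ?w \<le> 0" using L by (simp add: L_def mult_nonneg_nonpos divide_nonpos_pos)
      then show ?thesis by (simp add: sm0_def cut0_eq_1 indicator_def)
    next
      case False
      then have "indicator {\<omega> \<in> space M. \<forall>j\<in>{1..p}. mix \<nu> \<omega> j \<le> u j} \<omega> = (0::real)" by (simp only: indicator_def) simp
      then show ?thesis using sm0_ge_0 by simp
    qed
  qed
  show "(\<integral>\<omega>. sm0 (1 / ln p) p (\<lambda>j. \<beta> * mix \<nu> \<omega> j - (\<beta> * u j - ln p)) \<partial>M) \<le> P \<nu> u"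
    unfolding P_eq_integral L_def[symmetric]
  proof (rule integral_mono[OF i ii])
    fix \<omega> assume \<omega>: "\<omega> \<in> space M"
    let ?w = "\<lambda>j. \<beta> * mix \<nu> \<omega> j - (\<beta> * u j - L)"
    show "sm0 (1 / L) p ?w \<le> indicator {\<omega> \<in> space M. \<forall>j\<in>{1..p}. mix \<nu> \<omega> j \<le> u j} \<omega>"
    proof (cases "\<forall>j\<in>{1..p}. mix \<nu> \<omega> j \<le> u j")
      case True
      then have "indicator {\<omega> \<in> space M. \<forall>j\<in>{1..p}. mix \<nu> \<omega> j \<le> u j} \<omega> = (1::real)" using \<omega> by (simp only: indicator_def) simp
      then show ?thesis using sm0_le_1 by simp
    next
      case False
      then obtain j where j: "j \<in> {1..p}" "u j < mix \<nu> \<omega> j" by (auto simp: not_le)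
      have "\<beta> * u j < \<beta> * mix \<nu> \<omega> j" using j(2) \<beta> by simp
      then have "L \<le> ?w j" by linarith
      also have "?w j \<le> lse p ?w" by (rule le_lse[OF j(1)])
      finally have "1 \<le> 1 / L * lse p ?w" using L by simp
      then have "sm0 (1 / L) p ?w = 0" by (simp only: sm0_def cut0_eq_0)
      then show ?thesis by simp
    qed
  qed
qed

text \<open>The upper and lower smooth approximations differ by a corner shift
  \<open>d = 2 * ln p / \<beta>\<close>. Comparison passes from the mixture to \<open>G\<close>
  between them, and anti-concentration pays for the shift on the Gaussian side.\<close>

lemma P_diff_bound:
  assumes b: "0 < b" and small: "2 * real D * (b * (6 * B * ln (real n * real p))) \<le> 1" and \<nu>: "0 \<le> \<nu>" "\<nu> \<le> 1"
  defines "\<beta> \<equiv> b * sqrt (real n)"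
  defines "A \<equiv> 36 * exp 4 * sqrt (ln p) * (ln p / \<beta>) / sqrt K3"
  shows "\<bar>P \<nu> u - P0 u\<bar> \<le> 624000 * (1 / ln p * real n * real D * real Ds) *
      (1296 * (b * B) ^ 3 * (exp 4 * (2 * \<rr> + A + 6 / n) + 6 / n) + 9000000 * (b * B) ^ 3 / n) + A"
proof -
  define \<Delta> where "\<Delta> = 624000 * (1 / ln p * real n * real D * real Ds) *
      (1296 * (b * B) ^ 3 * (exp 4 * (2 * \<rr> + A + 6 / n) + 6 / n) + 9000000 * (b * B) ^ 3 / n)"
  have \<beta>: "0 < \<beta>" using b n1 by (simp add: \<beta>_def)
  note sm = smooth_mix[OF b small \<nu>, folded \<beta>_def, folded A_def, folded \<Delta>_def]
  define d where "d = 2 * ln p / \<beta>"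
  have d0: "0 \<le> d" using ln_p \<beta> by (simp add: d_def)
  have AC: "P0 (\<lambda>j. w j + d) - P0 w \<le> A" for w
  proof -
    have "P0 (\<lambda>j. w j + d) - P0 w \<le> 4 * exp 4 * sqrt (ln p) * (d / sqrt K3)" by (rule anti_conc[OF d0])
    \<comment> \<open>The constant 8 of this shift is enlarged to 36, so that one quantity
      \<open>A\<close> covers both the shift and the strip.\<close>
    also have "\<dots> = 8 * (exp 4 * sqrt (ln p) * (ln p / \<beta>) / sqrt K3)" by (simp add: d_def)
    also have "\<dots> \<le> 36 * (exp 4 * sqrt (ln p) * (ln p / \<beta>) / sqrt K3)"
      using ln_p \<beta> K3 by (intro mult_right_mono) auto
    finally show ?thesis by (simp add: A_def)
  qed
  have \<beta>d: "\<beta> * (w + d) = \<beta> * w + 2 * ln p" for w using \<beta> by (simp add: d_def distrib_left)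
  have "P \<nu> u \<le> (\<integral>\<omega>. sm0 (1 / ln p) p (\<lambda>j. \<beta> * mix \<nu> \<omega> j - (\<beta> * u j + ln p)) \<partial>M)" by (rule sandwich(1)[OF \<beta>])
  also have "\<dots> \<le> (\<integral>\<omega>. sm0 (1 / ln p) p (\<lambda>j. \<beta> * G \<omega> j - (\<beta> * u j + ln p)) \<partial>M) + \<Delta>"
    using sm[of "\<lambda>j. \<beta> * u j + ln p"] by (simp add: abs_le_iff)
  also have "(\<integral>\<omega>. sm0 (1 / ln p) p (\<lambda>j. \<beta> * G \<omega> j - (\<beta> * u j + ln p)) \<partial>M) \<le> P0 (\<lambda>j. u j + d)"
    using sandwich(2)[OF \<beta>, of 0 "\<lambda>j. u j + d"] unfolding P_0 mix_0 \<beta>d by (simp add: algebra_simps)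
  finally have 1: "P \<nu> u \<le> P0 u + A + \<Delta>" using AC[of u] by linarith
  have "P0 (\<lambda>j. u j - d) \<le> (\<integral>\<omega>. sm0 (1 / ln p) p (\<lambda>j. \<beta> * G \<omega> j - (\<beta> * u j - ln p)) \<partial>M)"
    using sandwich(1)[OF \<beta>, of 0 "\<lambda>j. u j - d"] \<beta>d[of "u _ - d"] unfolding P_0 mix_0 by (simp add: algebra_simps)
  also have "\<dots> \<le> (\<integral>\<omega>. sm0 (1 / ln p) p (\<lambda>j. \<beta> * mix \<nu> \<omega> j - (\<beta> * u j - ln p)) \<partial>M) + \<Delta>"
    using sm[of "\<lambda>j. \<beta> * u j - ln p"] by (simp add: abs_le_iff)
  also have "\<dots> \<le> P \<nu> u + \<Delta>" using sandwich(2)[OF \<beta>] by simp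
  finally have "P0 (\<lambda>j. u j - d) \<le> P \<nu> u + \<Delta>" .
  then have 2: "P0 u \<le> P \<nu> u + \<Delta> + A" using AC[of "\<lambda>j. u j - d"] by simp
  show ?thesis using 1 2 unfolding \<Delta>_def[symmetric] abs_le_iff by linarith
qed

section \<open>Choice of the scale and absorption\<close>

definition rate where
  "rate = B * (real D * real Ds) powr (1/3) * ln (real p) powr (7/6) / real n powr (1/6)"

text \<open>A rate of at least one is trivial. Below one, the truncation condition holds and the
  comparison yields \<open>varrho\<close> at most half of itself plus a multiple of
  \<open>rate\<close>; absorbing the half doubles the constant.\<close>

lemma varrho_le_rate:
  defines "A1 \<equiv> 624000 * 1296 * exp 4"
  defines "A2 \<equiv> 624000 * (1296 * (exp 4 + 1) * 6 + 9000000)"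
  defines "A3 \<equiv> 36 * exp 4 / sqrt K3"
  assumes \<epsilon>: "0 < \<epsilon>" "\<epsilon> \<le> 1" "12 * (1 + 1 / \<kappa>) * \<epsilon> \<le> 1" "4 * A1 * \<epsilon> \<le> 1"
  shows "\<rr> \<le> (2 * (A1 * A3 + A2 + A3 / \<epsilon>) + 1) * rate"
proof -
  \<comment> \<open>With sixth roots of \<open>n\<close> and \<open>ln p\<close> and the cube root
    of the product of the degrees, all exponents in the computation become integers.\<close>
  define x where "x = real n powr (1/6)"
  define m where "m = (real D * real Ds) powr (1/3)"
  define l where "l = ln (real p) powr (1/6)"
  have DD: "1 \<le> real D" "1 \<le> real Ds" using degrees_ge_1 by auto
  then have DDs: "1 \<le> real D * real Ds" using mult_mono[of 1 "real D" 1 "real Ds"] by simp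
  have x: "1 \<le> x" "x ^ 6 = real n" "x ^ 3 = sqrt (real n)"
    using n1 by (auto simp: x_def powr_power powr_half_sqrt intro: ge_one_powr_ge_zero)
  have m: "1 \<le> m" "m ^ 3 = real D * real Ds"
    using DDs DD by (auto simp: m_def powr_power intro: ge_one_powr_ge_zero)
  have l: "1 \<le> l" "l ^ 6 = ln (real p)" "l ^ 3 = sqrt (ln (real p))" "l ^ 7 = ln (real p) powr (7/6)"
    using ln_p by (auto simp: l_def powr_power powr_half_sqrt intro: ge_one_powr_ge_zero)
  have R: "rate = B * m * l ^ 7 / x" by (simp add: rate_def m_def x_def l(4))
  have pos: "0 < x" "0 < m" "0 < l" "0 < B" using x m l B1 by auto
  have A3: "0 \<le> A3" using K3 by (simp add: A3_def)
  have A12: "0 \<le> A1" "0 \<le> A2" by (simp_all add: A1_def A2_def)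
  have R0: "0 < rate" unfolding R using pos by simp
  show ?thesis
  proof (cases "1 \<le> rate")
    case True
    have "\<rr> \<le> 1" by (rule varrho_le[OF abs_P_le_1])
    also have "1 \<le> 1 * rate" using True by simp
    also have "\<dots> \<le> (2 * (A1 * A3 + A2 + A3 / \<epsilon>) + 1) * rate"
      using A3 A12 \<epsilon>(1) R0 by (intro mult_right_mono) auto
    finally show ?thesis .
  next
    case False
    \<comment> \<open>The scale for which \<open>sqrt (ln p) * ln p / (b * sqrt n)\<close> equals
      \<open>rate / \<epsilon>\<close>; the prefactor of the remainder is then
      \<open>\<epsilon> ^ 3\<close>.\<close>
    define b where "b = \<epsilon> * l ^ 2 / (B * m * x ^ 2)"
    have b: "0 < b" using \<epsilon>(1) pos by (simp add: b_def)
    have bs: "b * sqrt (real n) = \<epsilon> * l ^ 2 * x / (B * m)"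
      unfolding b_def x(3)[symmetric] using pos by (simp add: field_simps power2_eq_square power3_eq_cube)
    have small: "2 * real D * (b * (6 * B * ln (real n * real p))) \<le> 1"
    proof -
      have "2 * real D * (b * (6 * B * ln (real n * real p))) \<le> 2 * real D * (b * (6 * B * ((1 + 1 / \<kappa>) * l ^ 6)))"
        using ln_np b B0 unfolding l(2) by (intro mult_left_mono) auto
      also have "\<dots> = (12 * (1 + 1 / \<kappa>) * \<epsilon>) * (real D * l ^ 8 / (m * x ^ 2))"
        unfolding b_def using pos by (simp add: field_simps eval_nat_numeral)
      also have "\<dots> \<le> 1 * (real D * l ^ 8 / (m * x ^ 2))"
        using \<epsilon>(3) pos by (intro mult_right_mono) auto
      \<comment> \<open>Here \<open>D\<close> is at most \<open>m ^ 3\<close> because the second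
        degree is at least one. The comparison is arranged so that its right-hand side is the square
        of \<open>rate\<close>, which is at most one in this case.\<close>
      also have "real D * l ^ 8 / (m * x ^ 2) \<le> B ^ 2 * m ^ 2 * l ^ 14 / x ^ 2"
      proof -
        have "real D * l ^ 8 \<le> m ^ 3 * l ^ 14"
          using DD l(1) pos unfolding m(2) by (intro mult_mono power_increasing) auto
        also have "\<dots> \<le> B ^ 2 * (m ^ 3 * l ^ 14)"
          using B1 pos mult_right_mono[of 1 "B ^ 2" "m ^ 3 * l ^ 14"] by simp
        finally have "real D * l ^ 8 \<le> B ^ 2 * m ^ 2 * l ^ 14 * m"
          by (simp add: power3_eq_cube power2_eq_square ac_simps)
        then have "real D * l ^ 8 / m \<le> B ^ 2 * m ^ 2 * l ^ 14" using pos by (simp add: pos_divide_le_eq)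
        then have "real D * l ^ 8 / m / x ^ 2 \<le> B ^ 2 * m ^ 2 * l ^ 14 / x ^ 2" by (rule divide_right_mono) simp
        then show ?thesis by simp
      qed
      also have "B ^ 2 * m ^ 2 * l ^ 14 / x ^ 2 = rate ^ 2"
        unfolding R by (simp add: power_divide power_mult_distrib power_mult[symmetric])
      also have "rate ^ 2 \<le> 1" using False R0 by (intro power_le_one) auto
      finally show ?thesis by simp
    qed
    define A where "A = A3 * (rate / \<epsilon>)"
    have A_eq: "36 * exp 4 * sqrt (ln p) * (ln p / (b * sqrt (real n))) / sqrt K3 = A"
    proof -
      have "sqrt (ln p) * (ln p / (b * sqrt (real n))) = rate / \<epsilon>"
        unfolding l(3)[symmetric] unfolding bs R l(2)[symmetric] using pos \<epsilon>(1)
        by (simp add: field_simps eval_nat_numeral)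
      then have eq: "A = 36 * exp 4 / sqrt K3 * (sqrt (ln p) * (ln p / (b * sqrt (real n))))" by (simp only: A_def A3_def)
      show ?thesis unfolding eq by (simp add: ac_simps)
    qed
    \<comment> \<open>The powers of \<open>l\<close>, \<open>x\<close> and \<open>m\<close> cancel
      exactly, so the prefactor depends on neither \<open>n\<close>, \<open>p\<close> nor the
      graph.\<close>
    have F: "1 / ln p * real n * real D * real Ds * (b * B) ^ 3 = \<epsilon> ^ 3"
    proof -
      have bB: "b * B = \<epsilon> * l ^ 2 / (m * x ^ 2)" unfolding b_def using pos by (simp add: field_simps)
      have "1 / ln p * real n * real D * real Ds * (b * B) ^ 3 = 1 / l ^ 6 * x ^ 6 * m ^ 3 * (b * B) ^ 3"
        by (simp add: x m l mult.assoc)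
      also have "\<dots> = \<epsilon> ^ 3"
        unfolding bB using pos by (simp add: power_divide power_mult_distrib power_mult[symmetric])
      finally show ?thesis .
    qed
    have n_rate: "1 / real n \<le> rate"
    proof -
      have "1 / real n \<le> 1 / x"
        unfolding x(2)[symmetric] using x(1) pos self_le_power[of x 6] by (intro divide_left_mono) auto
      also have "\<dots> \<le> B * m * l ^ 7 / x"
      proof (rule divide_right_mono)
        have "1 * 1 * 1 \<le> B * m * l ^ 7" using B1 m(1) l(1) by (intro mult_mono one_le_power) auto
        then show "1 \<le> B * m * l ^ 7" by simp
      qed (use pos in simp)
      finally show ?thesis unfolding R .
    qed
    have e3: "\<epsilon> ^ 3 \<le> \<epsilon>" "0 \<le> \<epsilon> ^ 3" "\<epsilon> ^ 3 \<le> 1"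
      using \<epsilon> power_decreasing[of 1 3 \<epsilon>] by (auto intro: power_le_one)
    have r0: "0 \<le> \<rr>" using order_trans[OF abs_ge_zero varrho_ge[of 0]] by simp
    have A0: "0 \<le> A" using A3 R0 \<epsilon> by (simp add: A_def)
    \<comment> \<open>The coefficient of \<open>\<rr>\<close> is
      \<open>2 * A1 * \<epsilon> ^ 3\<close>, at most one half by the choice of
      \<open>\<epsilon>\<close>. The terms of order \<open>1 / n\<close> are below
      \<open>rate\<close>.\<close>
    have "\<rr> \<le> \<rr> / 2 + (A1 * A3 + A2 + A3 / \<epsilon>) * rate"
    proof (rule varrho_le)
      fix u \<nu> :: "nat \<Rightarrow> real" and \<nu>' :: real
      assume \<nu>: "0 \<le> \<nu>'" "\<nu>' \<le> 1"
      have "\<bar>P \<nu>' u - P0 u\<bar> \<le> 624000 * (1 / ln p * real n * real D * real Ds) *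
        (1296 * (b * B) ^ 3 * (exp 4 * (2 * \<rr> + A + 6 / n) + 6 / n) + 9000000 * (b * B) ^ 3 / n) + A"
        using P_diff_bound[OF b small \<nu>, of u] unfolding A_eq .
      also have "624000 * (1 / ln p * real n * real D * real Ds) *
        (1296 * (b * B) ^ 3 * (exp 4 * (2 * \<rr> + A + 6 / n) + 6 / n) + 9000000 * (b * B) ^ 3 / n)
        = 624000 * (1 / ln p * real n * real D * real Ds * (b * B) ^ 3) *
          (1296 * (exp 4 * (2 * \<rr> + A + 6 * (1 / n)) + 6 * (1 / n)) + 9000000 * (1 / n))"
        by (simp add: algebra_simps)
      also have "\<dots> = 2 * A1 * \<epsilon> ^ 3 * \<rr> + A1 * (\<epsilon> ^ 3 * A) + A2 * (\<epsilon> ^ 3 * (1 / n))"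
        unfolding F A1_def A2_def by (simp add: algebra_simps)
      also have "2 * A1 * \<epsilon> ^ 3 * \<rr> \<le> 1 / 2 * \<rr>"
      proof (rule mult_right_mono[OF _ r0])
        have "A1 * \<epsilon> ^ 3 \<le> A1 * \<epsilon>" using e3(1) A12(1) by (rule mult_left_mono)
        then show "2 * A1 * \<epsilon> ^ 3 \<le> 1 / 2" using \<epsilon>(4) by linarith
      qed
      also have "A1 * (\<epsilon> ^ 3 * A) \<le> A1 * (A3 * rate)"
      proof (rule mult_left_mono[OF _ A12(1)])
        have "\<epsilon> ^ 3 * A \<le> \<epsilon> * A" using e3(1) A0 by (rule mult_right_mono)
        also have "\<dots> = A3 * rate" using \<epsilon>(1) by (simp add: A_def)
        finally show "\<epsilon> ^ 3 * A \<le> A3 * rate" .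
      qed
      also have "A2 * (\<epsilon> ^ 3 * (1 / n)) \<le> A2 * (1 * rate)"
        using e3 n_rate R0 A12(2) by (intro mult_left_mono mult_mono) auto
      finally show "\<bar>P \<nu>' u - P0 u\<bar> \<le> \<rr> / 2 + (A1 * A3 + A2 + A3 / \<epsilon>) * rate"
        by (simp add: A_def algebra_simps)
    qed
    moreover have "(2 * (A1 * A3 + A2 + A3 / \<epsilon>) + 1) * rate = 2 * ((A1 * A3 + A2 + A3 / \<epsilon>) * rate) + rate"
      by (simp only: distrib_right mult.assoc mult_1_left)
    ultimately show ?thesis using R0 by linarith
  qed
qed

end

theorem theorem2:
  fixes \<kappa> \<gamma>1 K3 :: real
  assumes "\<kappa> > 0" and "\<gamma>1 \<ge> 1" and "K3 > 0"
  shows "\<exists>c>0. \<forall>(M :: nat \<Rightarrow> 'a measure) (p :: nat \<Rightarrow> nat)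
      (X :: nat \<Rightarrow> nat \<Rightarrow> 'a \<Rightarrow> nat \<Rightarrow> real) (G :: nat \<Rightarrow> 'a \<Rightarrow> nat \<Rightarrow> real)
      (E :: nat \<Rightarrow> (nat \<times> nat) set) (B :: nat \<Rightarrow> real).
    (\<forall>n\<ge>1.
       prob_space (M n) \<and>
       real (p n) \<ge> real n powr \<kappa> \<and>
       (\<forall>t\<in>{1..n}. X n t \<in> M n \<rightarrow>\<^sub>M rvec (p n)) \<and>
       (\<forall>t\<in>{1..n}. \<forall>j\<in>{1..p n}. prob_space.expectation (M n) (\<lambda>\<omega>. X n t \<omega> j) = 0) \<and>
       B n \<ge> 1 \<and>
       (\<forall>t\<in>{1..n}. \<forall>j\<in>{1..p n}. psi_norm (M n) \<gamma>1 (\<lambda>\<omega>. X n t \<omega> j) \<le> ennreal (B n)) \<and>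
       (\<forall>j\<in>{1..p n}. prob_space.variance (M n) (\<lambda>\<omega>. normalized_sum n (X n) \<omega> j) \<ge> K3) \<and>
       multivariate_normal (M n) (p n) (\<lambda>_. 0)
         (\<lambda>j k. covariance (M n) (\<lambda>\<omega>. normalized_sum n (X n) \<omega> j)
                                   (\<lambda>\<omega>. normalized_sum n (X n) \<omega> k))
         (G n) \<and>
       indep_of_sample (M n) n (p n) (X n) (G n) \<and>
       dependency_graph (M n) n (p n) (X n) (E n))
    \<longrightarrow>
    limsup (\<lambda>n. ereal
      (varrho (M n) n (p n) (X n) (G n) /
       (B n * (real (max_degree n (E n)) * real (max_degree2 n (E n))) powr (1/3)
          * ln (real (p n)) powr (7/6) / real n powr (1/6)))) \<le> ereal c"
proof -
  define A1 :: real where "A1 = 624000 * 1296 * exp 4"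
  define A2 :: real where "A2 = 624000 * (1296 * (exp 4 + 1) * 6 + 9000000)"
  define A3 where "A3 = 36 * exp 4 / sqrt K3"
  define k1 where "k1 = 12 * (1 + 1 / \<kappa>)"
  \<comment> \<open>The first bound secures the truncation condition, the second the absorption.
    Both involve fixed constants only, so \<open>c\<close> is chosen before the sequence of
    models.\<close>
  define \<epsilon> where "\<epsilon> = min (1 / k1) (1 / (4 * A1))"
  define c where "c = 2 * (A1 * A3 + A2 + A3 / \<epsilon>) + 1"
  have A: "1 \<le> A1" "0 \<le> A2" "0 \<le> A3"
  proof -
    have "1 \<le> exp (4::real)" by simp
    then show "1 \<le> A1" unfolding A1_def by linarith
  qed (use assms in \<open>simp_all add: A2_def A3_def\<close>)
  have k1: "1 \<le> k1" using assms by (simp add: k1_def)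
  have \<epsilon>: "0 < \<epsilon>" "\<epsilon> \<le> 1 / k1" "\<epsilon> \<le> 1 / (4 * A1)" using k1 A by (auto simp: \<epsilon>_def)
  have "k1 * \<epsilon> \<le> k1 * (1 / k1)" "4 * A1 * \<epsilon> \<le> 4 * A1 * (1 / (4 * A1))"
    using \<epsilon> k1 A by (intro mult_left_mono; simp)+
  then have \<epsilon>k: "k1 * \<epsilon> \<le> 1" "4 * A1 * \<epsilon> \<le> 1" using k1 A by simp_all
  have "1 / k1 \<le> 1" using k1 by simp
  then have \<epsilon>1: "\<epsilon> \<le> 1" using \<epsilon>(2) by linarith
  have c: "0 < c" unfolding c_def using A \<epsilon>(1) by (intro add_nonneg_pos) auto
  show ?thesis
  proof (intro exI[of _ c] conjI c allI impI)
    fix M :: "nat \<Rightarrow> 'a measure" and p :: "nat \<Rightarrow> nat"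
      and X :: "nat \<Rightarrow> nat \<Rightarrow> 'a \<Rightarrow> nat \<Rightarrow> real" and G :: "nat \<Rightarrow> 'a \<Rightarrow> nat \<Rightarrow> real"
      and E :: "nat \<Rightarrow> (nat \<times> nat) set" and B :: "nat \<Rightarrow> real"
    let ?A = "\<lambda>n. prob_space (M n) \<and>
       real (p n) \<ge> real n powr \<kappa> \<and>
       (\<forall>t\<in>{1..n}. X n t \<in> M n \<rightarrow>\<^sub>M rvec (p n)) \<and>
       (\<forall>t\<in>{1..n}. \<forall>j\<in>{1..p n}. prob_space.expectation (M n) (\<lambda>\<omega>. X n t \<omega> j) = 0) \<and>
       B n \<ge> 1 \<and>
       (\<forall>t\<in>{1..n}. \<forall>j\<in>{1..p n}. psi_norm (M n) \<gamma>1 (\<lambda>\<omega>. X n t \<omega> j) \<le> ennreal (B n)) \<and>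
       (\<forall>j\<in>{1..p n}. prob_space.variance (M n) (\<lambda>\<omega>. normalized_sum n (X n) \<omega> j) \<ge> K3) \<and>
       multivariate_normal (M n) (p n) (\<lambda>_. 0)
         (\<lambda>j k. covariance (M n) (\<lambda>\<omega>. normalized_sum n (X n) \<omega> j)
                                   (\<lambda>\<omega>. normalized_sum n (X n) \<omega> k))
         (G n) \<and>
       indep_of_sample (M n) n (p n) (X n) (G n) \<and>
       dependency_graph (M n) n (p n) (X n) (E n)"
    assume hyp: "\<forall>n\<ge>1. ?A n"
    define R where "R n = B n * (real (max_degree n (E n)) * real (max_degree2 n (E n))) powr (1/3)
          * ln (real (p n)) powr (7/6) / real n powr (1/6)" for n
    \<comment> \<open>This supplies \<open>3 \<le> p n\<close>; the finitely many earlier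
      \<open>n\<close> do not affect the limit superior.\<close>
    have large: "\<forall>\<^sub>F n in sequentially. 3 \<le> real n powr \<kappa>"
      using assms(1) by real_asymp
    have "\<forall>\<^sub>F n in sequentially. ereal (varrho (M n) n (p n) (X n) (G n) / R n) \<le> ereal c"
      using large eventually_ge_at_top[of 1]
    proof eventually_elim
      case (elim n)
      have h: "?A n" using hyp elim(2) by blast
      have p3: "3 \<le> p n" using elim(1) h by linarith
      interpret prob_space "M n" using h by blast
      interpret clt_setting "M n" n "p n" "X n" "G n" "E n" "B n" \<kappa> \<gamma>1 K3
        by unfold_locales (use h p3 elim assms in auto)
      have "varrho (M n) n (p n) (X n) (G n) \<le> c * R n"
        using varrho_le_rate[OF \<epsilon>(1) \<epsilon>1 \<epsilon>k(1)[unfolded k1_def] \<epsilon>k(2)[unfolded A1_def]]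
        unfolding c_def A1_def A2_def A3_def rate_def R_def .
      moreover have "0 < R n"
        using degrees_ge_1 B1 ln_p n1 unfolding R_def by (intro divide_pos_pos mult_pos_pos) auto
      ultimately show ?case by (simp add: pos_divide_le_eq)
    qed
    then have "limsup (\<lambda>n. ereal (varrho (M n) n (p n) (X n) (G n) / R n)) \<le> ereal c"
      by (rule Limsup_bounded)
    then show "limsup (\<lambda>n. ereal
      (varrho (M n) n (p n) (X n) (G n) /
       (B n * (real (max_degree n (E n)) * real (max_degree2 n (E n))) powr (1/3)
          * ln (real (p n)) powr (7/6) / real n powr (1/6)))) \<le> ereal c"
      unfolding R_def .
  qed
qed

end
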